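(* There exists a constant $C>0$ such that for every $k\in\mathbb{Z}$ and every $u_0\in L^2(\mathbb{R}^2)$, $$\|e^{it\Delta}P_ku_0\|_{L^2_{x_1}L^\infty_{x_2,t}L^2_\theta}\le C\,2^{k/2}\|u_0\|_{L^2(\mathbb{R}^2)}.$$
   Context: $e^{it\Delta}$ is the Schrödinger propagator on $\mathbb{R}^2$, i.e. the Fourier multiplier $e^{-it|\xi|^2}$. Let $\eta:\mathbb{R}\to[0,1]$ be an even, radially decreasing smooth function supported in $\{|\xi|\le 8/5\}$ with $\eta\equiv1$ for $|\xi|\le 5/4$; for $k\in\mathbb{Z}$ put $\chi_k(\xi)=\eta(\xi/2^k)-\eta(\xi/2^{k-1})$. The Littlewood–Paley projector $P_k$ is defined by $\widehat{P_ku}(\xi)=\chi_k(|\xi|)\widehat u(\xi)$. Let $A_\theta=\begin{pmatrix}\cos\theta&-\sin\theta\\ \sin\theta&\cos\theta\end{pmatrix}$. For a function $f(x,t)$ on $\mathbb{R}^2\times\mathbb{R}$ with $x=(x_1,x_2)$, $$\|f\|_{L^2_{x_1}L^\infty_{x_2,t}L^2_\theta}=\left\|\left(\int_0^{2\pi}|f(A_\theta x,t)|^2\,d\theta\right)^{1/2}\right\|_{L^2_{x_1}L^\infty_{x_2,t}},\qquad \|g\|_{L^2_{x_1}L^\infty_{x_2,t}}=\left(\int_{\mathbb{R}}\Big(\sup_{x_2,t}|g(x_1,x_2,t)|\Big)^2dx_1\right)^{1/2}$$ (essential supremum). *)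

theory Defs
  imports "HOL-Analysis.Analysis" "HOL-Probability.Essential_Supremum"
begin

section \<open>Square-integrable functions on the plane\<close>

definition square_integrable :: "(real^2 \<Rightarrow> complex) \<Rightarrow> bool" where
  "square_integrable u \<longleftrightarrow>
     u \<in> borel_measurable lebesgue \<and> integrable lebesgue (\<lambda>x. (norm (u x))\<^sup>2)"

definition L2_norm :: "(real^2 \<Rightarrow> complex) \<Rightarrow> real" where
  "L2_norm u = sqrt (\<integral>x. (norm (u x))\<^sup>2 \<partial>lebesgue)"

section \<open>Fourier transform and Fourier multipliers\<close>

definition fourier_integral :: "(real^2 \<Rightarrow> complex) \<Rightarrow> real^2 \<Rightarrow> complex" where
  "fourier_integral u \<xi> = (\<integral>x. cis (- (x \<bullet> \<xi>)) * u x \<partial>lebesgue)"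

text \<open>
  \<open>v\<close> is an \<open>L\<^sup>2\<close> Fourier transform of \<open>u\<close>: it is the limit in \<open>L\<^sup>2\<close>, as \<open>R\<close> tends to infinity,
  of the Fourier integrals of \<open>u\<close> restricted to the ball of radius \<open>R\<close>.
\<close>

definition is_L2_fourier :: "(real^2 \<Rightarrow> complex) \<Rightarrow> (real^2 \<Rightarrow> complex) \<Rightarrow> bool" where
  "is_L2_fourier u v \<longleftrightarrow> square_integrable v \<and>
     ((\<lambda>R::real. \<integral>\<^sup>+\<xi>. ennreal ((norm (fourier_integral (\<lambda>x. indicator (ball 0 R) x * u x) \<xi>
                                          - v \<xi>))\<^sup>2) \<partial>lebesgue)
        \<longlongrightarrow> 0) at_top"

text \<open>
  On \<open>L\<^sup>2\<close> the Fourier transform is determined only up to null sets. The representative chosen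
  here is the continuous one, given by the Fourier integral, whenever \<open>u\<close> is also integrable.
\<close>

definition fourier :: "(real^2 \<Rightarrow> complex) \<Rightarrow> real^2 \<Rightarrow> complex" where
  "fourier u = (if integrable lebesgue u then fourier_integral u else (SOME v. is_L2_fourier u v))"

definition inverse_fourier :: "(real^2 \<Rightarrow> complex) \<Rightarrow> real^2 \<Rightarrow> complex" where
  "inverse_fourier g x = of_real (1 / (2 * pi)\<^sup>2) * fourier g (- x)"

definition fourier_multiplier ::
    "(real^2 \<Rightarrow> complex) \<Rightarrow> (real^2 \<Rightarrow> complex) \<Rightarrow> real^2 \<Rightarrow> complex" where
  "fourier_multiplier m u = inverse_fourier (\<lambda>\<xi>. m \<xi> * fourier u \<xi>)"

text \<open>
  When the multiplier is applied to a function whose Fourier transform has compact support,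
  the value is given by an absolutely convergent integral. It is therefore the jointly
  continuous representative in space and time, rather than an arbitrary choice at each time.
\<close>

definition schroedinger :: "real \<Rightarrow> (real^2 \<Rightarrow> complex) \<Rightarrow> real^2 \<Rightarrow> complex" where
  "schroedinger t = fourier_multiplier (\<lambda>\<xi>. cis (- t * (norm \<xi>)\<^sup>2))"

section \<open>Littlewood--Paley projectors\<close>

definition LP_bump :: "(real \<Rightarrow> real) \<Rightarrow> bool" where
  "LP_bump \<eta> \<longleftrightarrow>
     (\<forall>r. 0 \<le> \<eta> r \<and> \<eta> r \<le> 1) \<and>
     (\<forall>r. \<eta> (- r) = \<eta> r) \<and>
     (\<forall>r s. \<bar>r\<bar> \<le> \<bar>s\<bar> \<longrightarrow> \<eta> s \<le> \<eta> r) \<and>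
     (\<forall>n r. (deriv ^^ n) \<eta> field_differentiable at r) \<and>
     (\<forall>r. \<bar>r\<bar> > 8/5 \<longrightarrow> \<eta> r = 0) \<and>
     (\<forall>r. \<bar>r\<bar> \<le> 5/4 \<longrightarrow> \<eta> r = 1)"

definition LP_chi :: "(real \<Rightarrow> real) \<Rightarrow> int \<Rightarrow> real \<Rightarrow> real" where
  "LP_chi \<eta> k r = \<eta> (r / 2 powi k) - \<eta> (r / 2 powi (k - 1))"

definition LP_proj :: "(real \<Rightarrow> real) \<Rightarrow> int \<Rightarrow> (real^2 \<Rightarrow> complex) \<Rightarrow> real^2 \<Rightarrow> complex" where
  "LP_proj \<eta> k = fourier_multiplier (\<lambda>\<xi>. of_real (LP_chi \<eta> k (norm \<xi>)))"

section \<open>The mixed norm\<close>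

definition esqrt :: "ennreal \<Rightarrow> ennreal" where
  "esqrt a = (if a = \<infinity> then \<infinity> else ennreal (sqrt (enn2real a)))"

definition rot :: "real \<Rightarrow> real^2^2" where
  "rot \<theta> = vector [vector [cos \<theta>, - sin \<theta>], vector [sin \<theta>, cos \<theta>]]"

definition angular_L2 :: "(real^2 \<Rightarrow> real \<Rightarrow> complex) \<Rightarrow> real^2 \<Rightarrow> real \<Rightarrow> ennreal" where
  "angular_L2 f x t =
     esqrt (\<integral>\<^sup>+\<theta>\<in>{0..2 * pi}. ennreal ((norm (f (rot \<theta> *v x) t))\<^sup>2) \<partial>lebesgue)"

text \<open>The essential supremum is taken over the pair \<open>(x\<^sub>2, t)\<close>.\<close>

definition L2_Linf_norm :: "(real^2 \<Rightarrow> real \<Rightarrow> ennreal) \<Rightarrow> ennreal" where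
  "L2_Linf_norm g =
     esqrt (\<integral>\<^sup>+x1. (esssup lebesgue (\<lambda>(x2, t). g (vector [x1, x2]) t))\<^sup>2 \<partial>lebesgue)"

definition L2_Linf_L2_norm :: "(real^2 \<Rightarrow> real \<Rightarrow> complex) \<Rightarrow> ennreal" where
  "L2_Linf_L2_norm f = L2_Linf_norm (angular_L2 f)"

end

theory Submission
  imports Defs "HOL-Probability.Characteristic_Functions"
begin

text \<open>
  The evolution of a frequency-localised function is
  \<open>f(x, t) = \<integral> exp(i x \<bullet> \<xi> - i t |\<xi>|\<^sup>2) h(\<xi>) d\<xi>\<close>, where \<open>h\<close> is, up to a constant, the Fourier transform
  of \<open>u\<^sub>0\<close> times the cutoff, supported in \<open>|\<xi>| \<le> r\<close> with \<open>r\<close> comparable to \<open>2\<^sup>k\<close>. After averaging over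
  rotations the quantity to bound depends on \<open>x\<close> only through \<open>|x|\<close>, and \<open>|x| \<ge> |x\<^sub>1|\<close>. With \<open>S\<^sub>i\<close> the
  supremum, over \<open>t\<close> and over \<open>x\<close> with \<open>2\<^sup>i \<le> |x| \<le> 2\<^bsup>i+1\<^esup>\<close>, of the squared \<open>L\<^sup>2\<close> norm of \<open>f\<close> over the circle through \<open>x\<close>,
  the square of the left-hand side is therefore at most a constant times \<open>\<Sum>\<^sub>i 2\<^sup>i S\<^sub>i\<close>.

  The point is that \<open>\<Sum>\<^sub>i 2\<^sup>i S\<^sub>i \<le> C 2\<^sup>k \<parallel>h\<parallel>\<^sup>2\<close>, with no logarithmic loss from the infinitely many scales.
  Choose one circle of radius \<open>\<rho>\<^sub>i\<close> about \<open>2\<^sup>i\<close> and one time \<open>t\<^sub>i\<close> for each \<open>i\<close>. By the \<open>T T\<^sup>*\<close> principle and Schur's test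
  (\<open>schur_TTstar\<close>) it suffices to bound the inner products of the plane waves
  \<open>exp(i x \<bullet> \<xi> - i t\<^sub>i |\<xi>|\<^sup>2)\<close>, as functions of \<open>\<xi>\<close>, for \<open>x\<close> on the chosen circles. As \<open>h\<close> is
  supported in \<open>|\<xi>| \<le> r\<close>, a Gaussian weight of width \<open>2\<^sup>k\<close> may be inserted at the cost of a constant, and then all inner products
  are explicit. On one circle they are Gaussians in the distance, whose integral over the circle is of size
  \<open>2\<^sup>k / \<rho>\<^sub>i\<close>. For the circles \<open>i \<noteq> j\<close> the dispersive bound (\<open>chirp_gaussian_dispersion\<close>)
  gives a constant times \<open>2\<^sup>k / |x - y|\<close> uniformly in the times, and \<open>|x - y|\<close> is at least half of the larger
  radius if \<open>|i - j| \<ge> 2\<close>; with the weights \<open>2\<^sup>i\<close> this is \<open>2\<^sup>k\<close> times a geometric factor \<open>2\<^bsup>-|i-j|/2\<^esup>\<close>, so the rows sum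
  (\<open>separated_circles_estimate\<close>). Neighbouring scales are kept apart by treating even and odd \<open>i\<close>
  separately.

  The multipliers are defined through the Fourier transform on \<open>L\<^sup>2\<close>, so the integral formula for \<open>f\<close> needs
  the existence of that transform and its inversion. The norm bound of Plancherel's theorem is
  again an instance of \<open>schur_TTstar\<close>; inversion is proved by pairing with indicators of boxes, regularising with a Gaussian, and
  Lebesgue differentiation (\<open>fourier_inverse_fourier_AE\<close>).
\<close>

section \<open>Gaussian integrals\<close>

lemma borel_measurable_cis [measurable (raw)]:
  "f \<in> borel_measurable M \<Longrightarrow> (\<lambda>x. cis (f x)) \<in> borel_measurable M"
  by (rule borel_measurable_continuous_on[where f = cis]) (auto intro!: continuous_intros)

lemma borel_measurable_cnj [measurable (raw)]:
  "f \<in> borel_measurable M \<Longrightarrow> (\<lambda>x. cnj (f x)) \<in> borel_measurable M"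
  by (rule borel_measurable_continuous_on[where f = cnj]) (auto intro!: continuous_intros)

lemma gaussian_fourier_real:
  fixes a z :: real
  assumes a: "a > 0"
  shows "integrable lborel (\<lambda>x::real. exp (- a * x\<^sup>2))"
    and "(\<integral>x. cis (z * x) * of_real (exp (- a * x\<^sup>2)) \<partial>lborel)
           = of_real (sqrt (pi / a) * exp (- z\<^sup>2 / (4 * a)))"
proof -
  \<comment> \<open>the standard deviation for which the normal density is a multiple of \<open>exp (- a * x\<^sup>2)\<close>\<close>
  define s where "s = 1 / sqrt (2 * a)"
  have s: "s > 0" using a by (simp add: s_def)
  have s2: "s\<^sup>2 = 1 / (2 * a)" using a by (simp add: s_def power_divide)
  have dens: "normal_density 0 s x * sqrt (pi / a) = exp (- a * x\<^sup>2)" for x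
    using a by (simp add: normal_density_def s2 real_sqrt_divide)
  have int_dens: "integrable lborel (normal_density 0 s)"
    using s by (rule integrable_normal_density)
  have "integrable lborel (\<lambda>x. normal_density 0 s x * sqrt (pi / a))"
    using int_dens by simp
  then show "integrable lborel (\<lambda>x::real. exp (- a * x\<^sup>2))"
    unfolding dens .
  have std: "(\<integral>x. std_normal_density x *\<^sub>R iexp (t * x) \<partial>lborel) = of_real (exp (- t\<^sup>2 / 2))" for t
  proof -
    have "char std_normal_distribution t = (\<integral>x. std_normal_density x *\<^sub>R iexp (t * x) \<partial>lborel)"
      unfolding char_def by (rule integral_density) (auto simp: normal_density_nonneg)
    then show ?thesis by (simp add: char_std_normal_distribution)
  qed
  have resc: "normal_density 0 s (0 + s * x) = std_normal_density x / s" for x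
    using s by (simp add: normal_density_def std_normal_density_def power_mult_distrib real_sqrt_mult)
  have "(\<integral>x. cis (z * x) * of_real (exp (- a * x\<^sup>2)) \<partial>lborel)
      = (\<integral>x. of_real (sqrt (pi / a)) * (of_real (normal_density 0 s x) * cis (z * x)) \<partial>lborel)"
    by (intro Bochner_Integration.integral_cong refl) (unfold dens[symmetric] of_real_mult, simp only: mult_ac)
  also have "\<dots> = of_real (sqrt (pi / a)) * (\<integral>x. of_real (normal_density 0 s x) * cis (z * x) \<partial>lborel)"
    by (subst integral_mult_right_zero) simp
  also have "(\<integral>x. of_real (normal_density 0 s x) * cis (z * x) \<partial>lborel)
      = s *\<^sub>R (\<integral>x. of_real (normal_density 0 s (0 + s * x)) * cis (z * (0 + s * x)) \<partial>lborel)"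
    by (subst lborel_integral_real_affine[of s _ 0]) (use s in auto)
  also have "\<dots> = (\<integral>x. s *\<^sub>R (of_real (normal_density 0 s (0 + s * x)) * cis (z * (0 + s * x))) \<partial>lborel)"
    by (rule integral_scaleR_right[symmetric])
  also have "\<dots> = (\<integral>x. std_normal_density x *\<^sub>R iexp ((z * s) * x) \<partial>lborel)"
    using s unfolding resc
    by (intro Bochner_Integration.integral_cong refl) (simp add: cis_conv_exp scaleR_conv_of_real mult_ac)
  also have "\<dots> = of_real (exp (- (z * s)\<^sup>2 / 2))" by (rule std)
  also have "- (z * s)\<^sup>2 / 2 = - z\<^sup>2 / (4 * a)" by (simp add: power_mult_distrib s2)
  finally show "(\<integral>x. cis (z * x) * of_real (exp (- a * x\<^sup>2)) \<partial>lborel)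
           = of_real (sqrt (pi / a) * exp (- z\<^sup>2 / (4 * a)))" 
    by simp
qed

lemma cis_sum: "finite A \<Longrightarrow> cis (\<Sum>i\<in>A. f i) = (\<Prod>i\<in>A. cis (f i))"
  by (induction A rule: finite_induct) (auto simp: cis_mult[symmetric])

lemma integral_lborel_prod:
  fixes f :: "'a::euclidean_space \<Rightarrow> real \<Rightarrow> complex"
  assumes f: "\<And>b. b \<in> Basis \<Longrightarrow> integrable lborel (f b)"
  shows "integrable lborel (\<lambda>x::'a. \<Prod>b\<in>Basis. f b (x \<bullet> b))"
    and "(\<integral>x. (\<Prod>b\<in>Basis. f b ((x::'a) \<bullet> b)) \<partial>lborel) = (\<Prod>b\<in>Basis. (\<integral>x. f b x \<partial>lborel))"
proof -
  interpret product_sigma_finite "\<lambda>_::'a. lborel :: real measure" ..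
  have [measurable]: "\<And>b. b \<in> Basis \<Longrightarrow> f b \<in> borel_measurable borel"
    using borel_measurable_integrable[OF f] by simp
  have eq: "(\<Prod>b\<in>Basis. f b ((\<Sum>c\<in>Basis. x c *\<^sub>R c) \<bullet> b)) = (\<Prod>b\<in>Basis. f b (x b))" for x :: "'a \<Rightarrow> real"
    by (intro prod.cong refl) simp
  have [measurable]: "(\<lambda>f. \<Sum>b\<in>Basis. f b *\<^sub>R b) \<in> measurable (\<Pi>\<^sub>M b\<in>Basis. lborel) (borel :: 'a measure)"
    by measurable
  note L = lborel_eq[where 'a = 'a]
  show "integrable lborel (\<lambda>x::'a. \<Prod>b\<in>Basis. f b (x \<bullet> b))"
    unfolding L
    by (subst integrable_distr_eq) (auto simp: eq intro!: product_integrable_prod f)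
  show "(\<integral>x. (\<Prod>b\<in>Basis. f b ((x::'a) \<bullet> b)) \<partial>lborel) = (\<Prod>b\<in>Basis. (\<integral>x. f b x \<partial>lborel))"
    unfolding L
    by (subst integral_distr) (auto simp: eq product_integral_prod f)
qed

lemma gaussian_fourier_euclidean:
  fixes z :: "'a::euclidean_space"
  assumes a: "a > 0"
  shows "integrable lborel (\<lambda>x::'a. cis (z \<bullet> x) * of_real (exp (- a * (norm x)\<^sup>2)))"
    and "(\<integral>x. cis (z \<bullet> x) * of_real (exp (- a * (norm x)\<^sup>2)) \<partial>lborel)
           = of_real (sqrt (pi / a) ^ DIM('a) * exp (- (norm z)\<^sup>2 / (4 * a)))"
proof -
  define f where "f b y = cis ((z \<bullet> b) * y) * of_real (exp (- a * y\<^sup>2))" for b :: 'a and y :: real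
  have int: "integrable lborel (f b)" for b
    unfolding f_def
    by (rule Bochner_Integration.integrable_bound[OF gaussian_fourier_real(1)[OF a]])
      (auto simp: norm_mult)
  have sq: "(norm x)\<^sup>2 = (\<Sum>b\<in>Basis. (x \<bullet> b)\<^sup>2)" for x :: 'a
    using euclidean_inner[of x x] by (simp only: power2_norm_eq_inner) (simp add: power2_eq_square)
  have eq: "cis (z \<bullet> x) * of_real (exp (- a * (norm x)\<^sup>2)) = (\<Prod>b\<in>Basis. f b (x \<bullet> b))" for x
    unfolding f_def sq
    by (subst euclidean_inner) (simp add: cis_sum prod.distrib sum_distrib_left exp_sum sum_negf[symmetric] del: sum_negf)
  show "integrable lborel (\<lambda>x::'a. cis (z \<bullet> x) * of_real (exp (- a * (norm x)\<^sup>2)))"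
    unfolding eq by (rule integral_lborel_prod) (rule int)
  have "(\<integral>x. cis (z \<bullet> x) * of_real (exp (- a * (norm x)\<^sup>2)) \<partial>lborel) = (\<Prod>b\<in>Basis. (\<integral>x. f b x \<partial>lborel))"
    unfolding eq by (rule integral_lborel_prod) (rule int)
  also have "\<dots> = (\<Prod>b\<in>Basis. of_real (sqrt (pi / a) * exp (- (z \<bullet> b)\<^sup>2 / (4 * a))))"
    unfolding f_def gaussian_fourier_real(2)[OF a] ..
  also have "\<dots> = of_real (sqrt (pi / a) ^ DIM('a) * exp (- (norm z)\<^sup>2 / (4 * a)))"
    unfolding sq by (simp add: prod.distrib of_real_prod[symmetric] exp_sum[symmetric] sum_divide_distrib sum_negf del: of_real_prod)
  finally show "(\<integral>x. cis (z \<bullet> x) * of_real (exp (- a * (norm x)\<^sup>2)) \<partial>lborel)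
           = of_real (sqrt (pi / a) ^ DIM('a) * exp (- (norm z)\<^sup>2 / (4 * a)))" .
qed

lemma integrable_gaussian:
  assumes "a > 0"
  shows "integrable lborel (\<lambda>x::'a::euclidean_space. exp (- a * (norm x)\<^sup>2))"
  using integrable_norm[OF gaussian_fourier_euclidean(1)[OF assms, of "0::'a"]] by (simp add: norm_mult)

lemma gaussian_fourier_plane:
  fixes z :: "real^2"
  assumes a: "a > 0"
  shows "(\<integral>x. cis (z \<bullet> x) * of_real (exp (- a * (norm x)\<^sup>2)) \<partial>lborel)
           = of_real (pi / a * exp (- (norm z)\<^sup>2 / (4 * a)))"
  using gaussian_fourier_euclidean(2)[OF a, of z] a by simp

lemma gaussian_integral_plane:
  assumes a: "a > 0"
  shows "(\<integral>x. exp (- a * (norm (x::real^2))\<^sup>2) \<partial>lborel) = pi / a"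
proof -
  have "(\<integral>x. complex_of_real (exp (- a * (norm (x::real^2))\<^sup>2)) \<partial>lborel) = of_real (pi / a)"
    using gaussian_fourier_plane[OF a, of 0] by simp
  then show ?thesis
    by (metis integral_complex_of_real of_real_eq_iff)
qed

lemma integrable_mult_gaussian:
  fixes f :: "'a::euclidean_space \<Rightarrow> complex"
  assumes a: "a > 0" and [measurable]: "f \<in> borel_measurable borel" and b: "\<And>x. norm (f x) \<le> 1"
  shows "integrable lborel (\<lambda>x. f x * of_real (exp (- a * (norm x)\<^sup>2)))"
  by (rule Bochner_Integration.integrable_bound[OF integrable_gaussian[OF a]])
    (auto simp: norm_mult b intro!: mult_left_le_one_le)

lemma lborel_integral_shift:
  fixes f :: "'a::euclidean_space \<Rightarrow> 'b::{banach, second_countable_topology}"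
  assumes [measurable]: "f \<in> borel_measurable borel"
  shows "(\<integral>x. f (c + x) \<partial>lborel) = (\<integral>x. f x \<partial>lborel)"
  by (subst (2) lborel_distr_plus[of c, symmetric]) (subst integral_distr, auto)

lemma norm_integral_le_nn_integral:
  fixes f :: "'a \<Rightarrow> 'b::{banach, second_countable_topology}"
  shows "ennreal (norm (integral\<^sup>L M f)) \<le> (\<integral>\<^sup>+x. ennreal (norm (f x)) \<partial>M)"
proof (cases "integrable M f")
  case True
  then show ?thesis by (rule integral_norm_bound_ennreal)
qed (simp add: not_integrable_integral_eq)

text \<open>
  Every use of Fubini's theorem below is for an integrand dominated by a product of integrable functions of
  the separate variables.
\<close>

lemma (in pair_sigma_finite) integrable_pair_bound:
  fixes h :: "'a \<Rightarrow> 'b \<Rightarrow> 'c::{banach, second_countable_topology}"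
  assumes [measurable]: "(\<lambda>(x, y). h x y) \<in> borel_measurable (M1 \<Otimes>\<^sub>M M2)"
    and f: "integrable M1 f" and g: "integrable M2 g"
    and le: "\<And>x y. x \<in> space M1 \<Longrightarrow> y \<in> space M2 \<Longrightarrow> norm (h x y) \<le> f x * g y"
  shows "integrable (M1 \<Otimes>\<^sub>M M2) (\<lambda>(x, y). h x y)"
proof -
  have [measurable]: "f \<in> borel_measurable M1" "g \<in> borel_measurable M2"
    using f g by auto
  have "integrable (M1 \<Otimes>\<^sub>M M2) (\<lambda>(x, y). f x * g y)"
  proof (rule Fubini_integrable)
    show "integrable M1 (\<lambda>x. \<integral>y. norm (case (x, y) of (x, y) \<Rightarrow> f x * g y) \<partial>M2)"
      using f by (simp add: abs_mult)
    show "AE x in M1. integrable M2 (\<lambda>y. case (x, y) of (x, y) \<Rightarrow> f x * g y)"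
      using g by simp
  qed measurable
  then show ?thesis
    by (rule Bochner_Integration.integrable_bound)
      (auto simp: space_pair_measure intro!: AE_I2 order_trans[OF le])
qed

text \<open>
  Only the modulus of this complex Gaussian is needed, and it can be had without analytic
  continuation: the square of the modulus is a double integral over \<open>x = y + p\<close> and \<open>y\<close>. The quadratic phase
  \<open>|y + p|\<^sup>2 - |y|\<^sup>2\<close> is affine in \<open>y\<close>, so the integral over \<open>y\<close> is the Fourier transform
  of a real Gaussian, and after it so is the integral over \<open>p\<close>.
\<close>

lemma chirp_gaussian_fourier:
  fixes z :: "real^2" and s :: real
  assumes a: "a > 0"
  shows "(norm (\<integral>x. cis (z \<bullet> x - s * (norm x)\<^sup>2) * of_real (exp (- a * (norm x)\<^sup>2)) \<partial>lborel))\<^sup>2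
          = pi\<^sup>2 / (a\<^sup>2 + s\<^sup>2) * exp (- a * (norm z)\<^sup>2 / (2 * (a\<^sup>2 + s\<^sup>2)))"
proof -
  define F where "F x = cis (z \<bullet> x - s * (norm x)\<^sup>2) * complex_of_real (exp (- a * (norm x)\<^sup>2))" for x :: "real^2"
  have [measurable]: "F \<in> borel_measurable borel"
    unfolding F_def by measurable
  have D: "a\<^sup>2 + s\<^sup>2 > 0" using a by (simp add: add_pos_nonneg)
  \<comment> \<open>the width of the Gaussian in \<open>p\<close> that remains after the integration over \<open>y\<close>\<close>
  define b where "b = (a\<^sup>2 + s\<^sup>2) / (2 * a)"
  have b: "b > 0" using a D by (simp add: b_def)
  let ?H = "\<lambda>p y. F (y + p) * cnj (F y)"
  have int: "integrable (lborel \<Otimes>\<^sub>M lborel) (\<lambda>(p, y). ?H p y)"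
  proof (rule lborel_pair.integrable_pair_bound)
    show "integrable lborel (\<lambda>x::real^2. exp (- (a/3) * (norm x)\<^sup>2))"
      and "integrable lborel (\<lambda>x::real^2. exp (- (a/3) * (norm x)\<^sup>2))"
      using a by (intro integrable_gaussian; simp)+
    show "norm (?H p y) \<le> exp (- (a/3) * (norm p)\<^sup>2) * exp (- (a/3) * (norm y)\<^sup>2)" for p y
    proof -
      have "(norm p)\<^sup>2 \<le> 2 * (norm (y + p))\<^sup>2 + 2 * (norm y)\<^sup>2"
      proof -
        have "0 \<le> (norm (p + 2 *\<^sub>R y))\<^sup>2" by simp
        then show ?thesis
          by (simp add: power2_norm_eq_inner inner_add_left inner_add_right inner_commute)
      qed
      then have "(norm p)\<^sup>2 + (norm y)\<^sup>2 \<le> 3 * ((norm (y + p))\<^sup>2 + (norm y)\<^sup>2)"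
        by (smt (verit) zero_le_power2)
      then have "(a/3) * ((norm p)\<^sup>2 + (norm y)\<^sup>2) \<le> (a/3) * (3 * ((norm (y + p))\<^sup>2 + (norm y)\<^sup>2))"
        using a by (intro mult_left_mono) auto
      then show ?thesis
        unfolding F_def by (simp add: norm_mult exp_add[symmetric] algebra_simps)
    qed
  qed measurable
  have inner: "(\<integral>y. ?H p y \<partial>lborel)
      = of_real (pi / (2 * a)) * (cis (z \<bullet> p) * of_real (exp (- b * (norm p)\<^sup>2)))" for p
  proof -
    \<comment> \<open>centring at the midpoint of \<open>y\<close> and \<open>y + p\<close> separates the variables \<open>u\<close> and \<open>p\<close> in the Gaussian\<close>
    have "(\<integral>y. ?H p y \<partial>lborel) = (\<integral>u. ?H p (- (p /\<^sub>R 2) + u) \<partial>lborel)"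
      by (rule lborel_integral_shift[symmetric]) measurable
    also have "\<dots> = (\<integral>u. (cis (z \<bullet> p) * of_real (exp (- (a/2) * (norm p)\<^sup>2))) *
        (cis ((- (2 * s)) *\<^sub>R p \<bullet> u) * of_real (exp (- (2 * a) * (norm u)\<^sup>2))) \<partial>lborel)"
    proof (intro Bochner_Integration.integral_cong refl)
      fix u :: "real^2"
      let ?y = "- (p /\<^sub>R 2) + u"
      have 1: "(norm (?y + p))\<^sup>2 - (norm ?y)\<^sup>2 = 2 * (p \<bullet> u)"
        by (simp add: power2_norm_eq_inner inner_simps inner_commute algebra_simps)
      have 2: "(norm (?y + p))\<^sup>2 + (norm ?y)\<^sup>2 = 2 * (norm u)\<^sup>2 + (norm p)\<^sup>2 / 2"
        by (simp add: power2_norm_eq_inner inner_simps inner_commute algebra_simps)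
      have gen: "cis A * of_real r * cnj (cis B * of_real q) = cis (A - B) * of_real (r * q)" for A B r q :: real
        using cis_mult[of A "- B"] by (simp add: cis_cnj mult_ac)
      have "?H p ?y = cis ((z \<bullet> (?y + p) - s * (norm (?y + p))\<^sup>2) - (z \<bullet> ?y - s * (norm ?y)\<^sup>2))
           * of_real (exp (- a * (norm (?y + p))\<^sup>2) * exp (- a * (norm ?y)\<^sup>2))"
        unfolding F_def by (rule gen)
      also have "(z \<bullet> (?y + p) - s * (norm (?y + p))\<^sup>2) - (z \<bullet> ?y - s * (norm ?y)\<^sup>2)
          = z \<bullet> p - s * ((norm (?y + p))\<^sup>2 - (norm ?y)\<^sup>2)"
        by (simp add: inner_add_right algebra_simps)
      also have "exp (- a * (norm (?y + p))\<^sup>2) * exp (- a * (norm ?y)\<^sup>2)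
          = exp (- a * ((norm (?y + p))\<^sup>2 + (norm ?y)\<^sup>2))"
        by (simp add: exp_add[symmetric] algebra_simps)
      finally have "?H p ?y = cis (z \<bullet> p - s * (2 * (p \<bullet> u))) *
           of_real (exp (- a * (2 * (norm u)\<^sup>2 + (norm p)\<^sup>2 / 2)))"
        unfolding 1 2 .
      also have "\<dots> = (cis (z \<bullet> p) * cis ((- (2 * s)) *\<^sub>R p \<bullet> u)) *
          of_real (exp (- (a/2) * (norm p)\<^sup>2) * exp (- (2 * a) * (norm u)\<^sup>2))"
        unfolding exp_add[symmetric] cis_mult by (simp add: algebra_simps)
      finally show "?H p ?y = (cis (z \<bullet> p) * of_real (exp (- (a/2) * (norm p)\<^sup>2))) *
        (cis ((- (2 * s)) *\<^sub>R p \<bullet> u) * of_real (exp (- (2 * a) * (norm u)\<^sup>2)))"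
        by (simp only: of_real_mult mult_ac)
    qed
    also have "\<dots> = (cis (z \<bullet> p) * of_real (exp (- (a/2) * (norm p)\<^sup>2))) *
        of_real (pi / (2 * a) * exp (- (norm ((- (2 * s)) *\<^sub>R p))\<^sup>2 / (4 * (2 * a))))"
      using a by (subst integral_mult_right_zero, subst gaussian_fourier_plane) simp_all
    also have "\<dots> = of_real (pi / (2 * a)) * (cis (z \<bullet> p) * 
        of_real (exp (- (a/2) * (norm p)\<^sup>2) * exp (- (norm ((- (2 * s)) *\<^sub>R p))\<^sup>2 / (4 * (2 * a)))))"
      by (simp only: of_real_mult mult_ac)
    also have "exp (- (a/2) * (norm p)\<^sup>2) * exp (- (norm ((- (2 * s)) *\<^sub>R p))\<^sup>2 / (4 * (2 * a)))
        = exp (- b * (norm p)\<^sup>2)"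
      unfolding exp_add[symmetric] b_def using a
      by (simp add: power_mult_distrib field_simps power2_eq_square)
    finally show ?thesis .
  qed
  have "integral\<^sup>L lborel F * cnj (integral\<^sup>L lborel F) = (\<integral>y. integral\<^sup>L lborel F * cnj (F y) \<partial>lborel)"
    by simp
  also have "\<dots> = (\<integral>y. (\<integral>p. ?H p y \<partial>lborel) \<partial>lborel)"
    by (intro Bochner_Integration.integral_cong refl) (simp add: lborel_integral_shift[of F, symmetric])
  also have "\<dots> = (\<integral>p. (\<integral>y. ?H p y \<partial>lborel) \<partial>lborel)"
    by (rule lborel_pair.Fubini_integral[OF int])
  also have "\<dots> = of_real (pi / (2 * a)) * of_real (pi / b * exp (- (norm z)\<^sup>2 / (4 * b)))"
    unfolding inner using b by (subst integral_mult_right_zero, subst gaussian_fourier_plane) simp_all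
  also have "\<dots> = of_real (pi\<^sup>2 / (a\<^sup>2 + s\<^sup>2) * exp (- a * (norm z)\<^sup>2 / (2 * (a\<^sup>2 + s\<^sup>2))))"
    unfolding of_real_mult[symmetric] b_def using a D by (simp add: field_simps power2_eq_square)
  finally have "complex_of_real ((norm (integral\<^sup>L lborel F))\<^sup>2)
      = of_real (pi\<^sup>2 / (a\<^sup>2 + s\<^sup>2) * exp (- a * (norm z)\<^sup>2 / (2 * (a\<^sup>2 + s\<^sup>2))))"
    unfolding complex_norm_square .
  then show ?thesis
    unfolding F_def of_real_eq_iff .
qed

text \<open>
  With \<open>y = a |z|\<^sup>2 / (2 (a\<^sup>2 + s\<^sup>2))\<close> the squared modulus is a constant times \<open>y exp(-y) / (a |z|\<^sup>2)\<close>, and \<open>y exp(-y) \<le> 1\<close>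
  for every \<open>s\<close>.
\<close>

lemma chirp_gaussian_dispersion:
  fixes z :: "real^2" and s :: real
  assumes a: "a > 0" and z: "z \<noteq> 0"
  shows "norm (\<integral>x. cis (z \<bullet> x - s * (norm x)\<^sup>2) * of_real (exp (- a * (norm x)\<^sup>2)) \<partial>lborel)
          \<le> 2 * pi / (sqrt a * norm z)" (is "norm ?K \<le> _")
proof (rule power2_le_imp_le)
  define y where "y = a * (norm z)\<^sup>2 / (2 * (a\<^sup>2 + s\<^sup>2))"
  have D: "a\<^sup>2 + s\<^sup>2 > 0" using a by (simp add: add_pos_nonneg)
  have y: "y > 0" unfolding y_def using a z D by (intro divide_pos_pos mult_pos_pos) auto
  have "y * exp (- y) \<le> 1"
    using exp_ge_add_one_self[of y] y by (auto simp: exp_minus field_simps intro: order_trans[of _ "1 + y"])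
  have "(norm ?K)\<^sup>2 = pi\<^sup>2 / (a\<^sup>2 + s\<^sup>2) * exp (- y)"
    using chirp_gaussian_fourier[OF a, of z s] by (simp add: y_def)
  also have "\<dots> = 2 * pi\<^sup>2 / (a * (norm z)\<^sup>2) * (y * exp (- y))"
    unfolding y_def using a z D by (simp add: field_simps)
  also have "\<dots> \<le> 2 * pi\<^sup>2 / (a * (norm z)\<^sup>2) * 1"
    using \<open>y * exp (- y) \<le> 1\<close> a by (intro mult_left_mono) auto
  also have "\<dots> \<le> (2 * pi / (sqrt a * norm z))\<^sup>2"
    using a z by (simp add: power_divide power_mult_distrib divide_right_mono)
  finally show "(norm ?K)\<^sup>2 \<le> (2 * pi / (sqrt a * norm z))\<^sup>2" .
  show "0 \<le> 2 * pi / (sqrt a * norm z)" using a by simp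
qed

section \<open>Schur's test\<close>

lemma mult_le_half_squares: "(x::real) * y \<le> (x\<^sup>2 + y\<^sup>2) / 2"
  using sum_squares_bound[of x y] by simp

lemma integrable_mult_L2:
  fixes f g :: "'a \<Rightarrow> complex"
  assumes [measurable]: "f \<in> borel_measurable M" "g \<in> borel_measurable M"
    and "integrable M (\<lambda>x. (norm (f x))\<^sup>2)" "integrable M (\<lambda>x. (norm (g x))\<^sup>2)"
  shows "integrable M (\<lambda>x. f x * g x)"
proof (rule Bochner_Integration.integrable_bound)
  show "integrable M (\<lambda>x. ((norm (f x))\<^sup>2 + (norm (g x))\<^sup>2) / 2)"
    using assms by simp
  show "AE x in M. norm (f x * g x) \<le> norm (((norm (f x))\<^sup>2 + (norm (g x))\<^sup>2) / 2)"
    using mult_le_half_squares[of "norm (f x)" "norm (g x)" for x] by (intro AE_I2) (simp add: norm_mult abs_of_nonneg del: divide_le_eq_numeral1 le_divide_eq_numeral1)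
qed measurable

text \<open>
  Let \<open>f\<close> be the function on \<open>M\<close> to be bounded, with squared norm \<open>X\<close>. By Fubini \<open>X\<close> is the pairing of \<open>g\<close> with
  \<open>V = \<integral> cnj (f p) E p dp\<close>, and the squared norm of \<open>V\<close> is the quadratic form of the Gram kernel
  at \<open>f\<close>. Schur's test bounds that form by \<open>B X\<close>, so \<open>X \<le> (\<parallel>V\<parallel>\<^sup>2 / B + B \<parallel>g\<parallel>\<^sup>2) / 2 \<le> (X + B \<parallel>g\<parallel>\<^sup>2) / 2\<close>, and \<open>X\<close> can
  be absorbed because it is finite. The domination by \<open>G\<close> serves to make \<open>f\<close> bounded and to
  justify Fubini.
\<close>

lemma schur_TTstar:
  fixes E :: "'p \<Rightarrow> 'x \<Rightarrow> complex" and G :: "'x \<Rightarrow> real"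
  assumes M: "finite_measure M" and N: "sigma_finite_measure N"
    and E: "(\<lambda>(p, x). E p x) \<in> borel_measurable (M \<Otimes>\<^sub>M N)"
    and EG: "\<And>p x. p \<in> space M \<Longrightarrow> x \<in> space N \<Longrightarrow> norm (E p x) \<le> G x"
    and G: "G \<in> borel_measurable N" and G0: "\<And>x. 0 \<le> G x"
    and G2: "integrable N (\<lambda>x. (G x)\<^sup>2)"
    and g: "g \<in> borel_measurable N" and g2: "integrable N (\<lambda>x. (norm (g x))\<^sup>2)"
    and B: "B > 0"
    and schur: "\<And>p. p \<in> space M \<Longrightarrow>
       (\<integral>\<^sup>+q. ennreal (norm (\<integral>x. E p x * cnj (E q x) \<partial>N)) \<partial>M) \<le> ennreal B"
  shows "(\<integral>\<^sup>+p. ennreal ((norm (\<integral>x. E p x * g x \<partial>N))\<^sup>2) \<partial>M) \<le> ennreal (B * (\<integral>x. (norm (g x))\<^sup>2 \<partial>N))"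
proof -
  interpret M: finite_measure M by fact
  interpret N: sigma_finite_measure N by fact
  interpret MN: pair_sigma_finite M N ..
  note E[measurable] G[measurable] g[measurable]
  define K where "K p q = (\<integral>x. E p x * cnj (E q x) \<partial>N)" for p q
  define f where "f p = (\<integral>x. E p x * g x \<partial>N)" for p
  have [measurable]: "f \<in> borel_measurable M"
    unfolding f_def by measurable
  have [measurable]: "(\<lambda>(p, q). K p q) \<in> borel_measurable (M \<Otimes>\<^sub>M M)"
    unfolding K_def by measurable
  have Ep[measurable]: "E p \<in> borel_measurable N" if "p \<in> space M" for p
    using that by measurable
  have Ep2: "integrable N (\<lambda>x. (norm (E p x))\<^sup>2)" if p: "p \<in> space M" for p
    using p by (intro Bochner_Integration.integrable_bound[OF G2] AE_I2)
      (auto intro!: power_mono EG simp: measurable_compose[OF Ep[OF p]])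
  have swap: "(\<integral>x. (\<integral>p. \<phi> p * E p x \<partial>M) * \<psi> x \<partial>N) = (\<integral>p. \<phi> p * (\<integral>x. E p x * \<psi> x \<partial>N) \<partial>M)"
    if [measurable]: "\<phi> \<in> borel_measurable M" "\<psi> \<in> borel_measurable N"
      and c: "\<And>p. p \<in> space M \<Longrightarrow> norm (\<phi> p) \<le> c"
      and \<psi>: "integrable N (\<lambda>x. (norm (\<psi> x))\<^sup>2)" for \<phi> \<psi> and c :: real
  proof -
    have "integrable (M \<Otimes>\<^sub>M N) (\<lambda>(p, x). \<phi> p * E p x * \<psi> x)"
    proof (rule MN.integrable_pair_bound)
      show "integrable M (\<lambda>_. c)" by simp
      have "integrable N (\<lambda>x. of_real (G x) * \<psi> x)"
        using G2 \<psi> by (intro integrable_mult_L2) auto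
      from integrable_norm[OF this] show "integrable N (\<lambda>x. G x * norm (\<psi> x))"
        using G0 by (simp add: norm_mult)
      show "norm (\<phi> p * E p x * \<psi> x) \<le> c * (G x * norm (\<psi> x))" if "p \<in> space M" "x \<in> space N" for p x
        unfolding norm_mult mult.assoc using c[OF that(1)] EG[OF that] G0[of x]
        by (intro mult_mono) (auto intro: order_trans[OF norm_ge_zero])
    qed measurable
    note Fub = MN.Fubini_integral[OF this]
    have "(\<integral>x. (\<integral>p. \<phi> p * E p x \<partial>M) * \<psi> x \<partial>N) = (\<integral>x. (\<integral>p. \<phi> p * E p x * \<psi> x \<partial>M) \<partial>N)"
      by simp
    also note Fub
    also have "(\<integral>p. (\<integral>x. \<phi> p * E p x * \<psi> x \<partial>N) \<partial>M) = (\<integral>p. \<phi> p * (\<integral>x. E p x * \<psi> x \<partial>N) \<partial>M)"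
      by (simp add: mult.assoc)
    finally show ?thesis .
  qed
  obtain c where c0: "0 \<le> c" and c: "\<And>p. p \<in> space M \<Longrightarrow> norm (f p) \<le> c"
  proof
    show "0 \<le> (\<integral>x. ((G x)\<^sup>2 + (norm (g x))\<^sup>2) / 2 \<partial>N)" by simp
    show "norm (f p) \<le> (\<integral>x. ((G x)\<^sup>2 + (norm (g x))\<^sup>2) / 2 \<partial>N)" if p: "p \<in> space M" for p
    proof -
      have "norm (f p) \<le> (\<integral>x. norm (E p x * g x) \<partial>N)"
        unfolding f_def by (rule integral_norm_bound)
      also have "\<dots> \<le> (\<integral>x. ((G x)\<^sup>2 + (norm (g x))\<^sup>2) / 2 \<partial>N)"
      proof (rule integral_mono)
        show "integrable N (\<lambda>x. norm (E p x * g x))"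
          using p Ep2 g2 by (intro integrable_norm integrable_mult_L2) auto
        show "integrable N (\<lambda>x. ((G x)\<^sup>2 + (norm (g x))\<^sup>2) / 2)"
          using G2 g2 by simp
        fix x assume "x \<in> space N"
        then have "norm (E p x * g x) \<le> G x * norm (g x)"
          using EG[OF p] by (simp add: norm_mult mult_right_mono)
        also have "\<dots> \<le> ((G x)\<^sup>2 + (norm (g x))\<^sup>2) / 2"
          by (rule mult_le_half_squares)
        finally show "norm (E p x * g x) \<le> ((G x)\<^sup>2 + (norm (g x))\<^sup>2) / 2" .
      qed
      finally show ?thesis .
    qed
  qed
  have f2: "integrable M (\<lambda>p. (norm (f p))\<^sup>2)"
    by (rule M.integrable_const_bound[where B = "c\<^sup>2"]) (auto intro!: AE_I2 power_mono c)
  define X where "X = (\<integral>p. (norm (f p))\<^sup>2 \<partial>M)"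
  have X: "(\<integral>\<^sup>+p. ennreal ((norm (f p))\<^sup>2) \<partial>M) = ennreal X"
    unfolding X_def by (rule nn_integral_eq_integral[OF f2]) simp
  have X0: "X \<ge> 0" unfolding X_def by simp
  define V where "V x = (\<integral>p. cnj (f p) * E p x \<partial>M)" for x
  have [measurable]: "V \<in> borel_measurable N"
    unfolding V_def by measurable
  have V_le: "norm (V x) \<le> measure M (space M) * c * G x" if "x \<in> space N" for x
  proof -
    have "norm (V x) \<le> (\<integral>p. norm (cnj (f p) * E p x) \<partial>M)"
      unfolding V_def by (rule integral_norm_bound)
    also have "\<dots> \<le> (\<integral>p. c * G x \<partial>M)"
    proof (rule Bochner_Integration.integral_mono')
      show "0 \<le> c * G x" for p using c0 G0 by simp
      show "norm (cnj (f p) * E p x) \<le> c * G x" if "p \<in> space M" for p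
        using c[OF that] EG[OF that \<open>x \<in> space N\<close>] unfolding norm_mult complex_mod_cnj
        by (intro mult_mono) (auto intro: order_trans[OF norm_ge_zero])
    qed auto
    finally show ?thesis by (simp add: mult_ac)
  qed
  have V2: "integrable N (\<lambda>x. (norm (V x))\<^sup>2)"
  proof (rule Bochner_Integration.integrable_bound)
    show "integrable N (\<lambda>x. (measure M (space M) * c)\<^sup>2 * (G x)\<^sup>2)"
      using G2 by simp
    show "AE x in N. norm ((norm (V x))\<^sup>2) \<le> norm ((measure M (space M) * c)\<^sup>2 * (G x)\<^sup>2)"
      using V_le by (intro AE_I2) (auto simp: power_mult_distrib[symmetric] intro!: power_mono)
  qed measurable
  have X_eq: "of_real X = (\<integral>x. V x * g x \<partial>N)"
  proof -
    have "(\<integral>x. V x * g x \<partial>N) = (\<integral>p. cnj (f p) * f p \<partial>M)"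
      unfolding V_def by (subst swap[where c = c]) (auto simp: c g2 f_def[symmetric])
    also have "\<dots> = (\<integral>p. of_real ((norm (f p))\<^sup>2) \<partial>M)"
      by (simp only: complex_norm_square mult.commute)
    finally show ?thesis by (simp only: integral_complex_of_real X_def)
  qed
  have K_sym: "norm (K q p) = norm (K p q)" for p q
  proof -
    have "cnj (K p q) = (\<integral>x. cnj (E p x * cnj (E q x)) \<partial>N)"
      unfolding K_def by (rule Bochner_Integration.integral_cnj[symmetric])
    also have "\<dots> = K q p"
      unfolding K_def by (simp only: complex_cnj_mult complex_cnj_cnj mult.commute)
    finally show ?thesis by (metis complex_mod_cnj)
  qed
  have VV: "(\<integral>x. (norm (V x))\<^sup>2 \<partial>N) \<le> B * X"
  proof -
    have inner: "(\<integral>x. E p x * cnj (V x) \<partial>N) = cnj (\<integral>q. cnj (f q) * K q p \<partial>M)" if p: "p \<in> space M" for p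
    proof -
      have "cnj (\<integral>x. V x * cnj (E p x) \<partial>N) = (\<integral>x. cnj (V x * cnj (E p x)) \<partial>N)"
        by (rule Bochner_Integration.integral_cnj[symmetric])
      also have "\<dots> = (\<integral>x. E p x * cnj (V x) \<partial>N)"
        by (simp only: complex_cnj_mult complex_cnj_cnj mult.commute)
      finally have "(\<integral>x. E p x * cnj (V x) \<partial>N) = cnj (\<integral>x. V x * cnj (E p x) \<partial>N)" ..
      moreover have "(\<integral>x. V x * cnj (E p x) \<partial>N) = (\<integral>q. cnj (f q) * K q p \<partial>M)"
        unfolding V_def K_def using p by (subst swap[where c = c]) (auto simp: c Ep2)
      ultimately show ?thesis by simp
    qed
    have "complex_of_real (\<integral>x. (norm (V x))\<^sup>2 \<partial>N) = (\<integral>x. V x * cnj (V x) \<partial>N)"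
      by (simp only: integral_complex_of_real[symmetric] complex_norm_square)
    also have "\<dots> = (\<integral>p. cnj (f p) * (\<integral>x. E p x * cnj (V x) \<partial>N) \<partial>M)"
      unfolding V_def[of x for x] by (subst swap[where c = c]) (auto simp: c V2 V_def[symmetric])
    also have "\<dots> = (\<integral>p. cnj (f p) * cnj (\<integral>q. cnj (f q) * K q p \<partial>M) \<partial>M)"
      by (intro Bochner_Integration.integral_cong refl) (simp add: inner)
    finally have eq: "complex_of_real (\<integral>x. (norm (V x))\<^sup>2 \<partial>N) = \<dots>" .
    have "ennreal (\<integral>x. (norm (V x))\<^sup>2 \<partial>N) = ennreal (norm (complex_of_real (\<integral>x. (norm (V x))\<^sup>2 \<partial>N)))"
      by (simp only: norm_of_real abs_of_nonneg integral_nonneg zero_le_power2 norm_ge_zero) simp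
    also have "\<dots> \<le> (\<integral>\<^sup>+p. ennreal (norm (cnj (f p) * cnj (\<integral>q. cnj (f q) * K q p \<partial>M))) \<partial>M)"
      unfolding eq by (rule norm_integral_le_nn_integral)
    also have "\<dots> = (\<integral>\<^sup>+p. ennreal (norm (f p)) * ennreal (norm (\<integral>q. cnj (f q) * K q p \<partial>M)) \<partial>M)"
      by (simp add: norm_mult ennreal_mult)
    also have "\<dots> \<le> (\<integral>\<^sup>+p. ennreal (norm (f p)) * (\<integral>\<^sup>+q. ennreal (norm (cnj (f q) * K q p)) \<partial>M) \<partial>M)"
      by (intro nn_integral_mono mult_left_mono norm_integral_le_nn_integral) simp
    also have "\<dots> = (\<integral>\<^sup>+p. (\<integral>\<^sup>+q. ennreal (norm (f p) * norm (f q) * norm (K p q)) \<partial>M) \<partial>M)"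
    proof (rule nn_integral_cong)
      fix p assume [measurable]: "p \<in> space M"
      have "(\<integral>\<^sup>+q. ennreal (norm (f p) * norm (f q) * norm (K p q)) \<partial>M)
          = (\<integral>\<^sup>+q. ennreal (norm (f p)) * ennreal (norm (cnj (f q) * K q p)) \<partial>M)"
        by (intro nn_integral_cong) (simp add: norm_mult ennreal_mult[symmetric] K_sym[of _ p] mult.assoc)
      also have "\<dots> = ennreal (norm (f p)) * (\<integral>\<^sup>+q. ennreal (norm (cnj (f q) * K q p)) \<partial>M)"
        by (rule nn_integral_cmult) measurable
      finally show "ennreal (norm (f p)) * (\<integral>\<^sup>+q. ennreal (norm (cnj (f q) * K q p)) \<partial>M)
          = (\<integral>\<^sup>+q. ennreal (norm (f p) * norm (f q) * norm (K p q)) \<partial>M)" ..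
    qed
    also have "\<dots> \<le> (\<integral>\<^sup>+p. (\<integral>\<^sup>+q. ennreal ((norm (f p))\<^sup>2 / 2) * ennreal (norm (K p q))
            + ennreal ((norm (f q))\<^sup>2 / 2) * ennreal (norm (K p q)) \<partial>M) \<partial>M)"
    proof (intro nn_integral_mono)
      fix p q
      have "norm (f p) * norm (f q) * norm (K p q) \<le> ((norm (f p))\<^sup>2 + (norm (f q))\<^sup>2) / 2 * norm (K p q)"
        by (intro mult_right_mono mult_le_half_squares) simp
      then have "ennreal (norm (f p) * norm (f q) * norm (K p q))
           \<le> ennreal ((norm (f p))\<^sup>2 / 2 * norm (K p q) + (norm (f q))\<^sup>2 / 2 * norm (K p q))"
        by (intro ennreal_leI) (simp add: field_simps)
      then show "ennreal (norm (f p) * norm (f q) * norm (K p q)) \<le> ennreal ((norm (f p))\<^sup>2 / 2) * ennreal (norm (K p q))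
            + ennreal ((norm (f q))\<^sup>2 / 2) * ennreal (norm (K p q))"
        by (simp add: ennreal_plus[symmetric] ennreal_mult[symmetric] del: ennreal_plus)
    qed
    also have "\<dots> = (\<integral>\<^sup>+p. (\<integral>\<^sup>+q. ennreal ((norm (f p))\<^sup>2 / 2) * ennreal (norm (K p q)) \<partial>M) \<partial>M)
        + (\<integral>\<^sup>+p. (\<integral>\<^sup>+q. ennreal ((norm (f q))\<^sup>2 / 2) * ennreal (norm (K p q)) \<partial>M) \<partial>M)"
      by (subst nn_integral_add[symmetric]) (auto intro!: nn_integral_cong nn_integral_add)
    also have "(\<integral>\<^sup>+p. (\<integral>\<^sup>+q. ennreal ((norm (f q))\<^sup>2 / 2) * ennreal (norm (K p q)) \<partial>M) \<partial>M)
         = (\<integral>\<^sup>+p. (\<integral>\<^sup>+q. ennreal ((norm (f p))\<^sup>2 / 2) * ennreal (norm (K p q)) \<partial>M) \<partial>M)"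
    proof -
      interpret MM: pair_sigma_finite M M ..
      have "(\<integral>\<^sup>+p. (\<integral>\<^sup>+q. ennreal ((norm (f q))\<^sup>2 / 2) * ennreal (norm (K p q)) \<partial>M) \<partial>M)
        = (\<integral>\<^sup>+q. (\<integral>\<^sup>+p. ennreal ((norm (f q))\<^sup>2 / 2) * ennreal (norm (K p q)) \<partial>M) \<partial>M)"
        by (rule MM.Fubini'[symmetric]) measurable
      then show ?thesis by (simp add: K_sym)
    qed
    also have "(\<integral>\<^sup>+p. (\<integral>\<^sup>+q. ennreal ((norm (f p))\<^sup>2 / 2) * ennreal (norm (K p q)) \<partial>M) \<partial>M)
         \<le> (\<integral>\<^sup>+p. ennreal ((norm (f p))\<^sup>2 / 2) * ennreal B \<partial>M)"
    proof (rule nn_integral_mono)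
      fix p assume p: "p \<in> space M"
      have "(\<integral>\<^sup>+q. ennreal ((norm (f p))\<^sup>2 / 2) * ennreal (norm (K p q)) \<partial>M)
          = ennreal ((norm (f p))\<^sup>2 / 2) * (\<integral>\<^sup>+q. ennreal (norm (K p q)) \<partial>M)"
        using p by (intro nn_integral_cmult) measurable
      also have "\<dots> \<le> ennreal ((norm (f p))\<^sup>2 / 2) * ennreal B"
        using schur[OF p] unfolding K_def by (intro mult_left_mono) auto
      finally show "(\<integral>\<^sup>+q. ennreal ((norm (f p))\<^sup>2 / 2) * ennreal (norm (K p q)) \<partial>M) \<le> \<dots>" .
    qed
    also have "\<dots> = (\<integral>\<^sup>+p. ennreal (B / 2) * ennreal ((norm (f p))\<^sup>2) \<partial>M)"
      using B by (simp add: ennreal_mult[symmetric] mult_ac)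
    also have "\<dots> = ennreal (B / 2 * X)"
      using B X0 by (subst nn_integral_cmult) (simp_all add: X ennreal_mult[symmetric])
    finally have "ennreal (\<integral>x. (norm (V x))\<^sup>2 \<partial>N) \<le> ennreal (B / 2 * X) + ennreal (B / 2 * X)"
      by (simp add: add_mono)
    also have "\<dots> = ennreal (B * X)"
      using B X0 by (simp add: ennreal_plus[symmetric] del: ennreal_plus)
    finally show ?thesis
      using B X0 by (simp add: ennreal_le_iff)
  qed
  have "X = norm (\<integral>x. V x * g x \<partial>N)"
    using X0 by (simp add: X_eq[symmetric])
  also have "\<dots> \<le> (\<integral>x. norm (V x * g x) \<partial>N)"
    by (rule integral_norm_bound)
  also have "\<dots> \<le> (\<integral>x. ((norm (V x))\<^sup>2 / B + B * (norm (g x))\<^sup>2) / 2 \<partial>N)"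
  proof (rule integral_mono)
    show "integrable N (\<lambda>x. norm (V x * g x))"
      by (intro integrable_norm integrable_mult_L2) (auto simp: V2 g2)
    show "integrable N (\<lambda>x. ((norm (V x))\<^sup>2 / B + B * (norm (g x))\<^sup>2) / 2)"
      using V2 g2 by simp
    fix x
    have "norm (V x) / sqrt B * (sqrt B * norm (g x)) \<le> ((norm (V x) / sqrt B)\<^sup>2 + (sqrt B * norm (g x))\<^sup>2) / 2"
      by (rule mult_le_half_squares)
    then show "norm (V x * g x) \<le> ((norm (V x))\<^sup>2 / B + B * (norm (g x))\<^sup>2) / 2"
      using B by (simp add: norm_mult power_divide power_mult_distrib)
  qed
  also have "\<dots> = ((\<integral>x. (norm (V x))\<^sup>2 \<partial>N) / B + B * (\<integral>x. (norm (g x))\<^sup>2 \<partial>N)) / 2"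
    using V2 g2 by simp
  also have "\<dots> \<le> (X + B * (\<integral>x. (norm (g x))\<^sup>2 \<partial>N)) / 2"
    using VV B by (simp add: field_simps)
  finally have "X \<le> B * (\<integral>x. (norm (g x))\<^sup>2 \<partial>N)" by simp
  then show ?thesis
    unfolding f_def[symmetric] X by (rule ennreal_leI)
qed

section \<open>The Fourier transform on square-integrable functions\<close>

lemma sets_borel_ball [measurable]: "ball (c::'a::euclidean_space) r \<in> sets borel"
  by simp

lemma lborel_integral_affine:
  fixes f :: "'a::euclidean_space \<Rightarrow> 'b::{banach, second_countable_topology}"
  assumes [measurable]: "f \<in> borel_measurable borel" and c: "c \<noteq> 0"
  shows "(\<integral>x. f x \<partial>lborel) = \<bar>c\<bar> ^ DIM('a) *\<^sub>R (\<integral>x. f (t + c *\<^sub>R x) \<partial>lborel)"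
proof -
  have "(\<integral>x. f x \<partial>lborel)
      = (\<integral>x. f x \<partial>density (distr lborel borel (\<lambda>x. t + c *\<^sub>R x)) (\<lambda>_. ennreal (\<bar>c\<bar> ^ DIM('a))))"
    by (subst lborel_affine[OF c, of t]) simp
  also have "\<dots> = \<bar>c\<bar> ^ DIM('a) *\<^sub>R (\<integral>x. f (t + c *\<^sub>R x) \<partial>lborel)"
    by (subst integral_density) (auto simp: integral_distr)
  finally show ?thesis .
qed

lemma nn_integral_lborel_shift:
  fixes f :: "'a::euclidean_space \<Rightarrow> ennreal"
  assumes [measurable]: "f \<in> borel_measurable borel"
  shows "(\<integral>\<^sup>+x. f (c + x) \<partial>lborel) = (\<integral>\<^sup>+x. f x \<partial>lborel)"
proof -
  have "(\<integral>\<^sup>+x. f x \<partial>distr lborel borel ((+) c)) = (\<integral>\<^sup>+x. f (c + x) \<partial>lborel)"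
    by (rule nn_integral_distr) simp_all
  then show ?thesis by (simp add: lborel_distr_plus)
qed

lemma lborel_distr_reflect: "distr lborel borel uminus = (lborel :: 'a::euclidean_space measure)"
proof -
  have "(lborel :: 'a measure) = density (distr lborel borel uminus) (\<lambda>_. 1)"
    using lborel_affine[of "-1" "0::'a"] by simp
  then show ?thesis by (simp add: density_1)
qed

lemma norm_diff_square_le: "(norm (a :: 'a::real_normed_vector))\<^sup>2 \<le> 2 * (norm (b - a))\<^sup>2 + 2 * (norm b)\<^sup>2"
proof -
  have "norm a \<le> norm (b - a) + norm b"
    by (metis add.commute norm_minus_commute norm_triangle_sub)
  then have "(norm a)\<^sup>2 \<le> (norm (b - a) + norm b)\<^sup>2"
    by (intro power_mono) auto
  also have "\<dots> \<le> 2 * (norm (b - a))\<^sup>2 + 2 * (norm b)\<^sup>2"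
    using sum_squares_bound[of "norm (b - a)" "norm b"] by (simp add: power2_sum)
  finally show ?thesis .
qed

lemma fourier_integral_lborel:
  assumes [measurable]: "u \<in> borel_measurable borel"
  shows "fourier_integral u \<xi> = (\<integral>x. cis (- (x \<bullet> \<xi>)) * u x \<partial>lborel)"
  unfolding fourier_integral_def by (rule integral_completion) measurable

lemma measurable_fourier_integral [measurable (raw)]:
  assumes [measurable]: "u \<in> borel_measurable borel"
  shows "fourier_integral u \<in> borel_measurable borel"
  unfolding fourier_integral_lborel[OF assms, abs_def] by measurable

lemma integrable_cis_mult:
  assumes [measurable]: "\<phi> \<in> borel_measurable borel" and u: "integrable lborel (u :: 'a::euclidean_space \<Rightarrow> complex)"
  shows "integrable lborel (\<lambda>x. cis (\<phi> x) * u x)"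
proof (rule Bochner_Integration.integrable_bound[OF u])
  have [measurable]: "u \<in> borel_measurable borel" using borel_measurable_integrable[OF u] by simp
  show "(\<lambda>x. cis (\<phi> x) * u x) \<in> borel_measurable lborel" by measurable
qed (simp add: norm_mult)

lemma norm_fourier_integral_le:
  assumes [measurable]: "u \<in> borel_measurable borel"
  shows "norm (fourier_integral u \<xi>) \<le> (\<integral>x. norm (u x) \<partial>lborel)"
proof -
  have "norm (fourier_integral u \<xi>) \<le> (\<integral>x. norm (cis (- (x \<bullet> \<xi>)) * u x) \<partial>lborel)"
    unfolding fourier_integral_lborel[OF assms] by (rule integral_norm_bound)
  then show ?thesis by (simp add: norm_mult)
qed

lemma fourier_integral_diff:
  assumes "u \<in> borel_measurable borel" "v \<in> borel_measurable borel"
    and "integrable lborel u" "integrable lborel v"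
  shows "fourier_integral (\<lambda>x. u x - v x) \<xi> = fourier_integral u \<xi> - fourier_integral v \<xi>"
  using assms unfolding fourier_integral_lborel[OF assms(1)] fourier_integral_lborel[OF assms(2)]
  by (subst fourier_integral_lborel)
    (auto simp: right_diff_distrib intro!: Bochner_Integration.integral_diff integrable_cis_mult)

text \<open>
  For the functions \<open>exp(-i x \<bullet> \<xi>) exp(-d |x|\<^sup>2)\<close> of \<open>x\<close>, indexed by \<open>\<xi>\<close>, the Gram kernel is a
  Gaussian in the difference of the frequencies, with integral \<open>(2 \<pi>)\<^sup>2\<close> for every \<open>d\<close>. So \<open>schur_TTstar\<close> on
  a ball of frequencies gives the inequality for the regularised transform, and Fatou's lemma removes
  both cutoffs.
\<close>

lemma plancherel_le:
  assumes [measurable]: "u \<in> borel_measurable borel" and u1: "integrable lborel u"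
    and u2: "integrable lborel (\<lambda>x. (norm (u x))\<^sup>2)"
  shows "(\<integral>\<^sup>+\<xi>. ennreal ((norm (fourier_integral u \<xi>))\<^sup>2) \<partial>lborel)
          \<le> ennreal ((2 * pi)\<^sup>2 * (\<integral>x. (norm (u x))\<^sup>2 \<partial>lborel))"
proof -
  define d where "d n = 1 / real (Suc n)" for n
  have d: "d n > 0" for n by (simp add: d_def)
  have d_lim: "d \<longlonglongrightarrow> 0" unfolding d_def by (rule LIMSEQ_Suc[OF lim_1_over_n])
  define F where "F n \<xi> = (\<integral>x. cis (- (x \<bullet> \<xi>)) * of_real (exp (- d n * (norm x)\<^sup>2)) * u x \<partial>lborel)" for n \<xi>
  define M where "M n = density lborel (\<lambda>\<xi>. indicator (ball (0::real^2) (real n)) \<xi> :: ennreal)" for n :: nat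
  have bound: "(\<integral>\<^sup>+\<xi>. ennreal ((norm (F n \<xi>))\<^sup>2) * indicator (ball 0 (real n)) \<xi> \<partial>lborel)
      \<le> ennreal ((2 * pi)\<^sup>2 * (\<integral>x. (norm (u x))\<^sup>2 \<partial>lborel))" for n
  proof -
    have "finite_measure (M n)"
    proof
      have "emeasure (M n) (space (M n)) = emeasure lborel (ball (0::real^2) (real n))"
        unfolding M_def by (subst emeasure_density) (auto simp: nn_integral_indicator)
      also have "\<dots> < \<infinity>" by (rule emeasure_lborel_ball_finite)
      finally show "emeasure (M n) (space (M n)) \<noteq> \<infinity>" by simp
    qed
    have sets_M[measurable_cong]: "sets (M n) = sets borel" by (simp add: M_def)
    have "(\<integral>\<^sup>+\<xi>. ennreal ((norm (F n \<xi>))\<^sup>2) \<partial>M n) \<le> ennreal ((2 * pi)\<^sup>2 * (\<integral>x. (norm (u x))\<^sup>2 \<partial>lborel))"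
      unfolding F_def
    proof (rule schur_TTstar)
      show "integrable lborel (\<lambda>x::real^2. (exp (- d n * (norm x)\<^sup>2))\<^sup>2)"
        using integrable_gaussian[of "2 * d n", where 'a="real^2"] d[of n] by (simp add: exp_double[symmetric] mult_ac)
      fix \<xi> :: "real^2"
      have K: "(\<integral>x. cis (- (x \<bullet> \<xi>)) * of_real (exp (- d n * (norm x)\<^sup>2)) *
             cnj (cis (- (x \<bullet> \<eta>)) * of_real (exp (- d n * (norm x)\<^sup>2))) \<partial>lborel)
           = of_real (pi / (2 * d n) * exp (- (norm (\<eta> - \<xi>))\<^sup>2 / (4 * (2 * d n))))" for \<eta> :: "real^2"
      proof -
        have "(\<integral>x. cis (- (x \<bullet> \<xi>)) * of_real (exp (- d n * (norm x)\<^sup>2)) *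
             cnj (cis (- (x \<bullet> \<eta>)) * of_real (exp (- d n * (norm x)\<^sup>2))) \<partial>lborel)
            = (\<integral>x. cis ((\<eta> - \<xi>) \<bullet> x) * of_real (exp (- (2 * d n) * (norm x)\<^sup>2)) \<partial>lborel)"
        proof (intro Bochner_Integration.integral_cong refl)
          fix x :: "real^2"
          have "cis ((\<eta> - \<xi>) \<bullet> x) = cis (- (x \<bullet> \<xi>)) * cis (x \<bullet> \<eta>)"
            by (simp add: cis_mult inner_diff_left inner_commute[of x])
          moreover have "exp (- (2 * d n) * (norm x)\<^sup>2) = exp (- d n * (norm x)\<^sup>2) * exp (- d n * (norm x)\<^sup>2)"
            by (simp add: exp_add[symmetric])
          ultimately show "cis (- (x \<bullet> \<xi>)) * of_real (exp (- d n * (norm x)\<^sup>2)) *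
             cnj (cis (- (x \<bullet> \<eta>)) * of_real (exp (- d n * (norm x)\<^sup>2)))
             = cis ((\<eta> - \<xi>) \<bullet> x) * of_real (exp (- (2 * d n) * (norm x)\<^sup>2))"
            by (simp only: complex_cnj_mult cis_cnj complex_cnj_complex_of_real of_real_mult minus_minus mult_ac)
        qed
        then show ?thesis using d[of n] by (simp only: gaussian_fourier_plane)
      qed
      have int: "integrable lborel (\<lambda>\<eta>::real^2. exp (- (1 / (8 * d n)) * (norm \<eta>)\<^sup>2))"
        using d[of n] by (intro integrable_gaussian) simp
      have "(\<integral>\<^sup>+\<eta>. ennreal (norm (\<integral>x. cis (- (x \<bullet> \<xi>)) * of_real (exp (- d n * (norm x)\<^sup>2)) *
             cnj (cis (- (x \<bullet> \<eta>)) * of_real (exp (- d n * (norm x)\<^sup>2))) \<partial>lborel)) \<partial>M n)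
          \<le> (\<integral>\<^sup>+\<eta>. ennreal (pi / (2 * d n) * exp (- (1 / (8 * d n)) * (norm (- \<xi> + \<eta>))\<^sup>2)) \<partial>lborel)"
        unfolding K norm_of_real M_def using d[of n]
        by (subst nn_integral_density) (auto intro!: nn_integral_mono simp: indicator_def abs_mult)
      also have "\<dots> = (\<integral>\<^sup>+\<eta>. ennreal (pi / (2 * d n) * exp (- (1 / (8 * d n)) * (norm (\<eta>::real^2))\<^sup>2)) \<partial>lborel)"
        by (rule nn_integral_lborel_shift[where f = "\<lambda>\<eta>::real^2. ennreal (pi / (2 * d n) * exp (- (1 / (8 * d n)) * (norm \<eta>)\<^sup>2))"]) measurable
      also have "\<dots> = ennreal (pi / (2 * d n) * (pi / (1 / (8 * d n))))"
      proof (subst nn_integral_eq_integral)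
        show "ennreal (\<integral>\<eta>. pi / (2 * d n) * exp (- (1 / (8 * d n)) * (norm (\<eta>::real^2))\<^sup>2) \<partial>lborel)
            = ennreal (pi / (2 * d n) * (pi / (1 / (8 * d n))))"
          using d[of n] gaussian_integral_plane[of "1 / (8 * d n)"]
          by (subst integral_mult_right_zero) (simp only: zero_less_divide_iff zero_less_mult_iff; simp)
      qed (use d[of n] int in \<open>auto simp del: mult_minus_left\<close>)
      also have "pi / (2 * d n) * (pi / (1 / (8 * d n))) = (2 * pi)\<^sup>2"
        using d[of n] by (simp add: power2_eq_square)
      finally show "(\<integral>\<^sup>+\<eta>. ennreal (norm (\<integral>x. cis (- (x \<bullet> \<xi>)) * of_real (exp (- d n * (norm x)\<^sup>2)) *
             cnj (cis (- (x \<bullet> \<eta>)) * of_real (exp (- d n * (norm x)\<^sup>2))) \<partial>lborel)) \<partial>M n) \<le> ennreal ((2 * pi)\<^sup>2)" .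
    qed (auto simp: norm_mult u2 intro: \<open>finite_measure (M n)\<close> sigma_finite_lborel)
    then show ?thesis
      unfolding M_def by (subst (asm) nn_integral_density) (auto simp: F_def mult.commute)
  qed
  have lim: "(\<lambda>n. F n \<xi>) \<longlonglongrightarrow> fourier_integral u \<xi>" for \<xi>
    unfolding F_def fourier_integral_lborel[OF assms(1)]
  proof (rule integral_dominated_convergence[where w = "\<lambda>x. norm (u x)"])
    show "integrable lborel (\<lambda>x. norm (u x))" using u1 by simp
    show "AE x in lborel. (\<lambda>n. cis (- (x \<bullet> \<xi>)) * of_real (exp (- d n * (norm x)\<^sup>2)) * u x) \<longlonglongrightarrow> cis (- (x \<bullet> \<xi>)) * u x"
    proof (intro AE_I2)
      fix x :: "real^2"
      have "(\<lambda>n. cis (- (x \<bullet> \<xi>)) * of_real (exp (- d n * (norm x)\<^sup>2)) * u x) \<longlonglongrightarrow> cis (- (x \<bullet> \<xi>)) * of_real (exp (- 0 * (norm x)\<^sup>2)) * u x"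
        by (intro tendsto_intros d_lim)
      then show "(\<lambda>n. cis (- (x \<bullet> \<xi>)) * of_real (exp (- d n * (norm x)\<^sup>2)) * u x) \<longlonglongrightarrow> cis (- (x \<bullet> \<xi>)) * u x" by simp
    qed
    show "AE x in lborel. norm (cis (- (x \<bullet> \<xi>)) * of_real (exp (- d n * (norm x)\<^sup>2)) * u x) \<le> norm (u x)" for n
      using d[of n] by (intro AE_I2) (simp add: norm_mult mult_left_le_one_le)
  qed measurable
  have [measurable]: "F n \<in> borel_measurable borel" for n
    unfolding F_def by measurable
  have "(\<integral>\<^sup>+\<xi>. ennreal ((norm (fourier_integral u \<xi>))\<^sup>2) \<partial>lborel)
      = (\<integral>\<^sup>+\<xi>. liminf (\<lambda>n. ennreal ((norm (F n \<xi>))\<^sup>2) * indicator (ball 0 (real n)) \<xi>) \<partial>lborel)"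
  proof (rule nn_integral_cong)
    fix \<xi> :: "real^2"
    have "(\<lambda>n. ennreal ((norm (F n \<xi>))\<^sup>2)) \<longlonglongrightarrow> ennreal ((norm (fourier_integral u \<xi>))\<^sup>2)"
      by (intro tendsto_intros lim)
    moreover have "eventually (\<lambda>n. ennreal ((norm (F n \<xi>))\<^sup>2) = ennreal ((norm (F n \<xi>))\<^sup>2) * indicator (ball 0 (real n)) \<xi>) sequentially"
      using eventually_gt_at_top[of "nat \<lceil>norm \<xi>\<rceil>"]
      by eventually_elim (auto simp: indicator_def nat_less_iff less_le_trans ceiling_less_iff; linarith)
    ultimately have "(\<lambda>n. ennreal ((norm (F n \<xi>))\<^sup>2) * indicator (ball 0 (real n)) \<xi>) \<longlonglongrightarrow> ennreal ((norm (fourier_integral u \<xi>))\<^sup>2)"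
      by (rule Lim_transform_eventually)
    then show "ennreal ((norm (fourier_integral u \<xi>))\<^sup>2) = liminf (\<lambda>n. ennreal ((norm (F n \<xi>))\<^sup>2) * indicator (ball 0 (real n)) \<xi>)"
      by (intro lim_imp_Liminf[symmetric]) auto
  qed
  also have "\<dots> \<le> liminf (\<lambda>n. \<integral>\<^sup>+\<xi>. ennreal ((norm (F n \<xi>))\<^sup>2) * indicator (ball 0 (real n)) \<xi> \<partial>lborel)"
    by (rule nn_integral_liminf) measurable
  also have "\<dots> \<le> ennreal ((2 * pi)\<^sup>2 * (\<integral>x. (norm (u x))\<^sup>2 \<partial>lborel))"
    using bound by (intro Liminf_le) auto
  finally show ?thesis .
qed

lemma square_integrable_lborel:
  assumes "u \<in> borel_measurable borel"
  shows "square_integrable u \<longleftrightarrow> integrable lborel (\<lambda>x. (norm (u x))\<^sup>2)"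
  using assms unfolding square_integrable_def
  by (auto simp: integrable_completion measurable_completion)

lemma indicator_ball_mult_L1_L2:
  fixes u :: "real^2 \<Rightarrow> complex"
  assumes [measurable]: "u \<in> borel_measurable borel"
    and u2: "integrable lborel (\<lambda>x. (norm (u x))\<^sup>2)"
  shows "integrable lborel (\<lambda>x. indicator (ball 0 R) x * u x)"
    and "integrable lborel (\<lambda>x. (norm (indicator (ball 0 R) x * u x))\<^sup>2)"
    and "(\<integral>x. (norm (indicator (ball 0 R) x * u x))\<^sup>2 \<partial>lborel) \<le> (\<integral>x. (norm (u x))\<^sup>2 \<partial>lborel)"
proof -
  have "(\<lambda>x::real^2. (norm (indicator (ball 0 R) x :: complex))\<^sup>2) = indicator (ball 0 R)"
    by (auto simp: indicator_def)
  moreover have "integrable lborel (indicator (ball (0::real^2) R) :: _ \<Rightarrow> real)"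
    by (rule integrable_real_indicator) (simp_all add: emeasure_lborel_ball_finite[unfolded infinity_ennreal_def])
  ultimately have ind2: "integrable lborel (\<lambda>x::real^2. (norm (indicator (ball 0 R) x :: complex))\<^sup>2)"
    by simp
  show "integrable lborel (\<lambda>x. indicator (ball 0 R) x * u x)"
    by (rule integrable_mult_L2[OF _ _ ind2 u2]) measurable
  show *: "integrable lborel (\<lambda>x. (norm (indicator (ball 0 R) x * u x))\<^sup>2)"
    by (rule Bochner_Integration.integrable_bound[OF u2]) (auto simp: norm_mult indicator_def)
  show "(\<integral>x. (norm (indicator (ball 0 R) x * u x))\<^sup>2 \<partial>lborel) \<le> (\<integral>x. (norm (u x))\<^sup>2 \<partial>lborel)"
    by (rule integral_mono[OF * u2]) (auto simp: indicator_def)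
qed

text \<open>
  The transforms of the truncations to balls form a Cauchy family, by Plancherel's inequality, with an error controlled by the tail
  \<open>\<tau> R\<close>. Along radii with \<open>\<tau> (r n) \<le> 4\<^bsup>-n\<^esup>\<close> the squared differences remain summable after multiplication by \<open>2\<^sup>n\<close>, which forces almost everywhere
  convergence; Fatou's lemma then shows that the pointwise limit is the limit in \<open>L\<^sup>2\<close>.
\<close>

lemma ex_L2_fourier:
  assumes [measurable]: "u \<in> borel_measurable borel"
    and u2: "integrable lborel (\<lambda>x. (norm (u x))\<^sup>2)"
  shows "\<exists>v. v \<in> borel_measurable borel \<and> is_L2_fourier u v"
proof -
  define U where "U R = (\<lambda>x. indicator (ball 0 R) x * u x)" for R :: real
  define F where "F R = fourier_integral (U R)" for R
  define \<tau> where "\<tau> R = (\<integral>x. indicator (- ball 0 R) x * (norm (u x))\<^sup>2 \<partial>lborel)" for R :: real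
  have [measurable]: "U R \<in> borel_measurable borel" for R unfolding U_def by measurable
  have [measurable]: "F R \<in> borel_measurable borel" for R unfolding F_def by measurable
  have U1: "integrable lborel (U R)" and U2: "integrable lborel (\<lambda>x. (norm (U R x))\<^sup>2)" for R
    unfolding U_def using indicator_ball_mult_L1_L2[OF assms] by auto
  have \<tau>_int: "integrable lborel (\<lambda>x. indicator (- ball 0 R) x * (norm (u x))\<^sup>2)" for R :: real
    by (rule Bochner_Integration.integrable_bound[OF u2]) (auto simp: indicator_def)
  have \<tau>_lim: "(\<tau> \<longlongrightarrow> 0) at_top"
  proof -
    have "(\<tau> \<longlongrightarrow> integral\<^sup>L lborel (\<lambda>x::real^2. 0)) at_top"
      unfolding \<tau>_def
    proof (rule integral_dominated_convergence_at_top[where w = "\<lambda>x. (norm (u x))\<^sup>2"])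
      show "\<forall>\<^sub>F R in at_top. AE x in lborel. norm (indicator (- ball 0 R) x * (norm (u x))\<^sup>2 :: real) \<le> (norm (u x))\<^sup>2"
        by (intro always_eventually allI AE_I2) (auto simp: indicator_def)
      show "AE x in lborel. ((\<lambda>R. indicator (- ball 0 R) x * (norm (u x))\<^sup>2 :: real) \<longlongrightarrow> 0) at_top"
      proof (intro AE_I2 tendsto_eventually)
        fix x :: "real^2"
        show "\<forall>\<^sub>F R in at_top. indicator (- ball 0 R) x * (norm (u x))\<^sup>2 = (0::real)"
          using eventually_gt_at_top[of "norm x"] by eventually_elim (auto simp: indicator_def)
      qed
    qed (use u2 in auto)
    then show ?thesis by simp
  qed
  have \<tau>0: "\<tau> R \<ge> 0" for R unfolding \<tau>_def by (intro Bochner_Integration.integral_nonneg) (auto simp: indicator_def)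
  have cauchy: "(\<integral>\<^sup>+\<xi>. ennreal ((norm (F R \<xi> - F S \<xi>))\<^sup>2) \<partial>lborel) \<le> ennreal ((2 * pi)\<^sup>2 * \<tau> R)" if RS: "R \<le> S" for R S
  proof -
    have le: "(norm (U R x - U S x))\<^sup>2 \<le> indicator (- ball 0 R) x * (norm (u x))\<^sup>2" for x
      using RS by (auto simp: U_def indicator_def)
    have int: "integrable lborel (\<lambda>x. (norm (U R x - U S x))\<^sup>2)"
      by (rule Bochner_Integration.integrable_bound[OF \<tau>_int[of R]])
        (use le in \<open>auto intro!: order_trans[OF _ abs_ge_self]\<close>)
    have "(\<integral>\<^sup>+\<xi>. ennreal ((norm (F R \<xi> - F S \<xi>))\<^sup>2) \<partial>lborel)
        = (\<integral>\<^sup>+\<xi>. ennreal ((norm (fourier_integral (\<lambda>x. U R x - U S x) \<xi>))\<^sup>2) \<partial>lborel)"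
      unfolding F_def by (subst fourier_integral_diff) (auto intro: U1)
    also have "\<dots> \<le> ennreal ((2 * pi)\<^sup>2 * (\<integral>x. (norm (U R x - U S x))\<^sup>2 \<partial>lborel))"
      by (rule plancherel_le) (auto simp: U1 int)
    also have "\<dots> \<le> ennreal ((2 * pi)\<^sup>2 * \<tau> R)"
      unfolding \<tau>_def by (intro ennreal_leI mult_left_mono integral_mono int \<tau>_int le) auto
    finally show ?thesis .
  qed
  have "\<exists>R0. \<forall>R\<ge>R0. \<tau> R \<le> (1/4) ^ n" for n :: nat
  proof -
    have "\<forall>\<^sub>F R in at_top. \<tau> R < (1/4) ^ n"
      using \<tau>_lim by (rule order_tendstoD) simp
    then show ?thesis by (auto simp: eventually_at_top_linorder intro: less_imp_le)
  qed
  then obtain R0 where R0: "\<And>n R. R \<ge> R0 n \<Longrightarrow> \<tau> R \<le> (1/4) ^ n" by metis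
  \<comment> \<open>the partial sums make \<open>r\<close> monotone and the summand \<open>real n\<close> makes it unbounded\<close>
  define r where "r n = real n + (\<Sum>m\<le>n. \<bar>R0 m\<bar>)" for n
  have r_R0: "r n \<ge> R0 n" for n
    using member_le_sum[of n "{..n}" "\<lambda>m. \<bar>R0 m\<bar>"] by (simp add: r_def)
  have r_n: "r n \<ge> real n" for n by (simp add: r_def sum_nonneg)
  have r_mono: "r n \<le> r (Suc n)" for n by (simp add: r_def)
  define D where "D n \<xi> = F (r n) \<xi> - F (r (Suc n)) \<xi>" for n \<xi>
  have [measurable]: "D n \<in> borel_measurable borel" for n unfolding D_def by measurable
  have D_le: "(\<integral>\<^sup>+\<xi>. ennreal (2 ^ n * (norm (D n \<xi>))\<^sup>2) \<partial>lborel) \<le> ennreal ((2 * pi)\<^sup>2 * (1/2) ^ n)" for n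
  proof -
    have "(\<integral>\<^sup>+\<xi>. ennreal (2 ^ n * (norm (D n \<xi>))\<^sup>2) \<partial>lborel) = ennreal (2 ^ n) * (\<integral>\<^sup>+\<xi>. ennreal ((norm (D n \<xi>))\<^sup>2) \<partial>lborel)"
      by (simp add: ennreal_mult nn_integral_cmult)
    also have "\<dots> \<le> ennreal (2 ^ n) * ennreal ((2 * pi)\<^sup>2 * \<tau> (r n))"
      unfolding D_def by (intro mult_left_mono cauchy r_mono) simp
    also have "\<dots> \<le> ennreal (2 ^ n) * ennreal ((2 * pi)\<^sup>2 * (1/4) ^ n)"
      by (intro mult_left_mono ennreal_leI R0 r_R0) auto
    also have "\<dots> = ennreal ((2 * pi)\<^sup>2 * (1/2) ^ n)"
      by (simp add: ennreal_mult[symmetric] power_mult_distrib[symmetric] mult.left_commute[of "2 ^ n"])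
    finally show ?thesis .
  qed
  have "(\<integral>\<^sup>+\<xi>. (\<Sum>n. ennreal (2 ^ n * (norm (D n \<xi>))\<^sup>2)) \<partial>lborel) = (\<Sum>n. \<integral>\<^sup>+\<xi>. ennreal (2 ^ n * (norm (D n \<xi>))\<^sup>2) \<partial>lborel)"
    by (rule nn_integral_suminf) measurable
  also have "\<dots> \<le> (\<Sum>n. ennreal ((2 * pi)\<^sup>2 * (1/2) ^ n))"
    by (intro suminf_le D_le) auto
  also have "\<dots> < \<infinity>"
    by (subst suminf_ennreal2) (auto intro!: summable_mult summable_geometric)
  finally have "AE \<xi> in lborel. (\<Sum>n. ennreal (2 ^ n * (norm (D n \<xi>))\<^sup>2)) \<noteq> \<infinity>"
    by (intro nn_integral_PInf_AE) auto
  then have conv: "AE \<xi> in lborel. convergent (\<lambda>n. F (r n) \<xi>)"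
  proof eventually_elim
    fix \<xi>
    assume fin: "(\<Sum>n. ennreal (2 ^ n * (norm (D n \<xi>))\<^sup>2)) \<noteq> \<infinity>"
    define c where "c = enn2real (\<Sum>n. ennreal (2 ^ n * (norm (D n \<xi>))\<^sup>2))"
    have c: "(\<Sum>n. ennreal (2 ^ n * (norm (D n \<xi>))\<^sup>2)) = ennreal c"
      using fin by (simp add: c_def less_top[symmetric])
    have c0: "c \<ge> 0" by (simp add: c_def)
    have "norm (D n \<xi>) \<le> sqrt c * (1 / sqrt 2) ^ n" for n
    proof -
      have "(\<Sum>i\<in>{n}. ennreal (2 ^ i * (norm (D i \<xi>))\<^sup>2)) \<le> (\<Sum>n. ennreal (2 ^ n * (norm (D n \<xi>))\<^sup>2))"
        by (rule sum_le_suminf) auto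
      then have "2 ^ n * (norm (D n \<xi>))\<^sup>2 \<le> c"
        unfolding c using c0 by (simp add: ennreal_le_iff)
      then have "(norm (D n \<xi>))\<^sup>2 \<le> c * (1/2) ^ n"
        by (simp add: field_simps)
      then have "norm (D n \<xi>) \<le> sqrt (c * (1/2) ^ n)"
        by (rule real_le_rsqrt)
      then show ?thesis by (simp add: real_sqrt_mult real_sqrt_power real_sqrt_divide)
    qed
    moreover have "summable (\<lambda>n. sqrt c * (1 / sqrt 2) ^ n)"
      by (intro summable_mult summable_geometric) simp
    ultimately have "summable (\<lambda>n. D n \<xi>)"
      by (meson summable_comparison_test')
    then have "convergent (\<lambda>n. \<Sum>i<n. D i \<xi>)"
      by (simp add: summable_iff_convergent)
    moreover have "(\<Sum>i<n. D i \<xi>) = F (r 0) \<xi> - F (r n) \<xi>" for n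
      unfolding D_def by (rule sum_lessThan_telescope')
    ultimately have "convergent (\<lambda>n. F (r 0) \<xi> - F (r n) \<xi>)"
      by (simp only:)
    then have "convergent (\<lambda>n. F (r 0) \<xi> - (F (r 0) \<xi> - F (r n) \<xi>))"
      by (rule convergent_diff[OF convergent_const])
    moreover have "(\<lambda>n. F (r 0) \<xi> - (F (r 0) \<xi> - F (r n) \<xi>)) = (\<lambda>n. F (r n) \<xi>)" by simp
    ultimately show "convergent (\<lambda>n. F (r n) \<xi>)" by (simp only:)
  qed
  define v where "v \<xi> = lim (\<lambda>n. F (r n) \<xi>)" for \<xi>
  have [measurable]: "v \<in> borel_measurable borel" unfolding v_def by measurable
  have v_le: "(\<integral>\<^sup>+\<xi>. ennreal ((norm (F R \<xi> - v \<xi>))\<^sup>2) \<partial>lborel) \<le> ennreal ((2 * pi)\<^sup>2 * \<tau> R)" for R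
  proof -
    have "(\<integral>\<^sup>+\<xi>. ennreal ((norm (F R \<xi> - v \<xi>))\<^sup>2) \<partial>lborel)
       = (\<integral>\<^sup>+\<xi>. liminf (\<lambda>n. ennreal ((norm (F R \<xi> - F (r n) \<xi>))\<^sup>2)) \<partial>lborel)"
    proof (rule nn_integral_cong_AE)
      show "AE \<xi> in lborel. ennreal ((norm (F R \<xi> - v \<xi>))\<^sup>2) = liminf (\<lambda>n. ennreal ((norm (F R \<xi> - F (r n) \<xi>))\<^sup>2))"
        using conv
      proof eventually_elim
        fix \<xi> assume "convergent (\<lambda>n. F (r n) \<xi>)"
        then have "(\<lambda>n. F (r n) \<xi>) \<longlonglongrightarrow> v \<xi>"
          by (simp add: convergent_LIMSEQ_iff v_def)
        then have "(\<lambda>n. ennreal ((norm (F R \<xi> - F (r n) \<xi>))\<^sup>2)) \<longlonglongrightarrow> ennreal ((norm (F R \<xi> - v \<xi>))\<^sup>2)"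
          by (intro tendsto_intros)
        then show "ennreal ((norm (F R \<xi> - v \<xi>))\<^sup>2) = liminf (\<lambda>n. ennreal ((norm (F R \<xi> - F (r n) \<xi>))\<^sup>2))"
          by (intro lim_imp_Liminf[symmetric]) auto
      qed
    qed
    also have "\<dots> \<le> liminf (\<lambda>n. \<integral>\<^sup>+\<xi>. ennreal ((norm (F R \<xi> - F (r n) \<xi>))\<^sup>2) \<partial>lborel)"
      by (rule nn_integral_liminf) measurable
    also have "\<dots> \<le> liminf (\<lambda>n. ennreal ((2 * pi)\<^sup>2 * \<tau> R))"
    proof (rule Liminf_mono)
      have "R \<le> r n" if "n \<ge> nat \<lceil>R\<rceil>" for n using r_n[of n] that by linarith
      then show "\<forall>\<^sub>F n in sequentially. (\<integral>\<^sup>+\<xi>. ennreal ((norm (F R \<xi> - F (r n) \<xi>))\<^sup>2) \<partial>lborel) \<le> ennreal ((2 * pi)\<^sup>2 * \<tau> R)"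
        by (intro eventually_sequentiallyI[of "nat \<lceil>R\<rceil>"] cauchy)
    qed
    also have "\<dots> = ennreal ((2 * pi)\<^sup>2 * \<tau> R)"
      by (simp add: Liminf_const)
    finally show ?thesis .
  qed
  have "(\<integral>\<^sup>+\<xi>. ennreal ((norm (v \<xi>))\<^sup>2) \<partial>lborel)
      \<le> (\<integral>\<^sup>+\<xi>. 2 * ennreal ((norm (F 1 \<xi> - v \<xi>))\<^sup>2) + 2 * ennreal ((norm (F 1 \<xi>))\<^sup>2) \<partial>lborel)"
  proof (rule nn_integral_mono)
    fix \<xi>
    have "ennreal ((norm (v \<xi>))\<^sup>2) \<le> ennreal (2 * (norm (F 1 \<xi> - v \<xi>))\<^sup>2 + 2 * (norm (F 1 \<xi>))\<^sup>2)"
      by (intro ennreal_leI norm_diff_square_le)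
    then show "ennreal ((norm (v \<xi>))\<^sup>2) \<le> 2 * ennreal ((norm (F 1 \<xi> - v \<xi>))\<^sup>2) + 2 * ennreal ((norm (F 1 \<xi>))\<^sup>2)"
      by (simp add: ennreal_mult)
  qed
  also have "\<dots> = 2 * (\<integral>\<^sup>+\<xi>. ennreal ((norm (F 1 \<xi> - v \<xi>))\<^sup>2) \<partial>lborel) + 2 * (\<integral>\<^sup>+\<xi>. ennreal ((norm (F 1 \<xi>))\<^sup>2) \<partial>lborel)"
    by (simp add: nn_integral_add nn_integral_cmult)
  also have "\<dots> \<le> 2 * ennreal ((2 * pi)\<^sup>2 * \<tau> 1) + 2 * ennreal ((2 * pi)\<^sup>2 * (\<integral>x. (norm (U 1 x))\<^sup>2 \<partial>lborel))"
    using plancherel_le[OF _ U1 U2, of 1]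
    by (intro add_mono mult_left_mono v_le) (auto simp: F_def)
  also have "\<dots> < \<infinity>" by (simp add: ennreal_mult_less_top)
  finally have v2: "integrable lborel (\<lambda>\<xi>. (norm (v \<xi>))\<^sup>2)"
    by (intro integrableI_bounded) auto
  have "((\<lambda>R. \<integral>\<^sup>+\<xi>. ennreal ((norm (F R \<xi> - v \<xi>))\<^sup>2) \<partial>lborel) \<longlongrightarrow> 0) at_top"
  proof (rule tendsto_sandwich[OF _ _ tendsto_const])
    show "((\<lambda>R. ennreal ((2 * pi)\<^sup>2 * \<tau> R)) \<longlongrightarrow> 0) at_top"
      using tendsto_ennrealI[OF tendsto_mult[OF tendsto_const \<tau>_lim], of "(2 * pi)\<^sup>2"] by simp
  qed (use v_le in auto)
  then have "is_L2_fourier u v"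
    unfolding is_L2_fourier_def nn_integral_completion F_def U_def
    using v2 by (simp add: square_integrable_lborel)
  then show ?thesis by (intro exI[of _ v]) simp
qed

lemma borel_representative:
  fixes u :: "real^2 \<Rightarrow> complex"
  assumes u: "u \<in> borel_measurable lebesgue"
  obtains u' where "u' \<in> borel_measurable borel" "AE x in lebesgue. u x = u' x"
proof -
  have "(\<lambda>x. Re (u x)) \<in> borel_measurable lebesgue" "(\<lambda>x. Im (u x)) \<in> borel_measurable lebesgue"
    using u by measurable
  from this[THEN completion_ex_borel_measurable_real]
  obtain a b where [measurable]: "a \<in> borel_measurable lborel" "b \<in> borel_measurable lborel"
    and ab: "AE x in lborel. Re (u x) = a x" "AE x in lborel. Im (u x) = b x"
    by blast
  have "AE x in lborel. u x = Complex (a x) (b x)"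
    using ab by eventually_elim (simp add: complex_eq_iff)
  moreover have "(\<lambda>x. Complex (a x) (b x)) \<in> borel_measurable lborel"
    unfolding Complex_eq by measurable
  ultimately show ?thesis
    using that[of "\<lambda>x. Complex (a x) (b x)"] by (simp add: AE_completion)
qed

lemma fourier_integral_cong_AE:
  assumes u: "u \<in> borel_measurable lebesgue" and u': "u' \<in> borel_measurable lebesgue"
    and eq: "AE x in lebesgue. u x = u' x"
  shows "fourier_integral u = fourier_integral u'"
proof
  fix \<xi> :: "real^2"
  have [measurable]: "(\<lambda>x. cis (- (x \<bullet> \<xi>))) \<in> borel_measurable lebesgue"
    by (rule measurable_completion) measurable
  note u[measurable] u'[measurable]
  show "fourier_integral u \<xi> = fourier_integral u' \<xi>"
    unfolding fourier_integral_def
    by (rule integral_cong_AE) (use eq in auto)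
qed

lemma is_L2_fourier_cong_AE:
  assumes u: "u \<in> borel_measurable lebesgue" and u': "u' \<in> borel_measurable lebesgue"
    and eq: "AE x in lebesgue. u x = u' x"
  shows "is_L2_fourier u = is_L2_fourier u'"
proof -
  have "fourier_integral (\<lambda>x. indicator (ball 0 R) x * u x) = fourier_integral (\<lambda>x. indicator (ball 0 R) x * u' x)" for R :: real
  proof (rule fourier_integral_cong_AE)
    have [measurable]: "(indicator (ball 0 R) :: real^2 \<Rightarrow> complex) \<in> borel_measurable lebesgue"
      by (rule measurable_completion) measurable
    show "(\<lambda>x. indicator (ball 0 R) x * u x) \<in> borel_measurable lebesgue"
      "(\<lambda>x. indicator (ball 0 R) x * u' x) \<in> borel_measurable lebesgue"
      using u u' by measurable
    show "AE x in lebesgue. indicator (ball 0 R) x * u x = indicator (ball 0 R) x * u' x"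
      using eq by eventually_elim simp
  qed
  then show ?thesis
    unfolding is_L2_fourier_def[abs_def] by simp
qed

text \<open>
  This is an equality of functions, not only almost everywhere: the two predicates \<open>is_L2_fourier u\<close> and
  \<open>is_L2_fourier u'\<close> coincide, so the choice operator picks the same representative for both.
\<close>

lemma fourier_cong_AE:
  assumes u: "u \<in> borel_measurable lebesgue" and u': "u' \<in> borel_measurable lebesgue"
    and eq: "AE x in lebesgue. u x = u' x"
  shows "fourier u = fourier u'"
proof -
  have "integrable lebesgue u \<longleftrightarrow> integrable lebesgue u'"
    by (rule integrable_cong_AE[OF u u' eq])
  then show ?thesis
    unfolding fourier_def fourier_integral_cong_AE[OF assms] is_L2_fourier_cong_AE[OF assms] by simp
qed

text \<open>
  Compare \<open>v\<close> with the transform of a truncation and let the radius tend to infinity; the factor 2 is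
  that of \<open>norm_diff_square_le\<close>.
\<close>

lemma is_L2_fourier_norm_le:
  assumes [measurable]: "u \<in> borel_measurable borel"
    and u2: "integrable lborel (\<lambda>x. (norm (u x))\<^sup>2)" and v: "is_L2_fourier u v"
  shows "(\<integral>\<^sup>+\<xi>. ennreal ((norm (v \<xi>))\<^sup>2) \<partial>lebesgue) \<le> ennreal (2 * (2 * pi)\<^sup>2 * (\<integral>x. (norm (u x))\<^sup>2 \<partial>lborel))"
proof -
  define F where "F R = fourier_integral (\<lambda>x. indicator (ball 0 R) x * u x)" for R :: real
  define X where "X R = (\<integral>\<^sup>+\<xi>. ennreal ((norm (F R \<xi> - v \<xi>))\<^sup>2) \<partial>lebesgue)" for R
  let ?c = "(2 * pi)\<^sup>2 * (\<integral>x. (norm (u x))\<^sup>2 \<partial>lborel)"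
  have [measurable]: "v \<in> borel_measurable lebesgue"
    using v by (simp add: is_L2_fourier_def square_integrable_def)
  have [measurable]: "F R \<in> borel_measurable lebesgue" for R
    unfolding F_def by (rule measurable_completion) measurable
  have F_le: "(\<integral>\<^sup>+\<xi>. ennreal ((norm (F R \<xi>))\<^sup>2) \<partial>lebesgue) \<le> ennreal ?c" for R
  proof -
    have "(\<integral>\<^sup>+\<xi>. ennreal ((norm (F R \<xi>))\<^sup>2) \<partial>lebesgue)
        \<le> ennreal ((2 * pi)\<^sup>2 * (\<integral>x. (norm (indicator (ball 0 R) x * u x))\<^sup>2 \<partial>lborel))"
      unfolding F_def nn_integral_completion
      by (rule plancherel_le) (auto simp: indicator_ball_mult_L1_L2 u2)
    also have "\<dots> \<le> ennreal ?c"
      by (intro ennreal_leI mult_left_mono indicator_ball_mult_L1_L2 u2) auto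
    finally show ?thesis .
  qed
  have le: "(\<integral>\<^sup>+\<xi>. ennreal ((norm (v \<xi>))\<^sup>2) \<partial>lebesgue) \<le> 2 * X R + 2 * ennreal ?c" for R
  proof -
    have "(\<integral>\<^sup>+\<xi>. ennreal ((norm (v \<xi>))\<^sup>2) \<partial>lebesgue)
      \<le> (\<integral>\<^sup>+\<xi>. 2 * ennreal ((norm (F R \<xi> - v \<xi>))\<^sup>2) + 2 * ennreal ((norm (F R \<xi>))\<^sup>2) \<partial>lebesgue)"
    proof (rule nn_integral_mono)
      fix \<xi>
      have "ennreal ((norm (v \<xi>))\<^sup>2) \<le> ennreal (2 * (norm (F R \<xi> - v \<xi>))\<^sup>2 + 2 * (norm (F R \<xi>))\<^sup>2)"
        by (intro ennreal_leI norm_diff_square_le)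
      then show "ennreal ((norm (v \<xi>))\<^sup>2) \<le> 2 * ennreal ((norm (F R \<xi> - v \<xi>))\<^sup>2) + 2 * ennreal ((norm (F R \<xi>))\<^sup>2)"
        by (simp add: ennreal_mult)
    qed
    also have "\<dots> = 2 * X R + 2 * (\<integral>\<^sup>+\<xi>. ennreal ((norm (F R \<xi>))\<^sup>2) \<partial>lebesgue)"
      unfolding X_def by (simp add: nn_integral_add nn_integral_cmult)
    also have "\<dots> \<le> 2 * X R + 2 * ennreal ?c"
      by (intro add_mono mult_left_mono F_le) auto
    finally show ?thesis .
  qed
  have "(X \<longlongrightarrow> 0) at_top"
    using v by (simp add: is_L2_fourier_def X_def[abs_def] F_def)
  then have "((\<lambda>R. 2 * X R + 2 * ennreal ?c) \<longlongrightarrow> 2 * 0 + 2 * ennreal ?c) at_top"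
    by (intro tendsto_add tendsto_const ennreal_tendsto_cmult) auto
  then have "(\<integral>\<^sup>+\<xi>. ennreal ((norm (v \<xi>))\<^sup>2) \<partial>lebesgue) \<le> 2 * 0 + 2 * ennreal ?c"
    by (rule tendsto_lowerbound) (intro always_eventually allI le, simp)
  also have "\<dots> = ennreal (2 * ?c)"
    by (subst ennreal_mult) auto
  finally show ?thesis by (simp only: mult.assoc)
qed

lemma fourier_eq_fourier_integral:
  assumes [measurable]: "u \<in> borel_measurable borel" and "integrable lborel u"
  shows "fourier u = fourier_integral u"
  using assms by (simp add: fourier_def integrable_completion)

lemma fourier_is_L2_fourier:
  assumes [measurable]: "u \<in> borel_measurable borel" and u2: "integrable lborel (\<lambda>x. (norm (u x))\<^sup>2)"
    and n: "\<not> integrable lborel u"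
  shows "is_L2_fourier u (fourier u)"
proof -
  have "fourier u = (SOME v. is_L2_fourier u v)"
    using n by (simp add: fourier_def integrable_completion)
  then show ?thesis
    using ex_L2_fourier[OF assms(1,2)] by (metis someI_ex)
qed

lemma square_integrable_fourier:
  assumes [measurable]: "u \<in> borel_measurable borel" and u2: "integrable lborel (\<lambda>x. (norm (u x))\<^sup>2)"
  shows "square_integrable (fourier u)"
    and "(\<integral>\<^sup>+\<xi>. ennreal ((norm (fourier u \<xi>))\<^sup>2) \<partial>lebesgue) \<le> ennreal (2 * (2 * pi)\<^sup>2 * (\<integral>x. (norm (u x))\<^sup>2 \<partial>lborel))"
proof -
  have "square_integrable (fourier u) \<and>
    (\<integral>\<^sup>+\<xi>. ennreal ((norm (fourier u \<xi>))\<^sup>2) \<partial>lebesgue) \<le> ennreal (2 * (2 * pi)\<^sup>2 * (\<integral>x. (norm (u x))\<^sup>2 \<partial>lborel))"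
  proof (cases "integrable lborel u")
    case True
    then have eq: "fourier u = fourier_integral u"
      by (simp add: fourier_eq_fourier_integral)
    note le = plancherel_le[OF assms(1) True u2]
    have "integrable lborel (\<lambda>\<xi>. (norm (fourier_integral u \<xi>))\<^sup>2)"
      using le by (intro integrableI_bounded) (auto intro: le_less_trans)
    moreover have "(2 * pi)\<^sup>2 * (\<integral>x. (norm (u x))\<^sup>2 \<partial>lborel) \<le> 2 * (2 * pi)\<^sup>2 * (\<integral>x. (norm (u x))\<^sup>2 \<partial>lborel)"
      by (intro mult_right_mono) auto
    ultimately show ?thesis
      unfolding eq nn_integral_completion
      by (auto simp: square_integrable_lborel intro: order_trans[OF le] ennreal_leI)
  next
    case False
    note F = fourier_is_L2_fourier[OF assms False]
    show ?thesis
      using is_L2_fourier_norm_le[OF assms F] F by (simp add: is_L2_fourier_def)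
  qed
  then show "square_integrable (fourier u)"
    and "(\<integral>\<^sup>+\<xi>. ennreal ((norm (fourier u \<xi>))\<^sup>2) \<partial>lebesgue) \<le> ennreal (2 * (2 * pi)\<^sup>2 * (\<integral>x. (norm (u x))\<^sup>2 \<partial>lborel))"
    by auto
qed

lemma fourier_integral_multiplication_formula:
  assumes [measurable]: "f \<in> borel_measurable borel" "g \<in> borel_measurable borel"
    and f: "integrable lborel f" and g: "integrable lborel g"
  shows "(\<integral>\<xi>. fourier_integral f \<xi> * g \<xi> \<partial>lborel) = (\<integral>x. f x * fourier_integral g x \<partial>lborel)"
proof -
  have int: "integrable (lborel \<Otimes>\<^sub>M lborel) (\<lambda>(x, \<xi>). cis (- (x \<bullet> \<xi>)) * f x * g \<xi>)"
  proof (rule lborel_pair.integrable_pair_bound)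
    show "integrable lborel (\<lambda>x. norm (f x))" "integrable lborel (\<lambda>x. norm (g x))"
      using f g by auto
  qed (auto simp: norm_mult)
  have "(\<integral>\<xi>. fourier_integral f \<xi> * g \<xi> \<partial>lborel) = (\<integral>\<xi>. (\<integral>x. cis (- (x \<bullet> \<xi>)) * f x * g \<xi> \<partial>lborel) \<partial>lborel)"
    by (simp add: fourier_integral_lborel)
  also have "\<dots> = (\<integral>x. (\<integral>\<xi>. cis (- (x \<bullet> \<xi>)) * f x * g \<xi> \<partial>lborel) \<partial>lborel)"
    by (rule lborel_pair.Fubini_integral[OF int])
  also have "\<dots> = (\<integral>x. f x * fourier_integral g x \<partial>lborel)"
  proof (intro Bochner_Integration.integral_cong refl)
    fix x
    have "(\<integral>\<xi>. cis (- (x \<bullet> \<xi>)) * f x * g \<xi> \<partial>lborel) = (\<integral>\<xi>. f x * (cis (- (\<xi> \<bullet> x)) * g \<xi>) \<partial>lborel)"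
      by (intro Bochner_Integration.integral_cong refl) (simp add: inner_commute mult_ac)
    then show "(\<integral>\<xi>. cis (- (x \<bullet> \<xi>)) * f x * g \<xi> \<partial>lborel) = f x * fourier_integral g x"
      by (simp add: fourier_integral_lborel)
  qed
  finally show ?thesis .
qed

text \<open>
  Lebesgue differentiation along the boxes with lower corner \<open>x\<close>.
\<close>

lemma AE_eq_zero_if_cbox_integrals_zero:
  fixes f :: "'a::euclidean_space \<Rightarrow> 'b::euclidean_space"
  assumes "\<And>a b. (f has_integral 0) (cbox a b)"
  shows "AE x in lebesgue. f x = 0"
proof -
  obtain N where N: "negligible N"
    and lim: "\<And>x e. x \<notin> N \<Longrightarrow> 0 < e \<Longrightarrow> \<exists>d>0. \<forall>h. 0 < h \<and> h < d \<longrightarrow>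
                         norm (integral (cbox x (x + h *\<^sub>R One)) f /\<^sub>R h ^ DIM('a) - f x) < e"
    by (rule integrable_ccontinuous_explicit[of f, OF has_integral_integrable[OF assms]]) blast
  have "f x = 0" if x: "x \<notin> N" for x
  proof (rule ccontr)
    assume "f x \<noteq> 0"
    then obtain d where d: "d > 0" and *: "\<And>h. 0 < h \<Longrightarrow> h < d \<Longrightarrow>
         norm (integral (cbox x (x + h *\<^sub>R One)) f /\<^sub>R h ^ DIM('a) - f x) < norm (f x)"
      using lim[OF x, of "norm (f x)"] by auto
    have "integral (cbox x (x + (d/2) *\<^sub>R One)) f = 0"
      using assms by (rule integral_unique)
    with *[of "d/2"] d show False by simp
  qed
  then show ?thesis
    using N unfolding negligible_iff_null_sets by (intro AE_I'[of N]) auto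
qed

lemma inverse_fourier_eq:
  assumes "h \<in> borel_measurable borel" and "integrable lborel h"
  shows "inverse_fourier h x = of_real (1 / (2 * pi)\<^sup>2) * fourier_integral h (- x)"
  by (simp add: inverse_fourier_def fourier_eq_fourier_integral[OF assms])

lemma square_integrable_inverse_fourier:
  assumes [measurable]: "h \<in> borel_measurable borel" and h1: "integrable lborel h"
    and h2: "integrable lborel (\<lambda>x. (norm (h x))\<^sup>2)"
  shows "inverse_fourier h \<in> borel_measurable borel"
    and "integrable lborel (\<lambda>x. (norm (inverse_fourier h x))\<^sup>2)"
proof -
  have [measurable]: "fourier_integral h \<in> borel_measurable borel"
    by (rule measurable_fourier_integral) measurable
  show [measurable]: "inverse_fourier h \<in> borel_measurable borel"
    unfolding inverse_fourier_eq[OF assms(1) h1, abs_def] by measurable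
  have "integrable lborel (\<lambda>\<xi>. (norm (fourier_integral h \<xi>))\<^sup>2)"
    using plancherel_le[OF assms] by (intro integrableI_bounded) (auto intro: le_less_trans)
  then have "integrable (distr lborel borel uminus) (\<lambda>\<xi>. (norm (fourier_integral h \<xi>))\<^sup>2)"
    by (simp add: lborel_distr_reflect)
  then have "integrable lborel (\<lambda>\<xi>. (norm (fourier_integral h (- \<xi>)))\<^sup>2)"
    by (subst (asm) integrable_distr_eq) auto
  then show "integrable lborel (\<lambda>x. (norm (inverse_fourier h x))\<^sup>2)"
    unfolding inverse_fourier_eq[OF assms(1) h1] norm_mult power_mult_distrib
    by (rule integrable_mult_right)
qed

text \<open>
  Weakly, the Fourier transform inverts \<open>inverse_fourier\<close>. Insert the factor \<open>exp(-d |x|\<^sup>2)\<close> on the left and apply the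
  multiplication formula twice: the result is the pairing of \<open>h\<close> with the convolution of \<open>b\<close> and a
  Gaussian approximate identity. That convolution is at most 1 and tends to \<open>b\<close> off the frontier of the box, so
  dominated convergence applies on both sides as \<open>d\<close> tends to 0.
\<close>

lemma inverse_fourier_pairing_cbox:
  fixes p q :: "real^2"
  assumes [measurable]: "h \<in> borel_measurable borel" and h1: "integrable lborel h"
    and h2: "integrable lborel (\<lambda>x. (norm (h x))\<^sup>2)"
  defines "b \<equiv> \<lambda>x. complex_of_real (indicator (cbox p q) x)"
  shows "integrable lborel (\<lambda>x. inverse_fourier h x * fourier_integral b x)"
    and "(\<integral>x. inverse_fourier h x * fourier_integral b x \<partial>lborel) = (\<integral>\<xi>. h \<xi> * b \<xi> \<partial>lborel)"
proof -
  define w where "w = inverse_fourier h"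
  note w_eq = inverse_fourier_eq[OF assms(1) h1, folded w_def]
  have w[measurable]: "w \<in> borel_measurable borel" and w2: "integrable lborel (\<lambda>x. (norm (w x))\<^sup>2)"
    using square_integrable_inverse_fourier[OF assms(1) h1 h2] by (simp_all add: w_def)
  have [measurable]: "cbox p q \<in> sets borel" by simp
  have [measurable]: "b \<in> borel_measurable borel" unfolding b_def by measurable
  have b_le: "norm (b x) \<le> 1" for x by (simp add: b_def)
  have b1: "integrable lborel b" unfolding b_def
    by (intro integrable_of_real integrable_real_indicator) (auto simp: emeasure_lborel_cbox_finite[unfolded infinity_ennreal_def])
  have b2: "integrable lborel (\<lambda>x. (norm (b x))\<^sup>2)"
    by (rule Bochner_Integration.integrable_bound[OF b1]) (auto simp: b_def indicator_def)
  define c where "c = fourier_integral b"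
  have [measurable]: "c \<in> borel_measurable borel" unfolding c_def by measurable
  define L where "L = (\<integral>x. norm (b x) \<partial>lborel)"
  have c_le: "norm (c x) \<le> L" for x unfolding c_def L_def by (rule norm_fourier_integral_le) measurable
  have L0: "0 \<le> L" unfolding L_def by (intro Bochner_Integration.integral_nonneg) auto
  have c2: "integrable lborel (\<lambda>x. (norm (c x))\<^sup>2)"
    unfolding c_def using plancherel_le[OF _ b1 b2] by (intro integrableI_bounded) (auto intro: le_less_trans)
  show wc: "integrable lborel (\<lambda>x. inverse_fourier h x * fourier_integral b x)"
    unfolding w_def[symmetric] c_def[symmetric] by (rule integrable_mult_L2[OF _ _ w2 c2]) measurable
  define d where "d n = 1 / real (Suc n)" for n
  have d: "d n > 0" for n by (simp add: d_def)
  have d_lim: "d \<longlonglongrightarrow> 0" unfolding d_def by (rule LIMSEQ_Suc[OF lim_1_over_n])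
  define g where "g n x = complex_of_real (exp (- d n * (norm x)\<^sup>2))" for n and x :: "real^2"
  have [measurable]: "g n \<in> borel_measurable borel" for n unfolding g_def by measurable
  define I where "I n = (\<integral>x. w x * c x * g n x \<partial>lborel)" for n
  have lim1: "I \<longlonglongrightarrow> (\<integral>x. w x * c x \<partial>lborel)"
    unfolding I_def
  proof (rule integral_dominated_convergence[where w = "\<lambda>x. norm (w x * c x)"])
    show "integrable lborel (\<lambda>x. norm (w x * c x))"
      using integrable_norm[OF wc] by (simp add: w_def c_def)
    show "AE x in lborel. (\<lambda>n. w x * c x * g n x) \<longlonglongrightarrow> w x * c x"
    proof (intro AE_I2)
      fix x :: "real^2"
      have "(\<lambda>n. w x * c x * g n x) \<longlonglongrightarrow> w x * c x * of_real (exp (- 0 * (norm x)\<^sup>2))"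
        unfolding g_def by (intro tendsto_intros d_lim)
      then show "(\<lambda>n. w x * c x * g n x) \<longlonglongrightarrow> w x * c x" by simp
    qed
    show "AE x in lborel. norm (w x * c x * g n x) \<le> norm (w x * c x)" for n
      using d[of n] by (intro AE_I2) (simp add: g_def norm_mult mult_right_le_one_le)
  qed measurable
  define B where "B n \<xi> = of_real (1 / pi) * (\<integral>z. b (\<xi> + (2 * sqrt (d n)) *\<^sub>R z) * of_real (exp (- 1 * (norm (z::real^2))\<^sup>2)) \<partial>lborel)" for n \<xi>
  have [measurable]: "B n \<in> borel_measurable borel" for n unfolding B_def by measurable
  have cg1: "integrable lborel (\<lambda>x. c x * g n x)" for n
  proof (rule Bochner_Integration.integrable_bound)
    show "integrable lborel (\<lambda>x::real^2. L * exp (- d n * (norm x)\<^sup>2))"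
      by (intro integrable_mult_right integrable_gaussian d)
    show "AE x in lborel. norm (c x * g n x) \<le> norm (L * exp (- d n * (norm x)\<^sup>2))"
      using c_le L0 by (intro AE_I2) (simp add: g_def norm_mult mult_right_mono)
  qed measurable
  have kernel: "of_real (1 / (2 * pi)\<^sup>2) * fourier_integral (\<lambda>x. c (- x) * g n (- x)) \<xi> = B n \<xi>" for n \<xi>
  proof -
    have chirp: "integrable lborel (\<lambda>x. cis (x \<bullet> \<xi>) * g n x)"
      unfolding g_def by (intro integrable_mult_gaussian d) auto
    have "fourier_integral (\<lambda>x. c (- x) * g n (- x)) \<xi>
        = (\<integral>x. cis (- (x \<bullet> \<xi>)) * (c (- x) * g n (- x)) \<partial>lborel)"
      by (rule fourier_integral_lborel) measurable
    also have "\<dots> = (\<integral>x. c x * (cis (x \<bullet> \<xi>) * g n x) \<partial>lborel)"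
      by (subst lborel_integral_affine[of _ "-1" 0]) (auto simp: mult_ac)
    also have "\<dots> = (\<integral>\<eta>. b \<eta> * fourier_integral (\<lambda>x. cis (x \<bullet> \<xi>) * g n x) \<eta> \<partial>lborel)"
      unfolding c_def by (rule fourier_integral_multiplication_formula) (auto simp: b1 chirp)
    also have "\<dots> = (\<integral>\<eta>. b \<eta> * of_real (pi / d n * exp (- (norm (\<xi> - \<eta>))\<^sup>2 / (4 * d n))) \<partial>lborel)"
    proof (intro Bochner_Integration.integral_cong refl arg_cong2[where f = "(*)"])
      fix \<eta> :: "real^2"
      have "fourier_integral (\<lambda>x. cis (x \<bullet> \<xi>) * g n x) \<eta> = (\<integral>x. cis ((\<xi> - \<eta>) \<bullet> x) * g n x \<partial>lborel)"
        by (subst fourier_integral_lborel, measurable)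
          (auto intro!: Bochner_Integration.integral_cong simp: mult.assoc[symmetric] cis_mult inner_diff_left inner_commute[of \<xi>] inner_commute[of \<eta>])
      then show "fourier_integral (\<lambda>x. cis (x \<bullet> \<xi>) * g n x) \<eta>
          = of_real (pi / d n * exp (- (norm (\<xi> - \<eta>))\<^sup>2 / (4 * d n)))"
        unfolding g_def by (simp only: gaussian_fourier_plane[OF d])
    qed
    also have "\<dots> = (4 * d n) *\<^sub>R (\<integral>z. b (\<xi> + (2 * sqrt (d n)) *\<^sub>R z) *
        of_real (pi / d n * exp (- (norm (\<xi> - (\<xi> + (2 * sqrt (d n)) *\<^sub>R z)))\<^sup>2 / (4 * d n))) \<partial>lborel)"
      by (subst lborel_integral_affine[of _ "2 * sqrt (d n)" \<xi>])
        (use d[of n] in \<open>auto simp: power_mult_distrib\<close>)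
    also have "\<dots> = (4 * d n) *\<^sub>R (\<integral>z. of_real (pi / d n) * (b (\<xi> + (2 * sqrt (d n)) *\<^sub>R z) * of_real (exp (- 1 * (norm z)\<^sup>2))) \<partial>lborel)"
    proof (intro Bochner_Integration.integral_cong refl arg_cong2[where f = scaleR])
      fix z :: "real^2"
      have "(norm (\<xi> - (\<xi> + (2 * sqrt (d n)) *\<^sub>R z)))\<^sup>2 = 4 * d n * (norm z)\<^sup>2"
        using d[of n] by (simp add: power_mult_distrib)
      then have "- (norm (\<xi> - (\<xi> + (2 * sqrt (d n)) *\<^sub>R z)))\<^sup>2 / (4 * d n) = - 1 * (norm z)\<^sup>2"
        using d[of n] by simp
      then show "b (\<xi> + (2 * sqrt (d n)) *\<^sub>R z) * of_real (pi / d n * exp (- (norm (\<xi> - (\<xi> + (2 * sqrt (d n)) *\<^sub>R z)))\<^sup>2 / (4 * d n)))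
        = of_real (pi / d n) * (b (\<xi> + (2 * sqrt (d n)) *\<^sub>R z) * of_real (exp (- 1 * (norm z)\<^sup>2)))"
        by (simp only: of_real_mult mult_ac)
    qed
    also have "\<dots> = (4 * d n) *\<^sub>R (of_real (pi / d n) * (\<integral>z. b (\<xi> + (2 * sqrt (d n)) *\<^sub>R z) * of_real (exp (- 1 * (norm z)\<^sup>2)) \<partial>lborel))"
      by (simp only: integral_mult_right_zero)
    finally have "of_real (1 / (2 * pi)\<^sup>2) * fourier_integral (\<lambda>x. c (- x) * g n (- x)) \<xi>
      = of_real (1 / (2 * pi)\<^sup>2 * (4 * d n) * (pi / d n)) * (\<integral>z. b (\<xi> + (2 * sqrt (d n)) *\<^sub>R z) * of_real (exp (- 1 * (norm z)\<^sup>2)) \<partial>lborel)"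
      by (simp only: scaleR_conv_of_real of_real_mult mult.assoc)
    also have "1 / (2 * pi)\<^sup>2 * (4 * d n) * (pi / d n) = 1 / pi"
      using d[of n] by (simp add: power2_eq_square)
    finally show ?thesis unfolding B_def .
  qed
  have I_eq: "I n = (\<integral>\<xi>. h \<xi> * B n \<xi> \<partial>lborel)" for n
  proof -
    have [measurable]: "(\<lambda>x. c (- x) * g n (- x)) \<in> borel_measurable borel" by measurable
    have "integrable (distr lborel borel uminus) (\<lambda>x. c x * g n x)"
      using cg1[of n] by (simp add: lborel_distr_reflect)
    then have cg1': "integrable lborel (\<lambda>x. c (- x) * g n (- x))"
      by (subst (asm) integrable_distr_eq) auto
    have "I n = (\<integral>x. of_real (1 / (2 * pi)\<^sup>2) * (fourier_integral h (- x) * (c x * g n x)) \<partial>lborel)"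
      unfolding I_def w_eq by (simp only: mult.assoc)
    also have "\<dots> = of_real (1 / (2 * pi)\<^sup>2) * (\<integral>x. fourier_integral h (- x) * (c x * g n x) \<partial>lborel)"
      by (rule integral_mult_right_zero)
    also have "(\<integral>x. fourier_integral h (- x) * (c x * g n x) \<partial>lborel)
        = (\<integral>x. fourier_integral h x * (c (- x) * g n (- x)) \<partial>lborel)"
      by (subst lborel_integral_affine[of _ "-1" 0]) auto
    also have "\<dots> = (\<integral>\<xi>. h \<xi> * fourier_integral (\<lambda>x. c (- x) * g n (- x)) \<xi> \<partial>lborel)"
      by (rule fourier_integral_multiplication_formula) (auto simp: h1 cg1')
    also have "of_real (1 / (2 * pi)\<^sup>2) * \<dots>
        = (\<integral>\<xi>. of_real (1 / (2 * pi)\<^sup>2) * (h \<xi> * fourier_integral (\<lambda>x. c (- x) * g n (- x)) \<xi>) \<partial>lborel)"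
      by (rule integral_mult_right_zero[symmetric])
    also have "\<dots> = (\<integral>\<xi>. h \<xi> * B n \<xi> \<partial>lborel)"
      by (simp only: kernel[symmetric] mult.left_commute)
    finally show ?thesis .
  qed
  have gauss_int: "integrable lborel (\<lambda>z::real^2. exp (- 1 * (norm z)\<^sup>2))"
    by (rule integrable_gaussian) simp
  have B_le: "norm (B n \<xi>) \<le> 1" for n \<xi>
  proof -
    have "norm (\<integral>z. b (\<xi> + (2 * sqrt (d n)) *\<^sub>R z) * of_real (exp (- 1 * (norm (z::real^2))\<^sup>2)) \<partial>lborel)
        \<le> (\<integral>z. norm (b (\<xi> + (2 * sqrt (d n)) *\<^sub>R z) * of_real (exp (- 1 * (norm (z::real^2))\<^sup>2))) \<partial>lborel)"
      by (rule integral_norm_bound)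
    also have "\<dots> \<le> (\<integral>z. exp (- 1 * (norm (z::real^2))\<^sup>2) \<partial>lborel)"
      using b_le gauss_int by (intro Bochner_Integration.integral_mono') (auto simp: norm_mult mult_left_le_one_le)
    also have "\<dots> = pi" using gaussian_integral_plane[of 1] by simp
    finally show ?thesis unfolding B_def by (simp add: norm_mult norm_divide)
  qed
  have B_lim: "(\<lambda>n. B n \<xi>) \<longlonglongrightarrow> b \<xi>" if \<xi>: "\<xi> \<notin> frontier (cbox p q)" for \<xi>
  proof -
    have cont: "isCont b \<xi>"
      unfolding b_def using \<xi> by (intro continuous_of_real) (simp add: isCont_indicator)
    have "(\<lambda>n. \<integral>z. b (\<xi> + (2 * sqrt (d n)) *\<^sub>R z) * of_real (exp (- 1 * (norm (z::real^2))\<^sup>2)) \<partial>lborel)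
       \<longlonglongrightarrow> (\<integral>z. b \<xi> * of_real (exp (- 1 * (norm (z::real^2))\<^sup>2)) \<partial>lborel)"
    proof (rule integral_dominated_convergence[where w = "\<lambda>z. exp (- 1 * (norm z)\<^sup>2)"])
      show "integrable lborel (\<lambda>z::real^2. exp (- 1 * (norm z)\<^sup>2))" by (rule gauss_int)
      show "AE z in lborel. (\<lambda>n. b (\<xi> + (2 * sqrt (d n)) *\<^sub>R z) * of_real (exp (- 1 * (norm z)\<^sup>2)))
          \<longlonglongrightarrow> b \<xi> * of_real (exp (- 1 * (norm z)\<^sup>2))"
      proof (intro AE_I2 tendsto_mult tendsto_const)
        fix z :: "real^2"
        have "(\<lambda>n. \<xi> + (2 * sqrt (d n)) *\<^sub>R z) \<longlonglongrightarrow> \<xi> + (2 * sqrt 0) *\<^sub>R z"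
          by (intro tendsto_intros d_lim)
        then have "(\<lambda>n. \<xi> + (2 * sqrt (d n)) *\<^sub>R z) \<longlonglongrightarrow> \<xi>" by simp
        with cont show "(\<lambda>n. b (\<xi> + (2 * sqrt (d n)) *\<^sub>R z)) \<longlonglongrightarrow> b \<xi>"
          by (rule isCont_tendsto_compose)
      qed
      show "AE z in lborel. norm (b (\<xi> + (2 * sqrt (d n)) *\<^sub>R z) * of_real (exp (- 1 * (norm z)\<^sup>2))) \<le> exp (- 1 * (norm z)\<^sup>2)" for n
        using b_le by (intro AE_I2) (auto simp: norm_mult mult_left_le_one_le)
    qed measurable
    also have "(\<integral>z. b \<xi> * of_real (exp (- 1 * (norm (z::real^2))\<^sup>2)) \<partial>lborel) = b \<xi> * of_real pi"
      using gaussian_integral_plane[of 1] by (simp only: integral_mult_right_zero integral_complex_of_real zero_less_one div_by_1)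
    finally have "(\<lambda>n. of_real (1 / pi) * (\<integral>z. b (\<xi> + (2 * sqrt (d n)) *\<^sub>R z) * of_real (exp (- 1 * (norm (z::real^2))\<^sup>2)) \<partial>lborel))
       \<longlonglongrightarrow> of_real (1 / pi) * (b \<xi> * of_real pi)"
      by (rule tendsto_mult[OF tendsto_const])
    then show ?thesis unfolding B_def by simp
  qed
  have lim2: "(\<lambda>n. \<integral>\<xi>. h \<xi> * B n \<xi> \<partial>lborel) \<longlonglongrightarrow> (\<integral>\<xi>. h \<xi> * b \<xi> \<partial>lborel)"
  proof (rule integral_dominated_convergence[where w = "\<lambda>\<xi>. norm (h \<xi>)"])
    show "integrable lborel (\<lambda>\<xi>. norm (h \<xi>))" using h1 by simp
    have "frontier (cbox p q) \<in> null_sets lebesgue"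
      using negligible_convex_frontier[OF convex_box(1), of p q] by (simp add: negligible_iff_null_sets)
    then have "AE \<xi> in lborel. \<xi> \<notin> frontier (cbox p q)"
      using AE_not_in AE_completion_iff by blast
    then show "AE \<xi> in lborel. (\<lambda>n. h \<xi> * B n \<xi>) \<longlonglongrightarrow> h \<xi> * b \<xi>"
      by eventually_elim (intro tendsto_mult tendsto_const B_lim)
    show "AE \<xi> in lborel. norm (h \<xi> * B n \<xi>) \<le> norm (h \<xi>)" for n
      using B_le by (intro AE_I2) (simp add: norm_mult mult_right_le_one_le)
  qed measurable
  from LIMSEQ_unique[OF lim1[unfolded I_eq[abs_def]] lim2]
  show "(\<integral>x. inverse_fourier h x * fourier_integral b x \<partial>lborel) = (\<integral>\<xi>. h \<xi> * b \<xi> \<partial>lborel)"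
    unfolding w_def c_def .
qed

text \<open>
  By \<open>AE_eq_zero_if_cbox_integrals_zero\<close> it is enough to compare integrals over boxes. Write \<open>w\<close> for the inverse transform of \<open>h\<close>. If \<open>w\<close> is
  integrable, its transform is the Fourier integral and the multiplication formula applies directly.
  Otherwise \<open>fourier w\<close> is the limit in \<open>L\<^sup>2\<close> of the transforms of truncations of \<open>w\<close>, to
  which the formula applies; convergence in \<open>L\<^sup>2\<close> implies convergence of the integrals over the box.
\<close>

lemma fourier_inverse_fourier_AE:
  assumes [measurable]: "h \<in> borel_measurable borel" and h1: "integrable lborel h"
    and h2: "integrable lborel (\<lambda>x. (norm (h x))\<^sup>2)"
  shows "AE \<xi> in lebesgue. fourier (inverse_fourier h) \<xi> = h \<xi>"
proof -
  define w where "w = inverse_fourier h"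
  have w[measurable]: "w \<in> borel_measurable borel" and w2: "integrable lborel (\<lambda>x. (norm (w x))\<^sup>2)"
    using square_integrable_inverse_fourier[OF assms(1) h1 h2] by (simp_all add: w_def)
  define v where "v = fourier w"
  have "square_integrable v" unfolding v_def by (rule square_integrable_fourier[OF w w2])
  then have v[measurable]: "v \<in> borel_measurable lebesgue" and v2: "integrable lebesgue (\<lambda>x. (norm (v x))\<^sup>2)"
    by (auto simp: square_integrable_def)
  have h_leb[measurable]: "h \<in> borel_measurable lebesgue" by (rule measurable_completion) simp
  have h2_leb: "integrable lebesgue (\<lambda>x. (norm (h x))\<^sup>2)" using h2 by (subst integrable_completion) auto
  have main: "integrable lebesgue (\<lambda>\<xi>. of_real (indicator (cbox p q) \<xi>) * v \<xi>) \<and>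
     (\<integral>\<xi>. of_real (indicator (cbox p q) \<xi>) * v \<xi> \<partial>lebesgue) = (\<integral>\<xi>. h \<xi> * of_real (indicator (cbox p q) \<xi>) \<partial>lborel)" for p q :: "real^2"
  proof
    define b where "b = (\<lambda>x. complex_of_real (indicator (cbox p q) x))"
    have [measurable]: "cbox p q \<in> sets borel" by simp
    have b[measurable]: "b \<in> borel_measurable borel" unfolding b_def by measurable
    have b_leb[measurable]: "b \<in> borel_measurable lebesgue" by (rule measurable_completion) simp
    have b1: "integrable lborel b" unfolding b_def
      by (intro integrable_of_real integrable_real_indicator) (auto simp: emeasure_lborel_cbox_finite[unfolded infinity_ennreal_def])
    have b2: "integrable lborel (\<lambda>x. (norm (b x))\<^sup>2)"
      by (rule Bochner_Integration.integrable_bound[OF b1]) (auto simp: b_def indicator_def)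
    have b2_leb: "integrable lebesgue (\<lambda>x. (norm (b x))\<^sup>2)" using b2 by (subst integrable_completion) auto
    note pair = inverse_fourier_pairing_cbox[OF assms, of p q, folded b_def w_def]
    show "integrable lebesgue (\<lambda>\<xi>. of_real (indicator (cbox p q) \<xi>) * v \<xi>)"
      using integrable_mult_L2[OF b_leb v b2_leb v2] by (simp add: b_def)
    have "(\<integral>\<xi>. b \<xi> * v \<xi> \<partial>lebesgue) = (\<integral>x. w x * fourier_integral b x \<partial>lborel)"
    proof (cases "integrable lborel w")
      case True
      have "v = fourier_integral w" unfolding v_def by (rule fourier_eq_fourier_integral[OF w True])
      then have "(\<integral>\<xi>. b \<xi> * v \<xi> \<partial>lebesgue) = (\<integral>\<xi>. fourier_integral w \<xi> * b \<xi> \<partial>lborel)"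
        by (subst integral_completion) (auto simp: mult.commute)
      also have "\<dots> = (\<integral>x. w x * fourier_integral b x \<partial>lborel)"
        by (rule fourier_integral_multiplication_formula[OF w b True b1])
      finally show ?thesis .
    next
      case False
      define U where "U n = (\<lambda>x. indicator (ball 0 (real n)) x * w x)" for n :: nat
      define F where "F n = fourier_integral (U n)" for n
      have U[measurable]: "U n \<in> borel_measurable borel" for n unfolding U_def by measurable
      have U1: "integrable lborel (U n)" and U2: "integrable lborel (\<lambda>x. (norm (U n x))\<^sup>2)" for n
        unfolding U_def by (rule indicator_ball_mult_L1_L2[OF w w2])+
      have F[measurable]: "F n \<in> borel_measurable borel" for n unfolding F_def by measurable
      have F_leb[measurable]: "F n \<in> borel_measurable lebesgue" for n by (rule measurable_completion) simp
      have F2: "integrable lebesgue (\<lambda>x. (norm (F n x))\<^sup>2)" for n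
        unfolding F_def using plancherel_le[OF U U1 U2, of n]
        by (subst integrable_completion, measurable) (intro integrableI_bounded; auto intro: le_less_trans)
      define X where "X n = (\<integral>\<^sup>+\<xi>. ennreal ((norm (F n \<xi> - v \<xi>))\<^sup>2) \<partial>lebesgue)" for n
      have "is_L2_fourier w v"
        unfolding v_def by (rule fourier_is_L2_fourier[OF w w2 False])
      then have X_lim: "X \<longlonglongrightarrow> 0"
        unfolding X_def F_def U_def is_L2_fourier_def
        by (auto dest: filterlim_compose[OF _ filterlim_real_sequentially])
      have lim1: "(\<lambda>n. \<integral>x. U n x * fourier_integral b x \<partial>lborel) \<longlonglongrightarrow> (\<integral>x. w x * fourier_integral b x \<partial>lborel)"
      proof (rule integral_dominated_convergence[where w = "\<lambda>x. norm (w x * fourier_integral b x)"])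
        show "integrable lborel (\<lambda>x. norm (w x * fourier_integral b x))"
          using pair(1) by (rule integrable_norm)
        show "AE x in lborel. (\<lambda>n. U n x * fourier_integral b x) \<longlonglongrightarrow> w x * fourier_integral b x"
        proof (intro AE_I2 tendsto_eventually)
          fix x :: "real^2"
          show "\<forall>\<^sub>F n in sequentially. U n x * fourier_integral b x = w x * fourier_integral b x"
            using eventually_gt_at_top[of "nat \<lceil>norm x\<rceil>"]
          proof eventually_elim
            case (elim n)
            then have "norm x < real n" by linarith
            then show ?case by (simp add: U_def)
          qed
        qed
        show "AE x in lborel. norm (U n x * fourier_integral b x) \<le> norm (w x * fourier_integral b x)" for n
          by (intro AE_I2) (auto simp: U_def indicator_def norm_mult)
      qed measurable
      have U_F: "(\<integral>x. U n x * fourier_integral b x \<partial>lborel) = (\<integral>\<xi>. b \<xi> * F n \<xi> \<partial>lebesgue)" for n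
      proof -
        have "(\<integral>\<xi>. b \<xi> * F n \<xi> \<partial>lebesgue) = (\<integral>\<xi>. fourier_integral (U n) \<xi> * b \<xi> \<partial>lborel)"
          by (subst integral_completion) (auto simp: mult.commute F_def)
        also have "\<dots> = (\<integral>x. U n x * fourier_integral b x \<partial>lborel)"
          by (rule fourier_integral_multiplication_formula[OF U b U1 b1])
        finally show ?thesis ..
      qed
      have lim2: "(\<lambda>n. \<integral>\<xi>. b \<xi> * F n \<xi> \<partial>lebesgue) \<longlonglongrightarrow> (\<integral>\<xi>. b \<xi> * v \<xi> \<partial>lebesgue)"
      proof (rule LIMSEQ_I)
        fix e :: real assume e: "e > 0"
        define m where "m = (\<integral>x. (norm (b x))\<^sup>2 \<partial>lborel)"
        have m0: "m \<ge> 0" unfolding m_def by (intro Bochner_Integration.integral_nonneg) auto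
        \<comment> \<open>the weight in the inequality between geometric and arithmetic mean that balances the fixed factor \<open>b\<close> against the small one\<close>
        define \<delta> where "\<delta> = e / (m + 1)"
        have \<delta>: "\<delta> > 0" using e m0 by (simp add: \<delta>_def)
        have \<delta>m: "\<delta> * m < e" using e m0 by (simp add: \<delta>_def field_simps)
        have "\<forall>\<^sub>F n in sequentially. X n < ennreal (\<delta> * e)"
          using X_lim by (rule order_tendstoD) (use \<delta> e in simp)
        then obtain N where N: "\<And>n. n \<ge> N \<Longrightarrow> X n < ennreal (\<delta> * e)"
          by (auto simp: eventually_sequentially)
        have "norm ((\<integral>\<xi>. b \<xi> * F n \<xi> \<partial>lebesgue) - (\<integral>\<xi>. b \<xi> * v \<xi> \<partial>lebesgue)) < e" if n: "n \<ge> N" for n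
        proof -
          have "(\<integral>\<xi>. b \<xi> * F n \<xi> \<partial>lebesgue) - (\<integral>\<xi>. b \<xi> * v \<xi> \<partial>lebesgue) = (\<integral>\<xi>. b \<xi> * F n \<xi> - b \<xi> * v \<xi> \<partial>lebesgue)"
            by (intro Bochner_Integration.integral_diff[symmetric] integrable_mult_L2 b2_leb v2 F2) measurable
          then have "ennreal (norm ((\<integral>\<xi>. b \<xi> * F n \<xi> \<partial>lebesgue) - (\<integral>\<xi>. b \<xi> * v \<xi> \<partial>lebesgue)))
              \<le> (\<integral>\<^sup>+\<xi>. ennreal (norm (b \<xi> * F n \<xi> - b \<xi> * v \<xi>)) \<partial>lebesgue)"
            by (simp only: norm_integral_le_nn_integral)
          also have "\<dots> \<le> (\<integral>\<^sup>+\<xi>. ennreal (\<delta> / 2) * ennreal ((norm (b \<xi>))\<^sup>2)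
               + ennreal (1 / (2 * \<delta>)) * ennreal ((norm (F n \<xi> - v \<xi>))\<^sup>2) \<partial>lebesgue)"
          proof (rule nn_integral_mono)
            fix \<xi>
            have "norm (b \<xi> * F n \<xi> - b \<xi> * v \<xi>) = (sqrt \<delta> * norm (b \<xi>)) * (norm (F n \<xi> - v \<xi>) / sqrt \<delta>)"
              using \<delta> by (simp add: right_diff_distrib[symmetric] norm_mult)
            also have "\<dots> \<le> ((sqrt \<delta> * norm (b \<xi>))\<^sup>2 + (norm (F n \<xi> - v \<xi>) / sqrt \<delta>)\<^sup>2) / 2"
              by (rule mult_le_half_squares)
            also have "\<dots> = \<delta> / 2 * (norm (b \<xi>))\<^sup>2 + 1 / (2 * \<delta>) * (norm (F n \<xi> - v \<xi>))\<^sup>2"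
              using \<delta> by (simp add: power_mult_distrib power_divide field_simps)
            finally have "ennreal (norm (b \<xi> * F n \<xi> - b \<xi> * v \<xi>)) \<le> ennreal (\<delta> / 2 * (norm (b \<xi>))\<^sup>2 + 1 / (2 * \<delta>) * (norm (F n \<xi> - v \<xi>))\<^sup>2)"
              by (rule ennreal_leI)
            then show "ennreal (norm (b \<xi> * F n \<xi> - b \<xi> * v \<xi>)) \<le> ennreal (\<delta> / 2) * ennreal ((norm (b \<xi>))\<^sup>2)
               + ennreal (1 / (2 * \<delta>)) * ennreal ((norm (F n \<xi> - v \<xi>))\<^sup>2)"
              using \<delta> by (simp add: ennreal_mult[symmetric] ennreal_plus[symmetric] del: ennreal_plus)
          qed
          also have "\<dots> = ennreal (\<delta> / 2) * (\<integral>\<^sup>+\<xi>. ennreal ((norm (b \<xi>))\<^sup>2) \<partial>lebesgue) + ennreal (1 / (2 * \<delta>)) * X n"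
            unfolding X_def by (subst nn_integral_add) (auto simp: nn_integral_cmult)
          also have "(\<integral>\<^sup>+\<xi>. ennreal ((norm (b \<xi>))\<^sup>2) \<partial>lebesgue) = ennreal m"
            unfolding m_def nn_integral_completion by (rule nn_integral_eq_integral[OF b2]) simp
          also have "ennreal (\<delta> / 2) * ennreal m + ennreal (1 / (2 * \<delta>)) * X n
              \<le> ennreal (\<delta> / 2) * ennreal m + ennreal (1 / (2 * \<delta>)) * ennreal (\<delta> * e)"
            using N[OF n] by (intro add_mono mult_left_mono) auto
          also have "\<dots> = ennreal (\<delta> * m / 2 + e / 2)"
            using \<delta> m0 e by (simp add: ennreal_mult[symmetric] ennreal_plus[symmetric] field_simps del: ennreal_plus)
          also have "\<dots> < ennreal e"
            using \<delta>m e \<delta> m0 by (intro ennreal_lessI) auto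
          finally show ?thesis by (simp add: ennreal_less_iff)
        qed
        then show "\<exists>no. \<forall>n\<ge>no. norm ((\<integral>\<xi>. b \<xi> * F n \<xi> \<partial>lebesgue) - (\<integral>\<xi>. b \<xi> * v \<xi> \<partial>lebesgue)) < e"
          by blast
      qed
      show ?thesis
        using LIMSEQ_unique[OF lim2 lim1[unfolded U_F]] .
    qed
    also have "\<dots> = (\<integral>\<xi>. h \<xi> * b \<xi> \<partial>lborel)" using pair(2) by (simp add: b_def)
    finally show "(\<integral>\<xi>. of_real (indicator (cbox p q) \<xi>) * v \<xi> \<partial>lebesgue) = (\<integral>\<xi>. h \<xi> * of_real (indicator (cbox p q) \<xi>) \<partial>lborel)"
      unfolding b_def .
  qed
  have "((\<lambda>\<xi>. v \<xi> - h \<xi>) has_integral 0) (cbox p q)" for p q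
  proof -
    have scale: "indicator (cbox p q) \<xi> *\<^sub>R (v \<xi> - h \<xi>)
      = of_real (indicator (cbox p q) \<xi>) * v \<xi> - h \<xi> * of_real (indicator (cbox p q) \<xi>)" for \<xi>
      by (simp add: scaleR_conv_of_real algebra_simps)
    have [measurable]: "cbox p q \<in> sets borel" by simp
    have hb: "integrable lborel (\<lambda>\<xi>. h \<xi> * of_real (indicator (cbox p q) \<xi>))"
      by (rule Bochner_Integration.integrable_bound[OF h1]) (auto simp: indicator_def)
    then have hb': "integrable lebesgue (\<lambda>\<xi>. h \<xi> * of_real (indicator (cbox p q) \<xi>))"
      by (subst integrable_completion) auto
    have "set_integrable lebesgue (cbox p q) (\<lambda>\<xi>. v \<xi> - h \<xi>)"
      unfolding set_integrable_def scale using main hb' by (intro Bochner_Integration.integrable_diff) auto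
    moreover have "(LINT \<xi>:cbox p q|lebesgue. v \<xi> - h \<xi>) = 0"
      unfolding set_lebesgue_integral_def scale
      using main[of p q] hb' by (simp add: integral_completion)
    ultimately show ?thesis
      by (metis has_integral_set_lebesgue)
  qed
  then have "AE \<xi> in lebesgue. v \<xi> - h \<xi> = 0"
    by (rule AE_eq_zero_if_cbox_integrals_zero)
  then show ?thesis
    unfolding v_def w_def by simp
qed

section \<open>Plane waves on circles\<close>

lemma jordan_sin_bound:
  fixes v :: real
  assumes "\<bar>v\<bar> \<le> pi / 2"
  shows "(2 / pi * v)\<^sup>2 \<le> (sin v)\<^sup>2"
proof -
  have conc: "concave_on {0..pi/2} sin"
  proof (rule f''_le0_imp_concave)
    show "(sin has_real_derivative cos x) (at x)" "(cos has_real_derivative - sin x) (at x)" for x :: real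
      by (auto intro!: derivative_eq_intros)
    show "- sin x \<le> 0" if "x \<in> {0..pi/2}" for x :: real
      using that by (auto intro: sin_ge_zero)
  qed simp
  have "2 / pi * \<bar>v\<bar> \<le> sin \<bar>v\<bar>"
    using concave_onD[OF conc, of "2 / pi * \<bar>v\<bar>" 0 "pi / 2"] assms by (simp add: field_simps)
  then have "(2 / pi * \<bar>v\<bar>)\<^sup>2 \<le> (sin \<bar>v\<bar>)\<^sup>2"
    by (intro power_mono) auto
  then show ?thesis
    by (cases "v \<ge> 0") (simp_all add: power_mult_distrib)
qed

lemma nn_integral_gaussian_real:
  fixes a c :: real
  assumes "a > 0"
  shows "(\<integral>\<^sup>+x. ennreal (exp (- a * (x - c)\<^sup>2)) \<partial>lborel) = ennreal (sqrt (pi / a))"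
proof -
  have val: "(\<integral>x. exp (- a * x\<^sup>2) \<partial>lborel) = sqrt (pi / a)"
  proof -
    have "(\<integral>x. complex_of_real (exp (- a * x\<^sup>2)) \<partial>lborel) = of_real (sqrt (pi / a))"
      using gaussian_fourier_real(2)[OF assms, of 0] by simp
    then show ?thesis by (metis integral_complex_of_real of_real_eq_iff)
  qed
  have "(\<integral>\<^sup>+x. ennreal (exp (- a * (x - c)\<^sup>2)) \<partial>lborel) = (\<integral>\<^sup>+x. ennreal (exp (- a * x\<^sup>2)) \<partial>lborel)"
    using nn_integral_lborel_shift[of "\<lambda>x. ennreal (exp (- a * x\<^sup>2))" "- c"] by simp
  also have "\<dots> = ennreal (\<integral>x. exp (- a * x\<^sup>2) \<partial>lborel)"
    by (rule nn_integral_eq_integral[OF gaussian_fourier_real(1)[OF assms]]) simp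
  finally show ?thesis unfolding val .
qed

text \<open>
  Half the difference of the angles lies in \<open>[-\<pi>, \<pi>]\<close>, hence within \<open>\<pi>/2\<close> of \<open>m \<pi>\<close> for some \<open>m \<in> {-1, 0, 1}\<close>.
  There Jordan's inequality bounds the sine from below by a linear function, and the integrand is dominated
  by the sum of the three corresponding Gaussians on the line.
\<close>

lemma nn_integral_circle_gaussian_principal:
  fixes b \<theta> :: real
  assumes b: "b > 0" and \<theta>: "\<theta> \<in> {0..2 * pi}"
  shows "(\<integral>\<^sup>+\<phi>\<in>{0..2 * pi}. ennreal (exp (- b * (sin ((\<theta> - \<phi>) / 2))\<^sup>2)) \<partial>lborel)
          \<le> ennreal (3 * (pi * sqrt (pi / b)))"
proof -
  define a where "a = b / pi\<^sup>2"
  have a: "a > 0" using b by (simp add: a_def)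
  let ?g = "\<lambda>m \<phi>. exp (- a * (\<phi> - (\<theta> - 2 * pi * m))\<^sup>2)"
  have le: "exp (- b * (sin ((\<theta> - \<phi>) / 2))\<^sup>2) \<le> ?g (-1) \<phi> + ?g 0 \<phi> + ?g 1 \<phi>"
    if \<phi>: "\<phi> \<in> {0..2 * pi}" for \<phi>
  proof -
    define u where "u = (\<theta> - \<phi>) / 2"
    have u: "- pi \<le> u" "u \<le> pi" using \<theta> \<phi> by (auto simp: u_def)
    have one: "exp (- b * (sin u)\<^sup>2) \<le> ?g m \<phi>" if m: "\<bar>u - m * pi\<bar> \<le> pi / 2" and "(sin u)\<^sup>2 = (sin (u - m * pi))\<^sup>2" for m
    proof -
      have "a * (\<phi> - (\<theta> - 2 * pi * m))\<^sup>2 = b * (2 / pi * (u - m * pi))\<^sup>2"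
      proof -
        define y where "y = u - m * pi"
        have "\<phi> - (\<theta> - 2 * pi * m) = - (2 * y)" by (simp add: u_def y_def field_simps)
        then have "(\<phi> - (\<theta> - 2 * pi * m))\<^sup>2 = 4 * y\<^sup>2" by (simp add: power_mult_distrib)
        then show ?thesis
          unfolding y_def[symmetric] by (simp add: a_def power_mult_distrib power_divide)
      qed
      also have "\<dots> \<le> b * (sin (u - m * pi))\<^sup>2"
        using b m by (intro mult_left_mono jordan_sin_bound) auto
      finally show ?thesis using that(2) by simp
    qed
    consider "\<bar>u\<bar> \<le> pi / 2" | "u > pi / 2" | "u < - (pi / 2)" by linarith
    then show ?thesis
    proof cases
      case 1
      then have "exp (- b * (sin u)\<^sup>2) \<le> ?g 0 \<phi>" by (intro one) auto
      then show ?thesis unfolding u_def by (smt (verit) exp_gt_zero)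
    next
      case 2
      have "sin (u - 1 * pi) = - sin u" by (simp add: sin_diff)
      then have "exp (- b * (sin u)\<^sup>2) \<le> ?g 1 \<phi>" using 2 u by (intro one) auto
      then show ?thesis unfolding u_def by (smt (verit) exp_gt_zero)
    next
      case 3
      have "sin (u - (-1) * pi) = - sin u" by simp
      then have "exp (- b * (sin u)\<^sup>2) \<le> ?g (-1) \<phi>" using 3 u by (intro one) auto
      then show ?thesis unfolding u_def by (smt (verit) exp_gt_zero)
    qed
  qed
  have "(\<integral>\<^sup>+\<phi>\<in>{0..2 * pi}. ennreal (exp (- b * (sin ((\<theta> - \<phi>) / 2))\<^sup>2)) \<partial>lborel)
      \<le> (\<integral>\<^sup>+\<phi>. ennreal (?g (-1) \<phi>) + ennreal (?g 0 \<phi>) + ennreal (?g 1 \<phi>) \<partial>lborel)"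
  proof (rule nn_integral_mono)
    fix \<phi>
    show "ennreal (exp (- b * (sin ((\<theta> - \<phi>) / 2))\<^sup>2)) * indicator {0..2 * pi} \<phi>
       \<le> ennreal (?g (-1) \<phi>) + ennreal (?g 0 \<phi>) + ennreal (?g 1 \<phi>)"
    proof (cases "\<phi> \<in> {0..2 * pi}")
      case True
      then show ?thesis
        using le[OF True] by (simp add: ennreal_plus[symmetric] ennreal_leI del: ennreal_plus)
    qed simp
  qed
  also have "\<dots> = (\<integral>\<^sup>+\<phi>. ennreal (?g (-1) \<phi>) \<partial>lborel) + (\<integral>\<^sup>+\<phi>. ennreal (?g 0 \<phi>) \<partial>lborel) + (\<integral>\<^sup>+\<phi>. ennreal (?g 1 \<phi>) \<partial>lborel)"
    by (simp add: nn_integral_add)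
  also have "\<dots> = ennreal (sqrt (pi / a)) + ennreal (sqrt (pi / a)) + ennreal (sqrt (pi / a))"
    by (simp only: nn_integral_gaussian_real[OF a])
  also have "\<dots> = ennreal (3 * sqrt (pi / a))"
    using a by (simp add: ennreal_plus[symmetric] del: ennreal_plus)
  also have "sqrt (pi / a) = pi * sqrt (pi / b)"
  proof -
    have "pi / a = pi\<^sup>2 * (pi / b)" by (simp add: a_def field_simps)
    then show ?thesis by (simp only: real_sqrt_mult real_sqrt_abs) simp
  qed
  finally show ?thesis .
qed

lemma nn_integral_circle_gaussian_le:
  fixes b \<theta> :: real
  assumes b: "b > 0"
  shows "(\<integral>\<^sup>+\<phi>\<in>{0..2 * pi}. ennreal (exp (- b * (sin ((\<theta> - \<phi>) / 2))\<^sup>2)) \<partial>lborel)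
          \<le> ennreal (3 * (pi * sqrt (pi / b)))"
proof -
  define n where "n = \<lfloor>\<theta> / (2 * pi)\<rfloor>"
  define \<theta>' where "\<theta>' = \<theta> - 2 * pi * of_int n"
  have "of_int n \<le> \<theta> / (2 * pi)" "\<theta> / (2 * pi) < of_int n + 1"
    unfolding n_def by linarith+
  then have "of_int n * (2 * pi) \<le> \<theta>" "\<theta> < (of_int n + 1) * (2 * pi)"
    by (simp_all add: pos_le_divide_eq pos_divide_less_eq)
  then have \<theta>': "\<theta>' \<in> {0..2 * pi}"
    by (auto simp: \<theta>'_def algebra_simps)
  have sin_eq: "(sin ((\<theta>' - \<phi>) / 2))\<^sup>2 = (sin ((\<theta> - \<phi>) / 2))\<^sup>2" for \<phi>
  proof -
    have "(\<theta>' - \<phi>) / 2 = (\<theta> - \<phi>) / 2 - pi * of_int n"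
      by (simp add: \<theta>'_def field_simps)
    then have "sin ((\<theta>' - \<phi>) / 2) = sin ((\<theta> - \<phi>) / 2) * cos (pi * of_int n)"
      by (simp only: sin_diff) simp
    moreover have "(cos (pi * of_int n :: real))\<^sup>2 = 1"
      using sin_cos_squared_add[of "pi * of_int n :: real"] by simp
    ultimately show ?thesis by (simp add: power_mult_distrib)
  qed
  show ?thesis
    using nn_integral_circle_gaussian_principal[OF b \<theta>'] unfolding sin_eq .
qed

lemma rot_mult_eq: "rot \<theta> *v x = cos \<theta> *\<^sub>R x + sin \<theta> *\<^sub>R (vector [- (x $ 2), x $ 1])"
  by (simp add: vec_eq_iff forall_2 rot_def matrix_vector_mult_def sum_2 vector_2)

lemma norm2_plane: "(norm (x::real^2))\<^sup>2 = (x $ 1)\<^sup>2 + (x $ 2)\<^sup>2"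
  by (simp only: power2_norm_eq_inner) (simp add: inner_vec_def sum_2 power2_eq_square)

lemma norm2_rotate_scale:
  "(norm (\<alpha> *\<^sub>R x + \<beta> *\<^sub>R (vector [- (x $ 2), x $ 1] :: real^2)))\<^sup>2 = (\<alpha>\<^sup>2 + \<beta>\<^sup>2) * (norm x)\<^sup>2"
  unfolding norm2_plane by (simp add: vector_2 power2_eq_square algebra_simps)

lemma norm_rot [simp]: "norm (rot \<theta> *v x) = norm x"
proof -
  have "(norm (rot \<theta> *v x))\<^sup>2 = ((cos \<theta>)\<^sup>2 + (sin \<theta>)\<^sup>2) * (norm x)\<^sup>2"
    unfolding rot_mult_eq by (rule norm2_rotate_scale)
  then show ?thesis by simp
qed

lemma norm_rot_diff: "(norm (rot \<theta> *v x - rot \<phi> *v x))\<^sup>2 = 4 * (norm x)\<^sup>2 * (sin ((\<theta> - \<phi>) / 2))\<^sup>2"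
proof -
  have "(norm (rot \<theta> *v x - rot \<phi> *v x))\<^sup>2 = ((cos \<theta> - cos \<phi>)\<^sup>2 + (sin \<theta> - sin \<phi>)\<^sup>2) * (norm x)\<^sup>2"
    unfolding norm2_rotate_scale[symmetric] rot_mult_eq by (simp add: algebra_simps)
  also have "(cos \<theta> - cos \<phi>)\<^sup>2 + (sin \<theta> - sin \<phi>)\<^sup>2
      = ((cos \<theta>)\<^sup>2 + (sin \<theta>)\<^sup>2) + ((cos \<phi>)\<^sup>2 + (sin \<phi>)\<^sup>2) - 2 * cos (\<theta> - \<phi>)"
    by (simp only: cos_diff) (simp add: power2_eq_square algebra_simps)
  also have "\<dots> = 2 - 2 * cos (2 * ((\<theta> - \<phi>) / 2))"
  proof -
    have "2 * ((\<theta> - \<phi>) / 2) = \<theta> - \<phi>" by simp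
    then show ?thesis by (simp only: sin_cos_squared_add2)
  qed
  also have "\<dots> = 4 * (sin ((\<theta> - \<phi>) / 2))\<^sup>2"
    unfolding cos_double_sin by simp
  finally show ?thesis by (simp only: mult_ac)
qed

lemma measurable_rot_mult [measurable (raw)]:
  assumes [measurable]: "f \<in> borel_measurable M" "g \<in> borel_measurable M"
  shows "(\<lambda>p. rot (f p) *v g p) \<in> borel_measurable M"
proof -
  have "linear (\<lambda>x::real^2. vector [- (x $ 2), x $ 1] :: real^2)"
    by (rule linearI) (simp_all add: vec_eq_iff forall_2 vector_2)
  then have "continuous_on UNIV (\<lambda>x::real^2. vector [- (x $ 2), x $ 1] :: real^2)"
    by (rule linear_continuous_on[OF linear_conv_bounded_linear[THEN iffD1]])
  then have [measurable]: "(\<lambda>x::real^2. vector [- (x $ 2), x $ 1] :: real^2) \<in> borel_measurable borel"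
    by (rule borel_measurable_continuous_onI)
  have [measurable]: "(\<lambda>p. vector [- (g p $ 2), g p $ 1] :: real^2) \<in> borel_measurable M"
    by (rule measurable_compose[of g M borel]) measurable
  show ?thesis unfolding rot_mult_eq by measurable
qed

text \<open>
  The Fourier extension operator of the paraboloid \<open>\<tau> = - |\<xi>|\<^sup>2\<close>; up to the constant \<open>(2 \<pi>)\<^sup>2\<close>, the Schroedinger evolution of the
  function with Fourier transform \<open>h\<close>.
\<close>

definition paraboloid_extension :: "(real^2 \<Rightarrow> complex) \<Rightarrow> real^2 \<Rightarrow> real \<Rightarrow> complex" where
  "paraboloid_extension h x t = (\<integral>\<xi>. cis (x \<bullet> \<xi> - t * (norm \<xi>)\<^sup>2) * h \<xi> \<partial>lborel)"

lemma sum_geometric_dist_le: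
  fixes I :: "int set" and r :: real
  assumes I: "finite I" and r: "0 \<le> r" "r < 1"
  shows "(\<Sum>j\<in>I. r ^ nat \<bar>i - j\<bar>) \<le> 2 / (1 - r)"
proof -
  have half: "(\<Sum>j\<in>J. r ^ nat \<bar>i - j\<bar>) \<le> 1 / (1 - r)"
    if J: "finite J" and inj: "inj_on (\<lambda>j. nat \<bar>i - j\<bar>) J" for J
  proof -
    have "(\<Sum>j\<in>J. r ^ nat \<bar>i - j\<bar>) = (\<Sum>n\<in>(\<lambda>j. nat \<bar>i - j\<bar>) ` J. r ^ n)"
      by (simp add: sum.reindex[OF inj])
    also have "\<dots> \<le> (\<Sum>n. r ^ n)"
      using J r by (intro sum_le_suminf summable_geometric) auto
    also have "\<dots> = 1 / (1 - r)" using r by (intro suminf_geometric) auto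
    finally show ?thesis .
  qed
  have "(\<Sum>j\<in>I. r ^ nat \<bar>i - j\<bar>) = (\<Sum>j\<in>I \<inter> {..i}. r ^ nat \<bar>i - j\<bar>) + (\<Sum>j\<in>I \<inter> {i<..}. r ^ nat \<bar>i - j\<bar>)"
    using I by (subst sum.union_disjoint[symmetric]) (auto intro!: sum.cong)
  also have "\<dots> \<le> 1 / (1 - r) + 1 / (1 - r)"
    using I by (intro add_mono half) (auto simp: inj_on_def)
  finally show ?thesis by simp
qed

lemma dyadic_separation:
  fixes i j :: int and x y :: "real^2"
  assumes ij: "i + 2 \<le> j" and x: "norm x \<le> 2 powi (i + 1)" and y: "2 powi j \<le> norm y"
  shows "2 powi j / 2 \<le> norm y - norm x"
proof -
  have "(2::real) powi (i + 1) \<le> 2 powi (j - 1)"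
    using ij by (intro power_int_increasing) auto
  also have "\<dots> = 2 powi j / 2" by (simp add: power_int_diff)
  finally show ?thesis using x y by linarith
qed

lemma sqrt_powi_quotient:
  fixes i j :: int
  assumes "i \<le> j"
  shows "sqrt (2 powi i) * sqrt (2 powi j) = 2 powi j * (1 / sqrt 2) ^ nat \<bar>i - j\<bar>"
proof -
  have "2 powi i = 2 powi j * (1/2 :: real) ^ nat \<bar>i - j\<bar>"
  proof -
    have "(2::real) powi (i - j) = (1/2) ^ nat (j - i)"
      using assms by (cases "i = j") (auto simp: power_int_def power_inverse[symmetric] inverse_eq_divide)
    moreover have "(2::real) powi i = 2 powi j * 2 powi (i - j)"
      by (simp add: power_int_add[symmetric])
    ultimately show ?thesis using assms by (simp add: abs_if)
  qed
  then have "sqrt (2 powi i) * sqrt (2 powi j) = sqrt (2 powi j * 2 powi j) * sqrt ((1/2) ^ nat \<bar>i - j\<bar>)"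
    by (simp add: real_sqrt_mult)
  also have "\<dots> = 2 powi j * (1 / sqrt 2) ^ nat \<bar>i - j\<bar>"
    by (simp add: real_sqrt_mult real_sqrt_power real_sqrt_divide)
  finally show ?thesis .
qed

text \<open>
  The first summand comes from the pairing of a circle with itself, the second from a
  geometric series of ratio \<open>1 / sqrt 2\<close> over the other circles.
\<close>

definition circle_const :: real where
  "circle_const = 3 * pi\<^sup>2 * sqrt pi + 8 * pi\<^sup>2 * (2 / (1 - 1 / sqrt 2))"

lemma circle_const_pos: "circle_const > 0"
proof -
  have "1 / sqrt 2 < (1::real)" by simp
  then have "2 / (1 - 1 / sqrt 2) > (0::real)" by simp
  then show ?thesis unfolding circle_const_def by (intro add_pos_pos mult_pos_pos) auto
qed

text \<open>
  The almost orthogonality of plane waves on circles of lacunary radii. It is \<open>schur_TTstar\<close> for the index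
  space of pairs (circle, angle) and the plane waves weighted by \<open>2\<^bsup>i/2\<^esup>\<close> and by a Gaussian, which is divided out of \<open>h\<close>; this
  costs the factor \<open>exp (a * r\<^sup>2)\<close>. In a row of the Gram kernel the circle itself contributes at most a constant
  times \<open>1 / sqrt a\<close>: the kernel is of size \<open>1 / a\<close> on an angle of size \<open>sqrt a / |x\<^sub>i|\<close>, and \<open>2\<^sup>i \<le> |x\<^sub>i|\<close>. By
  dispersion, circle \<open>j\<close> contributes at most a constant times \<open>2\<^bsup>-|i-j|/2\<^esup> / sqrt a\<close>.
\<close>

lemma separated_circles_estimate:
  fixes I :: "int set" and x :: "int \<Rightarrow> real^2" and t :: "int \<Rightarrow> real" and a r :: real
  assumes I: "finite I" and sep: "\<And>i j. i \<in> I \<Longrightarrow> j \<in> I \<Longrightarrow> i < j \<Longrightarrow> i + 2 \<le> j"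
    and x: "\<And>i. i \<in> I \<Longrightarrow> 2 powi i \<le> norm (x i)" "\<And>i. i \<in> I \<Longrightarrow> norm (x i) \<le> 2 powi (i + 1)"
    and a: "a > 0"
    and h: "h \<in> borel_measurable borel" and h2: "integrable lborel (\<lambda>\<xi>. (norm (h \<xi>))\<^sup>2)"
    and supp: "\<And>\<xi>. r < norm \<xi> \<Longrightarrow> h \<xi> = 0"
  shows "(\<Sum>i\<in>I. ennreal (2 powi i) *
            (\<integral>\<^sup>+\<theta>\<in>{0..2 * pi}. ennreal ((norm (paraboloid_extension h (rot \<theta> *v x i) (t i)))\<^sup>2) \<partial>lborel))
          \<le> ennreal (circle_const / sqrt a * (exp (a * r\<^sup>2) * (\<integral>\<xi>. (norm (h \<xi>))\<^sup>2 \<partial>lborel)))"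
proof -
  define C where "C = density lborel (\<lambda>\<theta>. indicator {0..2 * pi :: real} \<theta> :: ennreal)"
  define M where "M = count_space I \<Otimes>\<^sub>M C"
  have sets_C[measurable_cong]: "sets C = sets borel" by (simp add: C_def)
  have space_C: "space C = UNIV" by (simp add: C_def)
  have fin_C: "finite_measure C"
  proof
    have "emeasure C (space C) = emeasure lborel {0..2 * pi}"
      unfolding C_def by (subst emeasure_density) (auto simp: nn_integral_indicator)
    then show "emeasure C (space C) \<noteq> \<infinity>" by simp
  qed
  interpret C: finite_measure C by fact
  have M: "finite_measure M"
    unfolding M_def using fin_C I by (intro finite_measure_pair_measure finite_measure_count_space)
  have nn_M: "(\<integral>\<^sup>+p. f p \<partial>M) = (\<Sum>i\<in>I. \<integral>\<^sup>+\<theta>\<in>{0..2 * pi}. f (i, \<theta>) \<partial>lborel)"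
    if f: "\<And>i. i \<in> I \<Longrightarrow> (\<lambda>\<theta>. f (i, \<theta>)) \<in> borel_measurable borel" for f :: "int \<times> real \<Rightarrow> ennreal"
  proof -
    have [measurable]: "f \<in> borel_measurable (count_space I \<Otimes>\<^sub>M C)"
    proof -
      have "(\<lambda>p. f (fst p, snd p)) \<in> borel_measurable (count_space I \<Otimes>\<^sub>M C)"
        by (rule measurable_compose_countable'[where I = I and g = fst])
          (use f I in \<open>auto simp: countable_finite intro!: measurable_compose[OF measurable_snd]\<close>)
      then show ?thesis by simp
    qed
    have "(\<integral>\<^sup>+p. f p \<partial>M) = (\<integral>\<^sup>+i. \<integral>\<^sup>+\<theta>. f (i, \<theta>) \<partial>C \<partial>count_space I)"
      unfolding M_def by (rule C.nn_integral_fst[symmetric]) measurable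
    also have "\<dots> = (\<Sum>i\<in>I. \<integral>\<^sup>+\<theta>. f (i, \<theta>) \<partial>C)"
      by (rule nn_integral_count_space_finite[OF I])
    also have "\<dots> = (\<Sum>i\<in>I. \<integral>\<^sup>+\<theta>\<in>{0..2 * pi}. f (i, \<theta>) \<partial>lborel)"
      unfolding C_def using f by (intro sum.cong refl) (simp add: nn_integral_density mult.commute)
    finally show ?thesis .
  qed
  define s where "s i = sqrt (2 powi i)" for i :: int
  have s0: "s i > 0" for i by (simp add: s_def)
  define E where "E p \<xi> = of_real (s (fst p)) * (cis ((rot (snd p) *v x (fst p)) \<bullet> \<xi> - t (fst p) * (norm \<xi>)\<^sup>2)
      * of_real (exp (- (a / 2) * (norm \<xi>)\<^sup>2)))" for p and \<xi> :: "real^2"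
  define g where "g \<xi> = of_real (exp (a / 2 * (norm \<xi>)\<^sup>2)) * h \<xi>" for \<xi>
  note h[measurable]
  have g[measurable]: "g \<in> borel_measurable borel" unfolding g_def by measurable
  have g_le: "(norm (g \<xi>))\<^sup>2 \<le> exp (a * r\<^sup>2) * (norm (h \<xi>))\<^sup>2" for \<xi>
  proof (cases "norm \<xi> \<le> r")
    case True
    have "(exp (a / 2 * (norm \<xi>)\<^sup>2))\<^sup>2 = exp (a * (norm \<xi>)\<^sup>2)"
      by (simp add: exp_double[symmetric])
    also have "\<dots> \<le> exp (a * r\<^sup>2)"
      using True a by (auto intro!: mult_left_mono power_mono)
    finally show ?thesis
      unfolding g_def norm_mult power_mult_distrib by (intro mult_right_mono) auto
  qed (simp add: g_def supp)
  have g2: "integrable lborel (\<lambda>\<xi>. (norm (g \<xi>))\<^sup>2)"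
  proof (rule Bochner_Integration.integrable_bound)
    show "integrable lborel (\<lambda>\<xi>. exp (a * r\<^sup>2) * (norm (h \<xi>))\<^sup>2)" using h2 by simp
    show "AE \<xi> in lborel. norm ((norm (g \<xi>))\<^sup>2) \<le> norm (exp (a * r\<^sup>2) * (norm (h \<xi>))\<^sup>2)"
      using g_le by (intro AE_I2) simp
  qed measurable
  have g_int: "(\<integral>\<xi>. (norm (g \<xi>))\<^sup>2 \<partial>lborel) \<le> exp (a * r\<^sup>2) * (\<integral>\<xi>. (norm (h \<xi>))\<^sup>2 \<partial>lborel)"
  proof -
    have "(\<integral>\<xi>. (norm (g \<xi>))\<^sup>2 \<partial>lborel) \<le> (\<integral>\<xi>. exp (a * r\<^sup>2) * (norm (h \<xi>))\<^sup>2 \<partial>lborel)"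
      using g2 h2 by (intro integral_mono g_le) auto
    then show ?thesis by simp
  qed
  define B where "B = circle_const / sqrt a"
  have B: "B > 0" using circle_const_pos a by (simp add: B_def)
  have Eg: "(\<integral>\<xi>. E (i, \<theta>) \<xi> * g \<xi> \<partial>lborel) = of_real (s i) * paraboloid_extension h (rot \<theta> *v x i) (t i)" for i \<theta>
  proof -
    have "E (i, \<theta>) \<xi> * g \<xi> = of_real (s i) * (cis ((rot \<theta> *v x i) \<bullet> \<xi> - t i * (norm \<xi>)\<^sup>2) * h \<xi>)" for \<xi>
    proof -
      have "complex_of_real (exp (- (a / 2) * (norm \<xi>)\<^sup>2)) * of_real (exp (a / 2 * (norm \<xi>)\<^sup>2)) = 1"
        unfolding of_real_mult[symmetric] exp_add[symmetric] by simp
      moreover have "E (i, \<theta>) \<xi> * g \<xi> = (complex_of_real (exp (- (a / 2) * (norm \<xi>)\<^sup>2)) * of_real (exp (a / 2 * (norm \<xi>)\<^sup>2)))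
          * (of_real (s i) * (cis ((rot \<theta> *v x i) \<bullet> \<xi> - t i * (norm \<xi>)\<^sup>2) * h \<xi>))"
        unfolding E_def g_def fst_conv snd_conv by (simp only: mult_ac)
      ultimately show ?thesis by (simp only: mult_1)
    qed
    then show ?thesis unfolding paraboloid_extension_def by simp
  qed
  have "(\<integral>\<^sup>+p. ennreal ((norm (\<integral>\<xi>. E p \<xi> * g \<xi> \<partial>lborel))\<^sup>2) \<partial>M) \<le> ennreal (B * (\<integral>\<xi>. (norm (g \<xi>))\<^sup>2 \<partial>lborel))"
  proof (rule schur_TTstar[OF M sigma_finite_lborel])
    show "(\<lambda>(p, \<xi>). E p \<xi>) \<in> borel_measurable (M \<Otimes>\<^sub>M lborel)"
    proof -
      have 1: "(\<lambda>q. E (i, snd (fst q)) (snd q)) \<in> borel_measurable (M \<Otimes>\<^sub>M lborel)" for i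
        unfolding E_def fst_conv snd_conv M_def by measurable
      have "(\<lambda>q. E (fst (fst q), snd (fst q)) (snd q)) \<in> borel_measurable (M \<Otimes>\<^sub>M lborel)"
        by (rule measurable_compose_countable'[where I = I and g = "\<lambda>q. fst (fst q)"])
          (use 1 I in \<open>auto simp: M_def countable_finite intro!: measurable_compose[OF measurable_fst measurable_fst]\<close>)
      then show ?thesis by (simp add: case_prod_unfold)
    qed
    show "norm (E p \<xi>) \<le> (\<Sum>i\<in>I. s i) * exp (- (a / 2) * (norm \<xi>)\<^sup>2)" if "p \<in> space M" for p \<xi>
    proof -
      have "fst p \<in> I" using that by (auto simp: M_def space_pair_measure)
      then have "s (fst p) \<le> (\<Sum>i\<in>I. s i)"
        using I s0 by (intro member_le_sum) (auto intro: less_imp_le)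
      then show ?thesis
        unfolding E_def norm_mult norm_cis norm_of_real using s0[of "fst p"] by (simp add: mult_right_mono)
    qed
    show "0 \<le> (\<Sum>i\<in>I. s i) * exp (- (a / 2) * (norm \<xi>)\<^sup>2)" for \<xi> :: "real^2"
      using s0 by (intro mult_nonneg_nonneg sum_nonneg) (auto intro: less_imp_le)
    have "((\<Sum>i\<in>I. s i) * exp (- (a / 2) * (norm \<xi>)\<^sup>2))\<^sup>2 = (\<Sum>i\<in>I. s i)\<^sup>2 * exp (- a * (norm \<xi>)\<^sup>2)" for \<xi> :: "real^2"
      by (simp add: power_mult_distrib exp_double[symmetric])
    then show "integrable lborel (\<lambda>\<xi>::real^2. ((\<Sum>i\<in>I. s i) * exp (- (a / 2) * (norm \<xi>)\<^sup>2))\<^sup>2)"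
      using integrable_gaussian[OF a, where 'a = "real^2"] by simp
    show "(\<integral>\<^sup>+q. ennreal (norm (\<integral>\<xi>. E p \<xi> * cnj (E q \<xi>) \<partial>lborel)) \<partial>M) \<le> ennreal B" if p: "p \<in> space M" for p
    proof -
      obtain i \<theta> where p_eq: "p = (i, \<theta>)" by (cases p)
      have i: "i \<in> I" using p by (auto simp: p_eq M_def space_pair_measure)
      define K where "K j \<phi> = (\<integral>\<xi>. cis ((rot \<theta> *v x i - rot \<phi> *v x j) \<bullet> \<xi> - (t i - t j) * (norm \<xi>)\<^sup>2)
          * of_real (exp (- a * (norm \<xi>)\<^sup>2)) \<partial>lborel)" for j \<phi>
      have EE: "norm (\<integral>\<xi>. E p \<xi> * cnj (E (j, \<phi>) \<xi>) \<partial>lborel) = s i * s j * norm (K j \<phi>)" for j \<phi>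
      proof -
        have "E p \<xi> * cnj (E (j, \<phi>) \<xi>) = of_real (s i * s j) *
           (cis ((rot \<theta> *v x i - rot \<phi> *v x j) \<bullet> \<xi> - (t i - t j) * (norm \<xi>)\<^sup>2) * of_real (exp (- a * (norm \<xi>)\<^sup>2)))" for \<xi>
        proof -
          define A1 where "A1 = (rot \<theta> *v x i) \<bullet> \<xi> - t i * (norm \<xi>)\<^sup>2"
          define A2 where "A2 = (rot \<phi> *v x j) \<bullet> \<xi> - t j * (norm \<xi>)\<^sup>2"
          have 1: "(rot \<theta> *v x i - rot \<phi> *v x j) \<bullet> \<xi> - (t i - t j) * (norm \<xi>)\<^sup>2 = A1 + - A2"
            by (simp add: A1_def A2_def inner_diff_left algebra_simps)
          have 2: "exp (- a * (norm \<xi>)\<^sup>2) = exp (- (a / 2) * (norm \<xi>)\<^sup>2) * exp (- (a / 2) * (norm \<xi>)\<^sup>2)"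
            by (simp add: exp_add[symmetric])
          show ?thesis
            unfolding 1 2 cis_mult[symmetric] E_def p_eq fst_conv snd_conv A1_def[symmetric] A2_def[symmetric]
            by (simp only: complex_cnj_mult cis_cnj complex_cnj_complex_of_real of_real_mult mult_ac)
        qed
        then show ?thesis
          unfolding K_def using s0[of i] s0[of j] by (simp add: norm_mult)
      qed
      have diag: "(\<integral>\<^sup>+\<phi>\<in>{0..2 * pi}. ennreal (s i * s i * norm (K i \<phi>)) \<partial>lborel) \<le> ennreal (3 * pi\<^sup>2 * sqrt pi / sqrt a)"
      proof -
        define b where "b = (2 powi i)\<^sup>2 / a"
        have b: "b > 0" using a by (simp add: b_def)
        have K: "norm (K i \<phi>) \<le> pi / a * exp (- b * (sin ((\<theta> - \<phi>) / 2))\<^sup>2)" for \<phi>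
        proof -
          have "norm (K i \<phi>) = pi / a * exp (- (norm (rot \<theta> *v x i - rot \<phi> *v x i))\<^sup>2 / (4 * a))"
            unfolding K_def diff_self mult_zero_left diff_zero gaussian_fourier_plane[OF a] norm_of_real
            using a by (simp add: abs_mult)
          also have "\<dots> = pi / a * exp (- ((norm (x i))\<^sup>2 / a * (sin ((\<theta> - \<phi>) / 2))\<^sup>2))"
            unfolding norm_rot_diff by simp
          also have "\<dots> \<le> pi / a * exp (- (b * (sin ((\<theta> - \<phi>) / 2))\<^sup>2))"
            unfolding b_def using a x(1)[OF i]
            by (auto intro!: mult_left_mono mult_right_mono divide_right_mono power_mono)
          finally show ?thesis by simp
        qed
        have "(\<integral>\<^sup>+\<phi>\<in>{0..2 * pi}. ennreal (s i * s i * norm (K i \<phi>)) \<partial>lborel)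
            \<le> (\<integral>\<^sup>+\<phi>. ennreal (2 powi i * (pi / a)) * (ennreal (exp (- b * (sin ((\<theta> - \<phi>) / 2))\<^sup>2)) * indicator {0..2 * pi} \<phi>) \<partial>lborel)"
        proof (rule nn_integral_mono)
          fix \<phi>
          have "s i * s i * norm (K i \<phi>) \<le> 2 powi i * (pi / a) * exp (- b * (sin ((\<theta> - \<phi>) / 2))\<^sup>2)"
            using mult_left_mono[OF K, of "2 powi i" \<phi>] by (simp add: s_def mult.assoc)
          then have "ennreal (s i * s i * norm (K i \<phi>)) \<le> ennreal (2 powi i * (pi / a)) * ennreal (exp (- b * (sin ((\<theta> - \<phi>) / 2))\<^sup>2))"
            using a by (subst ennreal_mult[symmetric]) (auto intro!: ennreal_leI)
          then show "ennreal (s i * s i * norm (K i \<phi>)) * indicator {0..2 * pi} \<phi>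
            \<le> ennreal (2 powi i * (pi / a)) * (ennreal (exp (- b * (sin ((\<theta> - \<phi>) / 2))\<^sup>2)) * indicator {0..2 * pi} \<phi>)"
            by (auto simp: indicator_def)
        qed
        also have "\<dots> = ennreal (2 powi i * (pi / a)) * (\<integral>\<^sup>+\<phi>\<in>{0..2 * pi}. ennreal (exp (- b * (sin ((\<theta> - \<phi>) / 2))\<^sup>2)) \<partial>lborel)"
          by (rule nn_integral_cmult) measurable
        also have "\<dots> \<le> ennreal (2 powi i * (pi / a)) * ennreal (3 * (pi * sqrt (pi / b)))"
          by (intro mult_left_mono nn_integral_circle_gaussian_le b) simp
        also have "\<dots> = ennreal (2 powi i * (pi / a) * (3 * (pi * sqrt (pi / b))))"
          using a b by (subst ennreal_mult) auto
        also have "2 powi i * (pi / a) * (3 * (pi * sqrt (pi / b))) = 3 * pi\<^sup>2 * sqrt pi / sqrt a"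
        proof -
          have "sqrt (pi / b) = sqrt pi * sqrt a / 2 powi i"
            unfolding b_def by (simp add: real_sqrt_divide real_sqrt_mult)
          moreover have "a = sqrt a * sqrt a" using a by simp
          ultimately show ?thesis
            using a by (simp add: field_simps power2_eq_square)
        qed
        finally show ?thesis .
      qed
      have off: "(\<integral>\<^sup>+\<phi>\<in>{0..2 * pi}. ennreal (s i * s j * norm (K j \<phi>)) \<partial>lborel)
          \<le> ennreal (8 * pi\<^sup>2 / sqrt a * (1 / sqrt 2) ^ nat \<bar>i - j\<bar>)" if j: "j \<in> I" "j \<noteq> i" for j
      proof -
        define m where "m = max i j"
        have sij: "s i * s j = 2 powi m * (1 / sqrt 2) ^ nat \<bar>i - j\<bar>"
        proof (cases "i \<le> j")
          case True
          then show ?thesis using sqrt_powi_quotient[OF True] by (simp add: s_def m_def max_def)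
        next
          case False
          then have "j \<le> i" by simp
          from sqrt_powi_quotient[OF this] show ?thesis
            using False by (simp add: s_def m_def max_def mult.commute abs_minus_commute)
        qed
        have K: "norm (K j \<phi>) \<le> 4 * pi / (sqrt a * 2 powi m)" for \<phi>
        proof -
          let ?z = "rot \<theta> *v x i - rot \<phi> *v x j"
          have "2 powi m / 2 \<le> \<bar>norm (x i) - norm (x j)\<bar>"
          proof (cases "i < j")
            case True
            from dyadic_separation[OF sep[OF i j(1) True] x(2)[OF i] x(1)[OF j(1)]] have "2 powi j / 2 \<le> norm (x j) - norm (x i)" .
            moreover have "m = j" using True by (simp add: m_def)
            ultimately show ?thesis by (simp only:)
          next
            case False
            with j have ji: "j < i" by simp
            from dyadic_separation[OF sep[OF j(1) i ji] x(2)[OF j(1)] x(1)[OF i]] have "2 powi i / 2 \<le> norm (x i) - norm (x j)" .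
            moreover have "m = i" using ji by (simp add: m_def)
            ultimately show ?thesis by (simp only:)
          qed
          also have "\<dots> \<le> norm ?z"
            using norm_triangle_ineq3[of "rot \<theta> *v x i" "rot \<phi> *v x j"] by simp
          finally have z: "2 powi m / 2 \<le> norm ?z" .
          have pos: "(2::real) powi m / 2 > 0" by simp
          then have z0: "norm ?z > 0" using z by linarith
          then have "?z \<noteq> 0" by (simp only: zero_less_norm_iff not_False_eq_True)
          from chirp_gaussian_dispersion[OF a this, of "t i - t j"]
          have "norm (K j \<phi>) \<le> 2 * pi / (sqrt a * norm ?z)" unfolding K_def .
          also have "\<dots> \<le> 2 * pi / (sqrt a * (2 powi m / 2))"
            using z a by (intro divide_left_mono mult_left_mono mult_pos_pos z0 pos) auto
          also have "\<dots> = 4 * pi / (sqrt a * 2 powi m)" by simp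
          finally show ?thesis .
        qed
        have "(\<integral>\<^sup>+\<phi>\<in>{0..2 * pi}. ennreal (s i * s j * norm (K j \<phi>)) \<partial>lborel)
            \<le> (\<integral>\<^sup>+\<phi>\<in>{0..2 * pi}. ennreal (4 * pi / sqrt a * (1 / sqrt 2) ^ nat \<bar>i - j\<bar>) \<partial>lborel)"
        proof (intro nn_integral_mono mult_right_mono ennreal_leI)
          fix \<phi>
          have "s i * s j * norm (K j \<phi>) \<le> 2 powi m * (1 / sqrt 2) ^ nat \<bar>i - j\<bar> * (4 * pi / (sqrt a * 2 powi m))"
            unfolding sij by (intro mult_left_mono K) auto
          then show "s i * s j * norm (K j \<phi>) \<le> 4 * pi / sqrt a * (1 / sqrt 2) ^ nat \<bar>i - j\<bar>"
            by (simp add: field_simps)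
        qed simp
        also have "\<dots> = ennreal (4 * pi / sqrt a * (1 / sqrt 2) ^ nat \<bar>i - j\<bar>) * ennreal (2 * pi)"
          by (subst nn_integral_cmult_indicator) auto
        also have "\<dots> = ennreal (8 * pi\<^sup>2 / sqrt a * (1 / sqrt 2) ^ nat \<bar>i - j\<bar>)"
          using a by (subst ennreal_mult[symmetric]) (auto simp: power2_eq_square field_simps)
        finally show ?thesis .
      qed
      have "(\<integral>\<^sup>+q. ennreal (norm (\<integral>\<xi>. E p \<xi> * cnj (E q \<xi>) \<partial>lborel)) \<partial>M)
          = (\<Sum>j\<in>I. \<integral>\<^sup>+\<phi>\<in>{0..2 * pi}. ennreal (s i * s j * norm (K j \<phi>)) \<partial>lborel)"
      proof (subst nn_M)
        have [measurable]: "K j \<in> borel_measurable borel" for j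
          unfolding K_def by measurable
        show "(\<lambda>\<phi>. ennreal (norm (\<integral>\<xi>. E p \<xi> * cnj (E (j, \<phi>) \<xi>) \<partial>lborel))) \<in> borel_measurable borel" for j
          unfolding EE by measurable
      qed (simp only: EE)
      also have "\<dots> = (\<integral>\<^sup>+\<phi>\<in>{0..2 * pi}. ennreal (s i * s i * norm (K i \<phi>)) \<partial>lborel)
          + (\<Sum>j\<in>I - {i}. \<integral>\<^sup>+\<phi>\<in>{0..2 * pi}. ennreal (s i * s j * norm (K j \<phi>)) \<partial>lborel)"
        by (rule sum.remove[OF I i])
      also have "\<dots> \<le> ennreal (3 * pi\<^sup>2 * sqrt pi / sqrt a)
          + (\<Sum>j\<in>I - {i}. ennreal (8 * pi\<^sup>2 / sqrt a * (1 / sqrt 2) ^ nat \<bar>i - j\<bar>))"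
        by (intro add_mono diag sum_mono off) auto
      also have "(\<Sum>j\<in>I - {i}. ennreal (8 * pi\<^sup>2 / sqrt a * (1 / sqrt 2) ^ nat \<bar>i - j\<bar>))
          = ennreal (8 * pi\<^sup>2 / sqrt a * (\<Sum>j\<in>I - {i}. (1 / sqrt 2) ^ nat \<bar>i - j\<bar>))"
        using a by (subst sum_ennreal) (auto simp: sum_distrib_left)
      also have "\<dots> \<le> ennreal (8 * pi\<^sup>2 / sqrt a * (2 / (1 - 1 / sqrt 2)))"
        using I a by (intro ennreal_leI mult_left_mono sum_geometric_dist_le) auto
      also have "ennreal (3 * pi\<^sup>2 * sqrt pi / sqrt a) + \<dots>
          = ennreal (3 * pi\<^sup>2 * sqrt pi / sqrt a + 8 * pi\<^sup>2 / sqrt a * (2 / (1 - 1 / sqrt 2)))"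
        using a by (subst ennreal_plus) auto
      also have "3 * pi\<^sup>2 * sqrt pi / sqrt a + 8 * pi\<^sup>2 / sqrt a * (2 / (1 - 1 / sqrt 2)) = B"
        unfolding B_def circle_const_def by (simp add: add_divide_distrib)
      finally show ?thesis by (simp add: add_left_mono)
    qed
  qed (use g g2 B in auto)
  also have "(\<integral>\<^sup>+p. ennreal ((norm (\<integral>\<xi>. E p \<xi> * g \<xi> \<partial>lborel))\<^sup>2) \<partial>M) = (\<Sum>i\<in>I. ennreal (2 powi i) *
            (\<integral>\<^sup>+\<theta>\<in>{0..2 * pi}. ennreal ((norm (paraboloid_extension h (rot \<theta> *v x i) (t i)))\<^sup>2) \<partial>lborel))"
  proof -
    have [measurable]: "(\<lambda>\<theta>. paraboloid_extension h (rot \<theta> *v x i) (t i)) \<in> borel_measurable borel" for i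
      unfolding paraboloid_extension_def by measurable
    have eq: "ennreal ((norm (\<integral>\<xi>. E (i, \<theta>) \<xi> * g \<xi> \<partial>lborel))\<^sup>2)
        = ennreal (2 powi i) * ennreal ((norm (paraboloid_extension h (rot \<theta> *v x i) (t i)))\<^sup>2)" for i \<theta>
      unfolding Eg by (simp add: norm_mult power_mult_distrib s_def ennreal_mult)
    show ?thesis
      by (subst nn_M) (simp_all add: eq nn_integral_cmult[symmetric] mult.assoc)
  qed
  also have "ennreal (B * (\<integral>\<xi>. (norm (g \<xi>))\<^sup>2 \<partial>lborel))
      \<le> ennreal (circle_const / sqrt a * (exp (a * r\<^sup>2) * (\<integral>\<xi>. (norm (h \<xi>))\<^sup>2 \<partial>lborel)))"
    using B g_int unfolding B_def by (intro ennreal_leI mult_left_mono) auto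
  finally show ?thesis .
qed

section \<open>The maximal estimate\<close>

text \<open>
  A bound for every choice of points, one for each index, passes to the suprema. These need not be attained, so they
  are introduced one index at a time.
\<close>

lemma sum_SUP_le_ennreal:
  fixes c :: "'i \<Rightarrow> 'a \<Rightarrow> ennreal"
  assumes I: "finite I" and Y: "\<And>i. i \<in> I \<Longrightarrow> Y i \<noteq> {}"
    and le: "\<And>y. (\<And>i. i \<in> I \<Longrightarrow> y i \<in> Y i) \<Longrightarrow> (\<Sum>i\<in>I. c i (y i)) \<le> D"
  shows "(\<Sum>i\<in>I. SUP y\<in>Y i. c i y) \<le> D"
proof -
  have "e + (\<Sum>i\<in>I. SUP y\<in>Y i. c i y) \<le> D"
    if "\<And>y. (\<And>i. i \<in> I \<Longrightarrow> y i \<in> Y i) \<Longrightarrow> e + (\<Sum>i\<in>I. c i (y i)) \<le> D" for e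
    using I Y that
  proof (induction I arbitrary: e rule: finite_induct)
    case empty
    then show ?case by simp
  next
    case (insert j I)
    have "e + (\<Sum>i\<in>insert j I. SUP y\<in>Y i. c i y) = (SUP z\<in>Y j. c j z) + (e + (\<Sum>i\<in>I. SUP y\<in>Y i. c i y))"
      using insert.hyps by (simp add: ac_simps)
    also have "\<dots> = (SUP z\<in>Y j. c j z + (e + (\<Sum>i\<in>I. SUP y\<in>Y i. c i y)))"
      using insert.prems(1) by (subst ennreal_SUP_add_left) auto
    also have "\<dots> \<le> D"
    proof (rule SUP_least)
      fix z assume z: "z \<in> Y j"
      have "(c j z + e) + (\<Sum>i\<in>I. SUP y\<in>Y i. c i y) \<le> D"
      proof (rule insert.IH)
        fix y assume y: "\<And>i. i \<in> I \<Longrightarrow> y i \<in> Y i"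
        have "e + (\<Sum>i\<in>insert j I. c i ((y(j := z)) i)) \<le> D"
          using y z by (intro insert.prems(2)) auto
        moreover have "(\<Sum>i\<in>I. c i ((y(j := z)) i)) = (\<Sum>i\<in>I. c i (y i))"
          using insert.hyps by (intro sum.cong) auto
        ultimately show "(c j z + e) + (\<Sum>i\<in>I. c i (y i)) \<le> D"
          using insert.hyps by (simp add: ac_simps)
      qed (use insert.prems in auto)
      then show "c j z + (e + (\<Sum>i\<in>I. SUP y\<in>Y i. c i y)) \<le> D"
        by (simp add: ac_simps)
    qed
    finally show ?case .
  qed
  from this[of 0] show ?thesis using le by simp
qed

definition circle_mass :: "(real^2 \<Rightarrow> complex) \<Rightarrow> real^2 \<Rightarrow> real \<Rightarrow> ennreal" where
  "circle_mass h x t =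
     (\<integral>\<^sup>+\<theta>\<in>{0..2 * pi}. ennreal ((norm (paraboloid_extension h (rot \<theta> *v x) t))\<^sup>2) \<partial>lborel)"

definition dyadic_sup :: "(real^2 \<Rightarrow> complex) \<Rightarrow> int \<Rightarrow> ennreal" where
  "dyadic_sup h i = (SUP p\<in>{x. 2 powi i \<le> norm x \<and> norm x \<le> 2 powi (i + 1)} \<times> UNIV. circle_mass h (fst p) (snd p))"

text \<open>
  The even scales, and likewise the odd ones, are separated in the sense of \<open>separated_circles_estimate\<close>.
\<close>

lemma dyadic_sup_sum_le:
  fixes a r :: real
  assumes I: "finite I" and a: "a > 0"
    and h: "h \<in> borel_measurable borel" and h2: "integrable lborel (\<lambda>\<xi>. (norm (h \<xi>))\<^sup>2)"
    and supp: "\<And>\<xi>. r < norm \<xi> \<Longrightarrow> h \<xi> = 0"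
  shows "(\<Sum>i\<in>I. ennreal (2 powi i) * dyadic_sup h i)
          \<le> ennreal (2 * (circle_const / sqrt a * (exp (a * r\<^sup>2) * (\<integral>\<xi>. (norm (h \<xi>))\<^sup>2 \<partial>lborel))))"
proof -
  let ?Bd = "circle_const / sqrt a * (exp (a * r\<^sup>2) * (\<integral>\<xi>. (norm (h \<xi>))\<^sup>2 \<partial>lborel))"
  let ?Y = "\<lambda>i::int. {x::real^2. 2 powi i \<le> norm x \<and> norm x \<le> 2 powi (i + 1)} \<times> (UNIV :: real set)"
  have sep: "(\<Sum>i\<in>J. ennreal (2 powi i) * dyadic_sup h i) \<le> ennreal ?Bd"
    if J: "finite J" and par: "\<And>i j. i \<in> J \<Longrightarrow> j \<in> J \<Longrightarrow> i < j \<Longrightarrow> i + 2 \<le> j" for J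
  proof -
    have "(\<Sum>i\<in>J. ennreal (2 powi i) * dyadic_sup h i)
        = (\<Sum>i\<in>J. SUP p\<in>?Y i. ennreal (2 powi i) * circle_mass h (fst p) (snd p))"
      unfolding dyadic_sup_def by (simp add: SUP_mult_left_ennreal)
    also have "\<dots> \<le> ennreal ?Bd"
    proof (rule sum_SUP_le_ennreal[OF J])
      show "?Y i \<noteq> {}" for i
      proof -
        have "norm ((2 powi i) *\<^sub>R axis 1 1 :: real^2) = 2 powi i" by (simp add: norm_axis_1)
        moreover have "(2::real) powi i \<le> 2 powi (i + 1)" by (intro power_int_increasing) auto
        ultimately have "((2 powi i) *\<^sub>R axis 1 1, 0) \<in> ?Y i" by simp
        then show ?thesis by blast
      qed
      fix y assume y: "\<And>i. i \<in> J \<Longrightarrow> y i \<in> ?Y i"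
      show "(\<Sum>i\<in>J. ennreal (2 powi i) * circle_mass h (fst (y i)) (snd (y i))) \<le> ennreal ?Bd"
        unfolding circle_mass_def
        by (rule separated_circles_estimate[OF J par _ _ a h h2 supp]) (use y in \<open>auto simp: mem_Times_iff\<close>)
    qed
    finally show ?thesis .
  qed
  have "(\<Sum>i\<in>I. ennreal (2 powi i) * dyadic_sup h i)
      = (\<Sum>i\<in>{i\<in>I. even i}. ennreal (2 powi i) * dyadic_sup h i) + (\<Sum>i\<in>{i\<in>I. odd i}. ennreal (2 powi i) * dyadic_sup h i)"
    using I by (subst sum.union_disjoint[symmetric]) (auto intro!: sum.cong)
  also have "\<dots> \<le> ennreal ?Bd + ennreal ?Bd"
    using I by (intro add_mono sep) (auto, presburger+)
  also have "\<dots> = ennreal (2 * ?Bd)"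
    using circle_const_pos a by (subst ennreal_plus[symmetric]) auto
  finally show ?thesis .
qed

lemma esqrt_mono: "a \<le> b \<Longrightarrow> esqrt a \<le> esqrt b"
  by (cases a; cases b) (auto simp: esqrt_def ennreal_leI top_unique)

lemma esqrt_power2: "(esqrt a)\<^sup>2 = a"
  by (cases a) (auto simp: esqrt_def ennreal_power)

lemma borel_measurable_esqrt [measurable]: "esqrt \<in> borel_measurable borel"
  unfolding esqrt_def[abs_def] by measurable

lemma vector_2_eq: "(vector [x, y] :: real^2) = x *\<^sub>R axis 1 1 + y *\<^sub>R axis 2 1"
  by (simp add: vec_eq_iff forall_2 vector_2 axis_def)

text \<open>
  The essential supremum of a function that is not measurable is \<open>\<infinity>\<close>, so this fact
  carries weight in the final estimate.
\<close>

lemma measurable_circle_mass: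
  assumes [measurable]: "h \<in> borel_measurable borel"
  shows "(\<lambda>p. circle_mass h (vector [x1, fst p]) (snd p)) \<in> borel_measurable (borel :: (real \<times> real) measure)"
proof -
  have "(\<lambda>p. circle_mass h (vector [x1, fst p]) (snd p)) \<in> borel_measurable (borel \<Otimes>\<^sub>M borel)"
    unfolding circle_mass_def paraboloid_extension_def vector_2_eq by measurable
  then show ?thesis by (simp add: borel_prod)
qed

lemma dyadic_index:
  fixes r :: real
  assumes "r > 0"
  obtains i :: int where "2 powi i \<le> r" "r \<le> 2 powi (i + 1)"
proof
  define i where "i = \<lfloor>log 2 r\<rfloor>"
  have "of_int i \<le> log 2 r" "log 2 r \<le> of_int (i + 1)"
    unfolding i_def by linarith+
  then have "2 powr of_int i \<le> r" "r \<le> 2 powr of_int (i + 1)"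
    using assms by (simp_all add: le_log_iff log_le_iff del: of_int_add)
  then show "2 powi i \<le> r" "r \<le> 2 powi (i + 1)"
    by (simp_all add: powr_real_of_int' del: of_int_add)
qed

text \<open>
  A point \<open>x\<close> with first coordinate \<open>x\<^sub>1 \<noteq> 0\<close> lies in a dyadic annulus of outer radius
  \<open>2\<^bsup>i+1\<^esup> \<ge> |x| \<ge> |x\<^sub>1|\<close>. Hence the squared supremum over \<open>x\<^sub>2\<close> and \<open>t\<close> is at most the sum of \<open>dyadic_sup h i\<close> over the \<open>i\<close>
  with \<open>|x\<^sub>1| \<le> 2\<^bsup>i+1\<^esup>\<close>, and integration in \<open>x\<^sub>1\<close> gives each \<open>i\<close> the weight \<open>4 * 2\<^sup>i\<close>.
\<close>

lemma L2_Linf_norm_circle_le: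
  fixes a r :: real
  assumes a: "a > 0"
    and h: "h \<in> borel_measurable borel" and h2: "integrable lborel (\<lambda>\<xi>. (norm (h \<xi>))\<^sup>2)"
    and supp: "\<And>\<xi>. r < norm \<xi> \<Longrightarrow> h \<xi> = 0"
  shows "L2_Linf_norm (\<lambda>x t. esqrt (circle_mass h x t))
          \<le> esqrt (ennreal (8 * (circle_const / sqrt a * (exp (a * r\<^sup>2) * (\<integral>\<xi>. (norm (h \<xi>))\<^sup>2 \<partial>lborel)))))"
proof -
  let ?Bd = "circle_const / sqrt a * (exp (a * r\<^sup>2) * (\<integral>\<xi>. (norm (h \<xi>))\<^sup>2 \<partial>lborel))"
  have Bd0: "?Bd \<ge> 0" using circle_const_pos a by auto
  define J where "J n = {- (2 powi (int_decode n + 1)) .. 2 powi (int_decode n + 1) :: real}" for n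
  define D where "D x1 = (\<Sum>n. dyadic_sup h (int_decode n) * indicator (J n) x1)" for x1 :: real
  have pointwise: "circle_mass h (vector [x1, x2]) t \<le> D x1" if "x1 \<noteq> 0" for x1 x2 t
  proof -
    let ?x = "vector [x1, x2] :: real^2"
    have x1: "\<bar>x1\<bar> \<le> norm ?x"
      using component_le_norm_cart[of ?x 1] by (simp add: vector_2)
    with that have "norm ?x > 0" by linarith
    then obtain i where i: "2 powi i \<le> norm ?x" "norm ?x \<le> 2 powi (i + 1)"
      by (rule dyadic_index)
    define n where "n = int_encode i"
    have n: "int_decode n = i" by (simp add: n_def)
    have "circle_mass h ?x t \<le> dyadic_sup h i"
      unfolding dyadic_sup_def using i by (intro SUP_upper2[of "(?x, t)"]) auto
    also have "\<dots> = (\<Sum>n\<in>{n}. dyadic_sup h (int_decode n) * indicator (J n) x1)"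
      using x1 i by (auto simp: n J_def indicator_def)
    also have "\<dots> \<le> D x1"
      unfolding D_def by (rule sum_le_suminf) auto
    finally show ?thesis .
  qed
  have ess: "(esssup lebesgue (\<lambda>(x2, t). esqrt (circle_mass h (vector [x1, x2]) t)))\<^sup>2 \<le> D x1" if "x1 \<noteq> 0" for x1
  proof -
    have "(\<lambda>p. esqrt (circle_mass h (vector [x1, fst p]) (snd p))) \<in> borel_measurable (borel :: (real \<times> real) measure)"
      using measurable_circle_mass[OF h] by measurable
    then have "(\<lambda>(x2, t). esqrt (circle_mass h (vector [x1, x2]) t)) \<in> borel_measurable lebesgue"
      by (intro measurable_completion) (simp add: case_prod_unfold)
    then have "esssup lebesgue (\<lambda>(x2, t). esqrt (circle_mass h (vector [x1, x2]) t)) \<le> esqrt (D x1)"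
      using pointwise[OF that] by (intro esssup_I AE_I2) (auto intro!: esqrt_mono)
    then have "(esssup lebesgue (\<lambda>(x2, t). esqrt (circle_mass h (vector [x1, x2]) t)))\<^sup>2 \<le> (esqrt (D x1))\<^sup>2"
      by (intro power_mono) auto
    then show ?thesis by (simp only: esqrt_power2)
  qed
  have "(\<integral>\<^sup>+x1. (esssup lebesgue (\<lambda>(x2, t). esqrt (circle_mass h (vector [x1, x2]) t)))\<^sup>2 \<partial>lebesgue)
      \<le> (\<integral>\<^sup>+x1. D x1 \<partial>lborel)"
    unfolding nn_integral_completion
  proof (rule nn_integral_mono_AE)
    \<comment> \<open>for \<open>x1 = 0\<close> the point may be the origin, which lies in no dyadic annulus\<close>
    have "AE x1 in lborel. x1 \<noteq> (0::real)" by (rule AE_lborel_singleton)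
    then show "AE x1 in lborel. (esssup lebesgue (\<lambda>(x2, t). esqrt (circle_mass h (vector [x1, x2]) t)))\<^sup>2 \<le> D x1"
      by eventually_elim (rule ess)
  qed
  also have "\<dots> = (\<Sum>n. \<integral>\<^sup>+x1. dyadic_sup h (int_decode n) * indicator (J n) x1 \<partial>lborel)"
    unfolding D_def J_def by (rule nn_integral_suminf) measurable
  also have "\<dots> = (\<Sum>n. 4 * (ennreal (2 powi int_decode n) * dyadic_sup h (int_decode n)))"
  proof (intro suminf_cong)
    fix n
    have "(\<integral>\<^sup>+x1. dyadic_sup h (int_decode n) * indicator (J n) x1 \<partial>lborel)
        = dyadic_sup h (int_decode n) * ennreal (2 * 2 powi (int_decode n + 1))"
      by (subst nn_integral_cmult_indicator) (auto simp: J_def)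
    also have "2 * 2 powi (int_decode n + 1) = 4 * (2 powi int_decode n :: real)"
      by (simp add: power_int_add)
    also have "dyadic_sup h (int_decode n) * ennreal (4 * 2 powi int_decode n)
        = 4 * (ennreal (2 powi int_decode n) * dyadic_sup h (int_decode n))"
      by (subst ennreal_mult) (auto simp: mult_ac)
    finally show "(\<integral>\<^sup>+x1. dyadic_sup h (int_decode n) * indicator (J n) x1 \<partial>lborel)
        = 4 * (ennreal (2 powi int_decode n) * dyadic_sup h (int_decode n))" .
  qed
  also have "\<dots> = 4 * (\<Sum>n. ennreal (2 powi int_decode n) * dyadic_sup h (int_decode n))"
    by (rule ennreal_suminf_cmult)
  also have "\<dots> \<le> 4 * ennreal (2 * ?Bd)"
  proof (intro mult_left_mono suminf_le_const summableI)
    fix m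
    have "(\<Sum>n<m. ennreal (2 powi int_decode n) * dyadic_sup h (int_decode n))
        = (\<Sum>i\<in>int_decode ` {..<m}. ennreal (2 powi i) * dyadic_sup h i)"
      by (subst sum.reindex) (auto intro: inj_int_decode)
    also have "\<dots> \<le> ennreal (2 * ?Bd)"
      by (rule dyadic_sup_sum_le[OF _ a h h2 supp]) auto
    finally show "(\<Sum>n<m. ennreal (2 powi int_decode n) * dyadic_sup h (int_decode n)) \<le> ennreal (2 * ?Bd)" .
  qed simp
  also have "4 * ennreal (2 * ?Bd) = ennreal (4 * (2 * ?Bd))"
    using Bd0 by (subst (2) ennreal_mult) auto
  also have "4 * (2 * ?Bd) = 8 * ?Bd" by simp
  finally show ?thesis
    unfolding L2_Linf_norm_def by (rule esqrt_mono)
qed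

section \<open>The Schroedinger evolution of a Littlewood--Paley piece\<close>

lemma LP_chi_bounds:
  assumes "LP_bump \<eta>"
  shows "\<bar>LP_chi \<eta> k r\<bar> \<le> 1"
    and "8/5 * 2 powi k < \<bar>r\<bar> \<Longrightarrow> LP_chi \<eta> k r = 0"
    and "LP_chi \<eta> k \<in> borel_measurable borel"
proof -
  have b: "0 \<le> \<eta> s" "\<eta> s \<le> 1" for s using assms by (auto simp: LP_bump_def)
  have z: "\<eta> s = 0" if "\<bar>s\<bar> > 8/5" for s using assms that by (auto simp: LP_bump_def)
  have "\<eta> field_differentiable at r" for r
    using assms unfolding LP_bump_def by (metis funpow_0)
  then have "continuous_on UNIV \<eta>"
    by (intro continuous_at_imp_continuous_on) (auto intro: field_differentiable_imp_continuous_at)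
  then have [measurable]: "\<eta> \<in> borel_measurable borel"
    by (rule borel_measurable_continuous_onI)
  show "LP_chi \<eta> k \<in> borel_measurable borel"
    unfolding LP_chi_def[abs_def] by measurable
  show "\<bar>LP_chi \<eta> k r\<bar> \<le> 1"
    unfolding LP_chi_def using b[of "r / 2 powi k"] b[of "r / 2 powi (k - 1)"] by linarith
  show "LP_chi \<eta> k r = 0" if r: "8/5 * 2 powi k < \<bar>r\<bar>"
  proof -
    have pos: "(2::real) powi k > 0" "(2::real) powi (k - 1) > 0" by simp_all
    have "(2::real) powi (k - 1) \<le> 2 powi k" by (intro power_int_increasing) auto
    with r have r': "8/5 * 2 powi (k - 1) < \<bar>r\<bar>" by linarith
    have "\<bar>r / 2 powi k\<bar> > 8/5" "\<bar>r / 2 powi (k - 1)\<bar> > 8/5"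
      using r r' pos by (simp_all only: abs_divide abs_of_pos pos_less_divide_eq)
    then show ?thesis unfolding LP_chi_def by (simp add: z)
  qed
qed

lemma inverse_fourier_cong_AE:
  assumes "u \<in> borel_measurable lebesgue" "u' \<in> borel_measurable lebesgue" "AE x in lebesgue. u x = u' x"
  shows "inverse_fourier u = inverse_fourier u'"
  unfolding inverse_fourier_def[abs_def] fourier_cong_AE[OF assms] ..

text \<open>
  The projected function need not be integrable, so \<open>fourier\<close> is applied to it in the \<open>L\<^sup>2\<close> sense; by
  \<open>fourier_inverse_fourier_AE\<close> this recovers the truncated transform up to a null set. The equality with the
  extension operator nevertheless holds at every point, because the last step is an absolutely convergent integral.
\<close>

lemma schroedinger_LP_proj_eq_extension:
  fixes u0 :: "real^2 \<Rightarrow> complex"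
  assumes \<eta>: "LP_bump \<eta>" and u0: "square_integrable u0"
  obtains h where "h \<in> borel_measurable borel" "integrable lborel (\<lambda>\<xi>. (norm (h \<xi>))\<^sup>2)"
    "\<And>\<xi>. 8/5 * 2 powi k < norm \<xi> \<Longrightarrow> h \<xi> = 0"
    "(\<integral>\<xi>. (norm (h \<xi>))\<^sup>2 \<partial>lborel) \<le> (L2_norm u0)\<^sup>2"
    "\<And>x t. schroedinger t (LP_proj \<eta> k u0) x = paraboloid_extension h x t"
proof -
  obtain u where u[measurable]: "u \<in> borel_measurable borel" and u0_u: "AE x in lebesgue. u0 x = u x"
    using u0 borel_representative unfolding square_integrable_def by blast
  have u0_leb: "u0 \<in> borel_measurable lebesgue" and u0_2: "integrable lebesgue (\<lambda>x. (norm (u0 x))\<^sup>2)"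
    using u0 by (auto simp: square_integrable_def)
  have u_leb: "u \<in> borel_measurable lebesgue" by (rule measurable_completion) simp
  have sq: "AE x in lebesgue. (norm (u0 x))\<^sup>2 = (norm (u x))\<^sup>2"
    using u0_u by eventually_elim simp
  have sq_meas: "(\<lambda>x. (norm (u0 x))\<^sup>2) \<in> borel_measurable lebesgue" "(\<lambda>x. (norm (u x))\<^sup>2) \<in> borel_measurable lebesgue"
    using u0_leb u_leb by measurable
  have "integrable lebesgue (\<lambda>x. (norm (u x))\<^sup>2)"
    using u0_2 integrable_cong_AE[OF sq_meas sq] by simp
  then have u2: "integrable lborel (\<lambda>x. (norm (u x))\<^sup>2)"
    by (subst (asm) integrable_completion) auto
  have "(\<integral>x. (norm (u0 x))\<^sup>2 \<partial>lebesgue) = (\<integral>x. (norm (u x))\<^sup>2 \<partial>lborel)"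
    using integral_cong_AE[OF sq_meas sq] by (simp add: integral_completion)
  then have L2: "(\<integral>x. (norm (u x))\<^sup>2 \<partial>lborel) = (L2_norm u0)\<^sup>2"
    unfolding L2_norm_def by simp
  define U where "U = fourier u0"
  have U_eq: "U = fourier u" unfolding U_def by (rule fourier_cong_AE[OF u0_leb u_leb u0_u])
  have U_leb[measurable]: "U \<in> borel_measurable lebesgue"
    using square_integrable_fourier(1)[OF u u2] by (simp add: U_eq square_integrable_def)
  obtain U' where U'[measurable]: "U' \<in> borel_measurable borel" and U_U': "AE x in lebesgue. U x = U' x"
    using borel_representative[OF U_leb] by blast
  have U'2: "(\<integral>\<^sup>+\<xi>. ennreal ((norm (U' \<xi>))\<^sup>2) \<partial>lborel) \<le> ennreal (2 * (2 * pi)\<^sup>2 * (L2_norm u0)\<^sup>2)"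
  proof -
    have "(\<integral>\<^sup>+\<xi>. ennreal ((norm (U' \<xi>))\<^sup>2) \<partial>lborel) = (\<integral>\<^sup>+\<xi>. ennreal ((norm (U' \<xi>))\<^sup>2) \<partial>lebesgue)"
      by (simp add: nn_integral_completion)
    also have "\<dots> = (\<integral>\<^sup>+\<xi>. ennreal ((norm (U \<xi>))\<^sup>2) \<partial>lebesgue)"
      using U_U' by (intro nn_integral_cong_AE) (auto elim: eventually_mono)
    also have "\<dots> \<le> ennreal (2 * (2 * pi)\<^sup>2 * (L2_norm u0)\<^sup>2)"
      using square_integrable_fourier(2)[OF u u2] by (simp only: U_eq L2)
    finally show ?thesis .
  qed
  define \<mu> where "\<mu> \<xi> = complex_of_real (LP_chi \<eta> k (norm \<xi>))" for \<xi> :: "real^2"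
  note [measurable] = LP_chi_bounds(3)[OF \<eta>, of k]
  have [measurable]: "\<mu> \<in> borel_measurable borel" unfolding \<mu>_def by measurable
  have \<mu>_leb[measurable]: "\<mu> \<in> borel_measurable lebesgue" by (rule measurable_completion) simp
  have \<mu>_le: "norm (\<mu> \<xi>) \<le> 1" for \<xi>
    using LP_chi_bounds(1)[OF \<eta>] by (simp add: \<mu>_def)
  have \<mu>_0: "\<mu> \<xi> = 0" if "8/5 * 2 powi k < norm \<xi>" for \<xi>
    using LP_chi_bounds(2)[OF \<eta>, of k "norm \<xi>"] that by (simp add: \<mu>_def)
  define H where "H \<xi> = \<mu> \<xi> * U' \<xi>" for \<xi>
  have H[measurable]: "H \<in> borel_measurable borel" unfolding H_def by measurable
  have H_leb[measurable]: "H \<in> borel_measurable lebesgue" by (rule measurable_completion) simp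
  have H_nn: "(\<integral>\<^sup>+\<xi>. ennreal ((norm (H \<xi>))\<^sup>2) \<partial>lborel) \<le> ennreal (2 * (2 * pi)\<^sup>2 * (L2_norm u0)\<^sup>2)"
  proof -
    have "norm (H \<xi>) \<le> norm (U' \<xi>)" for \<xi>
      unfolding H_def norm_mult using \<mu>_le[of \<xi>] by (simp add: mult_left_le_one_le)
    then have "(\<integral>\<^sup>+\<xi>. ennreal ((norm (H \<xi>))\<^sup>2) \<partial>lborel) \<le> (\<integral>\<^sup>+\<xi>. ennreal ((norm (U' \<xi>))\<^sup>2) \<partial>lborel)"
      by (intro nn_integral_mono ennreal_leI power_mono) auto
    then show ?thesis using U'2 by (rule order_trans)
  qed
  have H2: "integrable lborel (\<lambda>\<xi>. (norm (H \<xi>))\<^sup>2)"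
    using H_nn by (intro integrableI_bounded) (auto intro: le_less_trans)
  have H_int: "(\<integral>\<xi>. (norm (H \<xi>))\<^sup>2 \<partial>lborel) \<le> 2 * (2 * pi)\<^sup>2 * (L2_norm u0)\<^sup>2"
    using H_nn by (subst (asm) nn_integral_eq_integral[OF H2]) (auto simp: ennreal_le_iff)
  have H1: "integrable lborel H"
  proof -
    have "indicator (ball 0 (2 * 2 powi k)) \<xi> * H \<xi> = H \<xi>" for \<xi>
    proof (cases "norm \<xi> < 2 * 2 powi k")
      case False
      moreover have "(2::real) powi k > 0" by simp
      ultimately have "8/5 * 2 powi k < norm \<xi>" by linarith
      then show ?thesis by (simp add: H_def \<mu>_0)
    qed simp
    then show ?thesis
      using indicator_ball_mult_L1_L2(1)[OF H H2, of "2 * 2 powi k"] by (simp only:)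
  qed
  have P: "LP_proj \<eta> k u0 = inverse_fourier H"
  proof -
    have "LP_proj \<eta> k u0 = inverse_fourier (\<lambda>\<xi>. \<mu> \<xi> * U \<xi>)"
      unfolding LP_proj_def fourier_multiplier_def \<mu>_def U_def ..
    also have "\<dots> = inverse_fourier H"
    proof (rule inverse_fourier_cong_AE)
      show "AE \<xi> in lebesgue. \<mu> \<xi> * U \<xi> = H \<xi>"
        using U_U' by eventually_elim (simp add: H_def)
    qed measurable
    finally show ?thesis .
  qed
  define W where "W = inverse_fourier H"
  have W[measurable]: "W \<in> borel_measurable borel" and W2: "integrable lborel (\<lambda>x. (norm (W x))\<^sup>2)"
    using square_integrable_inverse_fourier[OF H H1 H2] by (simp_all add: W_def)
  have FW: "AE \<xi> in lebesgue. fourier W \<xi> = H \<xi>"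
    unfolding W_def by (rule fourier_inverse_fourier_AE[OF H H1 H2])
  have FW_leb[measurable]: "fourier W \<in> borel_measurable lebesgue"
    using square_integrable_fourier(1)[OF W W2] by (simp add: square_integrable_def)
  define h where "h \<xi> = of_real (1 / (2 * pi)\<^sup>2) * H \<xi>" for \<xi>
  show ?thesis
  proof
    show "h \<in> borel_measurable borel" unfolding h_def by measurable
    have h_sq: "(norm (h \<xi>))\<^sup>2 = (1 / (2 * pi)\<^sup>2)\<^sup>2 * (norm (H \<xi>))\<^sup>2" for \<xi>
      unfolding h_def norm_mult power_mult_distrib norm_of_real by simp
    show "integrable lborel (\<lambda>\<xi>. (norm (h \<xi>))\<^sup>2)" unfolding h_sq using H2 by simp
    show "h \<xi> = 0" if "8/5 * 2 powi k < norm \<xi>" for \<xi>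
      by (simp add: h_def H_def \<mu>_0[OF that])
    have "(\<integral>\<xi>. (norm (h \<xi>))\<^sup>2 \<partial>lborel) = (1 / (2 * pi)\<^sup>2)\<^sup>2 * (\<integral>\<xi>. (norm (H \<xi>))\<^sup>2 \<partial>lborel)"
      unfolding h_sq by simp
    also have "\<dots> \<le> (1 / (2 * pi)\<^sup>2)\<^sup>2 * (2 * (2 * pi)\<^sup>2 * (L2_norm u0)\<^sup>2)"
      by (intro mult_left_mono H_int) auto
    also have "\<dots> = 1 / (2 * pi\<^sup>2) * (L2_norm u0)\<^sup>2"
      by (simp add: power2_eq_square field_simps)
    also have "\<dots> \<le> 1 * (L2_norm u0)\<^sup>2"
    proof (rule mult_right_mono)
      have "1 \<le> pi\<^sup>2" using pi_gt3 by (simp add: power2_eq_square mult_ge1_I)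
      then show "1 / (2 * pi\<^sup>2) \<le> 1" by simp
    qed simp
    finally show "(\<integral>\<xi>. (norm (h \<xi>))\<^sup>2 \<partial>lborel) \<le> (L2_norm u0)\<^sup>2" by simp
    show "schroedinger t (LP_proj \<eta> k u0) x = paraboloid_extension h x t" for x t
    proof -
      define e where "e \<xi> = cis (- t * (norm \<xi>)\<^sup>2)" for \<xi> :: "real^2"
      have e[measurable]: "e \<in> borel_measurable borel" unfolding e_def by measurable
      have e_leb[measurable]: "e \<in> borel_measurable lebesgue" by (rule measurable_completion) simp
      have "schroedinger t (LP_proj \<eta> k u0) x = inverse_fourier (\<lambda>\<xi>. e \<xi> * fourier W \<xi>) x"
        unfolding P W_def schroedinger_def fourier_multiplier_def e_def ..
      also have "inverse_fourier (\<lambda>\<xi>. e \<xi> * fourier W \<xi>) = inverse_fourier (\<lambda>\<xi>. e \<xi> * H \<xi>)"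
      proof (rule inverse_fourier_cong_AE)
        show "AE \<xi> in lebesgue. e \<xi> * fourier W \<xi> = e \<xi> * H \<xi>"
          using FW by eventually_elim simp
      qed measurable
      also have "inverse_fourier (\<lambda>\<xi>. e \<xi> * H \<xi>) x = of_real (1 / (2 * pi)\<^sup>2) * fourier_integral (\<lambda>\<xi>. e \<xi> * H \<xi>) (- x)"
        unfolding e_def by (intro inverse_fourier_eq integrable_cis_mult H1) measurable
      also have "fourier_integral (\<lambda>\<xi>. e \<xi> * H \<xi>) (- x) = (\<integral>\<xi>. cis (- (\<xi> \<bullet> (- x))) * (e \<xi> * H \<xi>) \<partial>lborel)"
        by (rule fourier_integral_lborel) measurable
      also have "of_real (1 / (2 * pi)\<^sup>2) * \<dots> = (\<integral>\<xi>. of_real (1 / (2 * pi)\<^sup>2) * (cis (- (\<xi> \<bullet> (- x))) * (e \<xi> * H \<xi>)) \<partial>lborel)"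
        by (rule integral_mult_right_zero[symmetric])
      also have "\<dots> = paraboloid_extension h x t"
        unfolding paraboloid_extension_def
      proof (intro Bochner_Integration.integral_cong refl)
        fix \<xi> :: "real^2"
        have "cis (x \<bullet> \<xi> - t * (norm \<xi>)\<^sup>2) = cis (- (\<xi> \<bullet> (- x))) * e \<xi>"
          unfolding e_def cis_mult by (simp add: inner_commute)
        then show "of_real (1 / (2 * pi)\<^sup>2) * (cis (- (\<xi> \<bullet> (- x))) * (e \<xi> * H \<xi>)) = cis (x \<bullet> \<xi> - t * (norm \<xi>)\<^sup>2) * h \<xi>"
          unfolding h_def by (simp only: mult_ac)
      qed
      finally show ?thesis .
    qed
  qed
qed

theorem theorem1p1:
  fixes \<eta> :: "real \<Rightarrow> real"
  assumes "LP_bump \<eta>"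
  shows "\<exists>C::real. C > 0 \<and>
           (\<forall>(k::int) (u0 :: real^2 \<Rightarrow> complex). square_integrable u0 \<longrightarrow>
              L2_Linf_L2_norm (\<lambda>x t. schroedinger t (LP_proj \<eta> k u0) x)
                \<le> ennreal (C * 2 powr (of_int k / 2) * L2_norm u0))"
proof (intro exI conjI allI impI)
  define c where "c = 8 * (circle_const * exp (64 / 25))"
  have c: "c > 0" using circle_const_pos by (simp add: c_def)
  show "sqrt c > 0" using c by simp
  fix k :: int and u0 :: "real^2 \<Rightarrow> complex"
  assume u0: "square_integrable u0"
  obtain h where h: "h \<in> borel_measurable borel" "integrable lborel (\<lambda>\<xi>. (norm (h \<xi>))\<^sup>2)"
    "\<And>\<xi>. 8/5 * 2 powi k < norm \<xi> \<Longrightarrow> h \<xi> = 0"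
    and h_le: "(\<integral>\<xi>. (norm (h \<xi>))\<^sup>2 \<partial>lborel) \<le> (L2_norm u0)\<^sup>2"
    and ext: "\<And>x t. schroedinger t (LP_proj \<eta> k u0) x = paraboloid_extension h x t"
    using schroedinger_LP_proj_eq_extension[OF assms u0, of k] by blast
  define N where "N = (2::real) powi k"
  have N: "N > 0" by (simp add: N_def)
  \<comment> \<open>the Gaussian weight then has the width of the frequency support: \<open>a r\<^sup>2 = 64 / 25\<close> for every \<open>k\<close>\<close>
  define a where "a = 1 / N\<^sup>2"
  have a: "a > 0" using N by (simp add: a_def)
  have L0: "L2_norm u0 \<ge> 0"
    unfolding L2_norm_def by (intro real_sqrt_ge_zero Bochner_Integration.integral_nonneg) auto
  have "angular_L2 (\<lambda>x t. schroedinger t (LP_proj \<eta> k u0) x) = (\<lambda>x t. esqrt (circle_mass h x t))"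
    unfolding angular_L2_def[abs_def] circle_mass_def ext nn_integral_completion ..
  then have "L2_Linf_L2_norm (\<lambda>x t. schroedinger t (LP_proj \<eta> k u0) x)
      = L2_Linf_norm (\<lambda>x t. esqrt (circle_mass h x t))"
    unfolding L2_Linf_L2_norm_def by simp
  also have "\<dots> \<le> esqrt (ennreal (8 * (circle_const / sqrt a * (exp (a * (8/5 * 2 powi k)\<^sup>2) * (\<integral>\<xi>. (norm (h \<xi>))\<^sup>2 \<partial>lborel)))))"
    by (rule L2_Linf_norm_circle_le[OF a h])
  also have "8 * (circle_const / sqrt a * (exp (a * (8/5 * 2 powi k)\<^sup>2) * (\<integral>\<xi>. (norm (h \<xi>))\<^sup>2 \<partial>lborel)))
      = c * N * (\<integral>\<xi>. (norm (h \<xi>))\<^sup>2 \<partial>lborel)"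
  proof -
    have 1: "sqrt a = 1 / N" using N by (simp add: a_def real_sqrt_divide)
    have 2: "a * (8/5 * 2 powi k)\<^sup>2 = 64 / 25"
      using N unfolding N_def[symmetric] a_def by (simp add: power2_eq_square)
    show ?thesis unfolding 1 2 c_def by simp
  qed
  also have "esqrt (ennreal (c * N * (\<integral>\<xi>. (norm (h \<xi>))\<^sup>2 \<partial>lborel))) \<le> esqrt (ennreal (c * N * (L2_norm u0)\<^sup>2))"
    using c N h_le by (intro esqrt_mono ennreal_leI mult_left_mono) auto
  also have "\<dots> = ennreal (sqrt (c * N * (L2_norm u0)\<^sup>2))"
    using c N by (simp add: esqrt_def)
  also have "sqrt (c * N * (L2_norm u0)\<^sup>2) = sqrt c * 2 powr (of_int k / 2) * L2_norm u0"
  proof -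
    have "sqrt N = 2 powr (of_int k / 2)"
      unfolding N_def by (simp add: powr_real_of_int'[symmetric] powr_half_sqrt[symmetric] powr_powr)
    then show ?thesis using L0 by (simp add: real_sqrt_mult)
  qed
  finally show "L2_Linf_L2_norm (\<lambda>x t. schroedinger t (LP_proj \<eta> k u0) x)
      \<le> ennreal (sqrt c * 2 powr (of_int k / 2) * L2_norm u0)" .
qed

end
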